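(* Let $h$ be univalent and analytic in $\mathbb H$ with $\lim_{z\to\infty}h(z)=\infty$ and let $h(\mathbb H)$ be a Jordan domain. Let $h$ satisfy $$\lim_{\mathrm{Re}\,z\to0^+}\tfrac12(2\,\mathrm{Re}\,z)^2\,|Sh(z)|=0.$$ Suppose that (B): $h$ is locally quasiconformally extendible to a neighborhood of $\infty$. Let $\tau_0>0$ be the constant described in the context (for some fixed $k\in(0,1)$). Then there is a positive constant $\tau\le\tau_0$ such that the analytic function $h_t$ on $\mathbb H$ defined by $$h_t(z)=h(z+t)-\frac{2t\,h'(z+t)}{1+t\,Ph(z+t)}$$ is univalent for all $0\le t\le\tau$.
   Context: $\mathbb H=\{z=x+iy\in\mathbb C:x>0\}$ is the right half-plane. $Pf:=f''/f'$ is the pre-Schwarzian derivative and $Sf:=(Pf)'-(Pf)^2/2$ the Schwarzian derivative of a locally univalent analytic $f$. The limit $\lim_{\mathrm{Re}\,z\to0^+}$ is uniform in $\mathrm{Im}\,z$: the supremum over $0<\mathrm{Re}\,z\le t$ tends to $0$ as $t\to0^+$. A Jordan domain is a domain in $\overline{\mathbb C}$ bounded by a Jordan curve of $\overline{\mathbb C}$. Condition (B) means: for some $M>0$, $h$ has a quasiconformal extension to $\{z\in\mathbb C:|z|>M\}$, i.e. there is a quasiconformal mapping of $\{z\in\mathbb C:|z|>M\}$ into $\mathbb C$ which coincides with $h$ on $\{z\in\mathbb H:|z|>M\}$ and tends to $\infty$ as $z\to\infty$. The constant $\tau_0$: if $h$ is univalent and analytic in $\mathbb H$ with $\lim_{z\to\infty}h(z)=\infty$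 and $\lim_{\mathrm{Re}\,z\to0^+}\tfrac12(2\,\mathrm{Re}\,z)^2\,|Sh(z)|=0$, then for any $0<k<1$ there is $\tau_0>0$ such that for $0\le t\le\tau_0$ the functions $h_t(z)=h(z+t)-\frac{2t\,h'(z+t)}{1+t\,Ph(z+t)}$ are analytic on $\mathbb H$ and the family satisfies $h_0=h$ and $\frac{\partial}{\partial t}h_t(z)=-p(z,t)\,h_t'(z)$, where $h_t'=\frac{d h_t}{dz}$, for a Herglotz function $p$ with $\left|\frac{p(z,t)-1}{p(z,t)+1}\right|\le k$ for $z\in\mathbb H$, $0\le t\le\tau_0$. (A Herglotz function is one that is locally integrable in $t$ for each $z$, and analytic in $z$ with non-negative real part for almost every $t$.) Fix such a $k$ and $\tau_0$. *)

theory Defs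
  imports "HOL-Analysis.Analysis"
begin

definition right_half_plane :: "complex set" where
  "right_half_plane = {z. 0 < Re z}"

definition univalent_on :: "(complex \<Rightarrow> complex) \<Rightarrow> complex set \<Rightarrow> bool" where
  "univalent_on f S \<longleftrightarrow> f holomorphic_on S \<and> inj_on f S"

definition pre_schwarzian :: "(complex \<Rightarrow> complex) \<Rightarrow> complex \<Rightarrow> complex" where
  "pre_schwarzian f z = deriv (deriv f) z / deriv f z"

definition schwarzian :: "(complex \<Rightarrow> complex) \<Rightarrow> complex \<Rightarrow> complex" where
  "schwarzian f z = deriv (pre_schwarzian f) z - (pre_schwarzian f z)\<^sup>2 / 2"

(* The limit is uniform in Im z.  The supremum is taken in ereal, since it may be infinite. *)
definition schwarzian_vanishes_at_boundary :: "(complex \<Rightarrow> complex) \<Rightarrow> bool" where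
  "schwarzian_vanishes_at_boundary h \<longleftrightarrow>
     ((\<lambda>t::real. SUP z\<in>{z. 0 < Re z \<and> Re z \<le> t}.
          ereal (1/2 * (2 * Re z)\<^sup>2 * cmod (schwarzian h z))) \<longlongrightarrow> 0) (at_right 0)"


subsection \<open>Jordan domains of the Riemann sphere\<close>

(* The point at infinity is None; a finite point w is Some w. *)
definition riemann_sphere :: "complex option topology" where
  "riemann_sphere = Alexandroff_compactification euclidean"

definition jordan_curve :: "complex option set \<Rightarrow> bool" where
  "jordan_curve J \<longleftrightarrow>
     J \<subseteq> topspace riemann_sphere \<and>
     subtopology riemann_sphere J homeomorphic_space top_of_set (sphere (0::complex) 1)"

definition jordan_domain :: "complex option set \<Rightarrow> bool" where
  "jordan_domain D \<longleftrightarrow>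
     D \<noteq> {} \<and> openin riemann_sphere D \<and> connectedin riemann_sphere D \<and>
     jordan_curve (riemann_sphere frontier_of D)"


subsection \<open>Quasiconformal mappings\<close>

(* For a finite family d of non-overlapping compact intervals [u,v], the premise bounds the
   sum of v - u and the conclusion the sum of |f(v) - f(u)|. *)
definition abs_continuous_on_interval :: "(real \<Rightarrow> complex) \<Rightarrow> real \<Rightarrow> real \<Rightarrow> bool" where
  "abs_continuous_on_interval f a b \<longleftrightarrow>
     (\<forall>\<epsilon>>0. \<exists>\<delta>>0. \<forall>d t. d division_of t \<and> t \<subseteq> {a..b} \<and> (\<Sum>I\<in>d. Sup I - Inf I) < \<delta> \<longrightarrow>
        (\<Sum>I\<in>d. cmod (f (Sup I) - f (Inf I))) < \<epsilon>)"

(* Absolute continuity on lines: in every closed rectangle contained in S, f is absolutely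
   continuous on almost every horizontal and almost every vertical segment. *)
definition ACL_on :: "(complex \<Rightarrow> complex) \<Rightarrow> complex set \<Rightarrow> bool" where
  "ACL_on f S \<longleftrightarrow>
     (\<forall>u v. cbox u v \<subseteq> S \<longrightarrow>
        (AE y in lebesgue. y \<in> {Im u..Im v} \<longrightarrow>
            abs_continuous_on_interval (\<lambda>x. f (Complex x y)) (Re u) (Re v)) \<and>
        (AE x in lebesgue. x \<in> {Re u..Re v} \<longrightarrow>
            abs_continuous_on_interval (\<lambda>y. f (Complex x y)) (Im u) (Im v)))"

(* Ahlfors' analytic definition: a homeomorphism onto its image that is ACL and satisfies
   |f_zbar| <= k |f_z| almost everywhere for some constant k < 1.  Below a = f_x and b = f_y, so
   f_z = (a - i b) / 2 and f_zbar = (a + i b) / 2.  Since k < 1, such mappings are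
   orientation preserving. *)
definition quasiconformal_on :: "(complex \<Rightarrow> complex) \<Rightarrow> complex set \<Rightarrow> bool" where
  "quasiconformal_on f S \<longleftrightarrow>
     open S \<and> (\<exists>g. homeomorphism S (f ` S) f g) \<and> ACL_on f S \<and>
     (\<exists>k. 0 \<le> k \<and> k < 1 \<and>
        (AE z in lebesgue. z \<in> S \<longrightarrow>
          (\<exists>a b. ((\<lambda>s. f (z + of_real s)) has_vector_derivative a) (at 0) \<and>
                 ((\<lambda>s. f (z + \<i> * of_real s)) has_vector_derivative b) (at 0) \<and>
                 cmod ((a + \<i> * b) / 2) \<le> k * cmod ((a - \<i> * b) / 2))))"

(* Condition (B). *)
definition locally_qc_extendible_at_infinity :: "(complex \<Rightarrow> complex) \<Rightarrow> bool" where
  "locally_qc_extendible_at_infinity h \<longleftrightarrow>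
     (\<exists>M>0. \<exists>F. quasiconformal_on F {z. M < cmod z} \<and>
        (\<forall>z\<in>right_half_plane. M < cmod z \<longrightarrow> F z = h z) \<and>
        filterlim F at_infinity at_infinity)"


subsection \<open>The family and its Loewner equation\<close>

definition h_family :: "(complex \<Rightarrow> complex) \<Rightarrow> real \<Rightarrow> complex \<Rightarrow> complex" where
  "h_family h t z =
     h (z + of_real t) -
       2 * of_real t * deriv h (z + of_real t) / (1 + of_real t * pre_schwarzian h (z + of_real t))"

(* On a compact time interval, local integrability in t is integrability. *)
definition herglotz_function :: "real \<Rightarrow> (complex \<Rightarrow> real \<Rightarrow> complex) \<Rightarrow> bool" where
  "herglotz_function T p \<longleftrightarrow>
     (\<forall>z\<in>right_half_plane. (\<lambda>t. p z t) absolutely_integrable_on {0..T}) \<and>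
     (AE t in lebesgue. t \<in> {0..T} \<longrightarrow>
        (\<lambda>z. p z t) holomorphic_on right_half_plane \<and> (\<forall>z\<in>right_half_plane. 0 \<le> Re (p z t)))"

(* T has the property required of the constant tau_0 for the given k.  Since x / 0 = 0 in HOL,
   the non-vanishing of the denominators, which is part of the analyticity of h_t and of the
   bound on (p - 1) / (p + 1), is stated explicitly.  At t = 0 and t = T the time derivative
   is one-sided. *)
definition loewner_constant :: "(complex \<Rightarrow> complex) \<Rightarrow> real \<Rightarrow> real \<Rightarrow> bool" where
  "loewner_constant h k T \<longleftrightarrow>
     0 < T \<and>
     (\<forall>t\<in>{0..T}. h_family h t holomorphic_on right_half_plane \<and>
        (\<forall>z\<in>right_half_plane. 1 + of_real t * pre_schwarzian h (z + of_real t) \<noteq> 0)) \<and>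
     (\<forall>z\<in>right_half_plane. h_family h 0 z = h z) \<and>
     (\<exists>p. herglotz_function T p \<and>
        (\<forall>z\<in>right_half_plane. \<forall>t\<in>{0..T}.
           ((\<lambda>s. h_family h s z) has_vector_derivative - p z t * deriv (h_family h t) z)
             (at t within {0..T}) \<and>
           p z t + 1 \<noteq> 0 \<and> cmod ((p z t - 1) / (p z t + 1)) \<le> k))"

end

theory Submission
  imports Defs "HOL-Complex_Analysis.Complex_Analysis"
begin

text \<open>
  Let \<open>N\<^sub>c = (h - c) / (h' - (h - c) Ph / 2)\<close>. Then \<open>N\<^sub>c' = 1 + (Sh / 2) N\<^sub>c\<^sup>2\<close>, and
  \<open>h\<^sub>t(z) = c\<close> holds iff \<open>N\<^sub>c(z + t) = 2t\<close>. Where \<open>Sh\<close> is small, the solutions \<open>N\<^sub>c\<close> almost are translations;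
  hence \<open>h\<^sub>t\<close> is injective at a fixed scale \<open>\<delta>\<close> near the imaginary axis, and \<open>|h\<^sub>t(z) - h(z + t)|\<close> is at most
  \<open>C \<surd>t |h(w) - h(z + t)|\<close> for all \<open>w\<close> at distance at least \<open>\<delta>\<close> from \<open>z + t\<close>, provided that
  \<open>|h(z') - h(z)| \<le> C |h(w) - h(z)|\<close> whenever \<open>|z' - z| \<le> \<delta>/4\<close> and \<open>|w - z| \<ge> \<delta>\<close> (weak quasisymmetry at scale \<open>\<delta>\<close>).
  For small \<open>t\<close> the latter separates \<open>h\<^sub>t(z)\<close> from \<open>h\<^sub>t(w)\<close> for distant points. For close points in the
  interior one applies the maximum principle to the quotient of \<open>h\<^sub>t(w) - h\<^sub>t(z)\<close> by \<open>h(w + t) - h(z + t)\<close>.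

  Weak quasisymmetry is a compactness statement for bounded \<open>z\<close>, as \<open>h\<close> extends to an injective continuous map
  of the closed half-plane: boundary values exist by the same differential equation, and they are
  distinct because \<open>h(H)\<close> is a Jordan domain. For \<open>z\<close> near \<open>\<infinity>\<close> it follows from the quasiconformal
  extension by a length-area argument on the boundaries of concentric squares.
\<close>

text \<open>The function N_c, which is \<open>quo c\<close> below, solves the Riccati equation that
  belongs to y'' + (Sh/2) y = 0: for y = (h - c) / sqrt h' one has N_c = y / y', and the root
  cancels.

  The obstacle is the region near the axis. There t need not be small against Re (z + t), so Cauchy
  estimates for h' and Ph at z + t do not bring h_t(z) close to h(z + t), whereas (Re z)^2 |Sh| is
  small uniformly. The Riccati equation transports the problem to a point at a fixed distance from z
  + t. Two solutions that differ by 2t at z + t, where the real part exceeds t, grow apart at most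
  like the square root of the real part; this produces the factor sqrt t.

  What remains is to compare values of h at points whose mutual distances are fixed, uniformly in z
  and without any control of the size of h. That is exactly what weak quasisymmetry at one scale
  says. Compactness yields it for bounded z and fails as z tends to infinity, which is where
  condition (B) enters.\<close>

definition strip :: "real \<Rightarrow> complex set" where
  "strip X = {z. 0 < Re z \<and> Re z < X}"

lemma open_strip: "open (strip X)"
  unfolding strip_def by (simp add: open_Collect_conj open_halfspace_Re_gt open_halfspace_Re_lt)

lemma convex_strip: "convex (strip X)"
  unfolding strip_def by (intro convex_Int[of "{z. 0 < Re z}" "{z. Re z < X}", unfolded Int_def, simplified]
      convex_halfspace_Re_gt convex_halfspace_Re_lt)

section \<open>The Riccati equation of a function with small Schwarzian derivative\<close>

locale small_schwarzian_strip =
  fixes f :: "complex \<Rightarrow> complex" and X :: real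
  assumes holo: "f holomorphic_on strip X"
    and deriv_nz: "\<And>z. z \<in> strip X \<Longrightarrow> deriv f z \<noteq> 0"
    and small: "\<And>z. z \<in> strip X \<Longrightarrow> (Re z)\<^sup>2 * cmod (schwarzian f z) \<le> 1/1000"
begin

definition den :: "complex \<Rightarrow> complex \<Rightarrow> complex" where
  "den c z = deriv f z - (f z - c) * pre_schwarzian f z / 2"

definition quo :: "complex \<Rightarrow> complex \<Rightarrow> complex" where
  "quo c z = (f z - c) / den c z"

lemma has_deriv_f: "z \<in> strip X \<Longrightarrow> (f has_field_derivative deriv f z) (at z)"
  using holo holomorphic_derivI open_strip by blast

lemma holo_deriv: "deriv f holomorphic_on strip X"
  using holo holomorphic_deriv open_strip by blast

lemma holo_deriv2: "deriv (deriv f) holomorphic_on strip X"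
  using holo_deriv holomorphic_deriv open_strip by blast

lemma has_deriv_deriv: "z \<in> strip X \<Longrightarrow> (deriv f has_field_derivative deriv (deriv f) z) (at z)"
  using holo_deriv holomorphic_derivI open_strip by blast

lemma holo_ps: "pre_schwarzian f holomorphic_on strip X"
proof -
  have "(\<lambda>z. deriv (deriv f) z / deriv f z) holomorphic_on strip X"
    by (rule holomorphic_on_divide[OF holo_deriv2 holo_deriv deriv_nz])
  then show ?thesis
    by (simp add: pre_schwarzian_def[abs_def])
qed

lemma has_deriv_ps:
  "z \<in> strip X \<Longrightarrow> (pre_schwarzian f has_field_derivative deriv (pre_schwarzian f) z) (at z)"
  using holo_ps holomorphic_derivI open_strip by blast

lemma deriv2_eq: "z \<in> strip X \<Longrightarrow> deriv (deriv f) z = pre_schwarzian f z * deriv f z"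
  using deriv_nz by (simp add: pre_schwarzian_def)

lemma quo_has_derivative:
  assumes z: "z \<in> strip X" and d: "den c z \<noteq> 0"
  shows "(quo c has_field_derivative 1 + schwarzian f z / 2 * (quo c z)\<^sup>2) (at z)"
proof -
  let ?P = "pre_schwarzian f z" and ?P' = "deriv (pre_schwarzian f) z"
  let ?D = "deriv (deriv f) z - (deriv f z * ?P + (f z - c) * ?P') / 2"
  have 1: "(den c has_field_derivative ?D) (at z)"
  proof -
    have "((\<lambda>z. (f z - c) * pre_schwarzian f z) has_field_derivative
        deriv f z * ?P + (f z - c) * ?P') (at z)"
      by (rule derivative_eq_intros has_deriv_f[OF z] has_deriv_ps[OF z] refl)+ simp
    then show ?thesis
      unfolding den_def by (intro DERIV_diff has_deriv_deriv z DERIV_cdivide)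
  qed
  have "((\<lambda>z. (f z - c) / den c z) has_field_derivative
      (deriv f z * den c z - (f z - c) * ?D) / (den c z)\<^sup>2) (at z)"
    by (rule derivative_eq_intros has_deriv_f[OF z] 1 refl d)+ (auto simp: power2_eq_square)
  moreover have "(deriv f z * den c z - (f z - c) * ?D) / (den c z)\<^sup>2
      = 1 + schwarzian f z / 2 * (quo c z)\<^sup>2"
  proof -
    have "deriv f z * den c z - (f z - c) * ?D
        = (den c z)\<^sup>2 + schwarzian f z / 2 * (f z - c)\<^sup>2"
      unfolding deriv2_eq[OF z] den_def schwarzian_def
      by (simp add: field_simps power2_eq_square)
    then show ?thesis
      using d by (simp only:) (simp add: quo_def power_divide add_divide_distrib)
  qed
  ultimately show ?thesis
    by (simp add: quo_def[abs_def])
qed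

lemma continuous_den: "continuous_on (strip X) (den c)"
  unfolding den_def
  by (intro holomorphic_on_imp_continuous_on holomorphic_on_diff holomorphic_on_mult holomorphic_on_divide
      holomorphic_on_const holo holo_deriv holo_ps) auto

text \<open>A first-failure argument: as long as \<^term>\<open>cmod (quo c z) \<le> 6 * Re z\<close> the derivative of
  \<^term>\<open>quo c\<close> is close to \<^term>\<open>1::complex\<close>, and this in turn keeps the bound strict.\<close>

lemma quo_along_segment:
  assumes z0: "z0 \<in> strip X" and z1: "z0 + v \<in> strip X"
    and d0: "den c z0 \<noteq> 0" and q0: "cmod (quo c z0) \<le> 2 * Re z0"
    and v: "cmod v \<le> 3 * Re v"
  shows "den c (z0 + v) \<noteq> 0" and "cmod (quo c (z0 + v) - quo c z0 - v) \<le> cmod v / 50"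
proof -
  define p where "p s = z0 + of_real s * v" for s :: real
  have pin: "p s \<in> strip X" if "s \<in> {0..1}" for s
  proof -
    have "p s = (1 - s) *\<^sub>R z0 + s *\<^sub>R (z0 + v)"
      by (simp add: p_def scaleR_conv_of_real algebra_simps)
    then show ?thesis
      using that convex_strip z0 z1 by (auto simp: convex_alt)
  qed
  have Re_p: "Re (p s) = Re z0 + s * Re v" for s
    by (simp add: p_def)
  have Re_v: "0 \<le> Re v"
    using v norm_ge_zero[of v] by linarith
  have Re0: "0 < Re z0"
    using z0 by (simp add: strip_def)
  \<comment> \<open>The bound is written without the quotient, so that it makes sense where
    \<open>den c\<close> vanishes. All terms are then continuous, \<open>bad\<close> is closed, and
    a first failure exists.\<close>
  define bad where "bad = {s \<in> {0..1}. 6 * Re (p s) * cmod (den c (p s)) \<le> cmod (f (p s) - c)}"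
  have contp: "continuous_on {0..1} p"
    unfolding p_def by (intro continuous_intros)
  have contf: "continuous_on {0..1} (\<lambda>s. f (p s))"
    by (rule continuous_on_compose2[OF holomorphic_on_imp_continuous_on[OF holo] contp]) (use pin in auto)
  have contd: "continuous_on {0..1} (\<lambda>s. den c (p s))"
    by (rule continuous_on_compose2[OF continuous_den contp]) (use pin in auto)
  \<comment> \<open>If \<open>den c\<close> vanished under this bound, then \<open>f = c\<close> at
    that point and \<open>den c\<close> would reduce to \<open>deriv f\<close>.\<close>
  have nz: "den c (p s) \<noteq> 0" if s: "s \<in> {0..1}" and "cmod (f (p s) - c) \<le> 6 * Re (p s) * cmod (den c (p s))" for s
  proof
    assume d: "den c (p s) = 0"
    with that have "f (p s) = c" by simp
    with d have "deriv f (p s) = 0" by (simp add: den_def)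
    with deriv_nz pin s show False by blast
  qed
  \<comment> \<open>The constant 18/1000 is half the square of 6 times the bound 1/1000 for the
    Schwarzian derivative.\<close>
  have est: "cmod (quo c (p s) - quo c z0 - of_real s * v) \<le> cmod (of_real s * v) * (18/1000)"
    if s: "s \<in> {0..1}" and le: "\<And>r. r \<in> {0..s} \<Longrightarrow> cmod (f (p r) - c) \<le> 6 * Re (p r) * cmod (den c (p r))" for s
  proof -
    have seg: "\<exists>r\<in>{0..s}. w = p r" if "w \<in> closed_segment z0 (p s)" for w
    proof -
      have "\<exists>u. 0 \<le> u \<and> u \<le> 1 \<and> w = (1 - u) *\<^sub>R z0 + u *\<^sub>R p s"
        using that by (simp only: in_segment(1))
      then obtain u where u: "0 \<le> u" "u \<le> 1" "w = (1 - u) *\<^sub>R z0 + u *\<^sub>R p s"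
        by metis
      have "w = p (u * s)"
        unfolding u(3) p_def by (simp add: scaleR_conv_of_real ring_distribs)
      moreover have "u * s \<in> {0..s}"
        using u s mult_right_mono[of u 1 s] by auto
      ultimately show ?thesis by blast
    qed
    have 1: "((\<lambda>w. quo c w - w) has_field_derivative schwarzian f w / 2 * (quo c w)\<^sup>2)
           (at w within closed_segment z0 (p s))"
      and 2: "cmod (schwarzian f w / 2 * (quo c w)\<^sup>2) \<le> 18/1000"
      if w: "w \<in> closed_segment z0 (p s)" for w
    proof -
      obtain r where r: "r \<in> {0..s}" "w = p r"
        using seg w by blast
      have r1: "r \<in> {0..1}" using r s by auto
      have ws: "w \<in> strip X" using pin r1 r by auto
      have l: "cmod (f w - c) \<le> 6 * Re w * cmod (den c w)" using le r by auto
      then have dw: "den c w \<noteq> 0" using nz r1 r by auto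
      have "((\<lambda>w. quo c w - w) has_field_derivative (1 + schwarzian f w / 2 * (quo c w)\<^sup>2) - 1) (at w)"
        by (intro derivative_intros quo_has_derivative ws dw)
      then show "((\<lambda>w. quo c w - w) has_field_derivative schwarzian f w / 2 * (quo c w)\<^sup>2)
           (at w within closed_segment z0 (p s))"
        by (simp add: has_field_derivative_at_within)
      have "cmod (quo c w) \<le> 6 * Re w"
        using l dw by (simp add: quo_def norm_divide field_simps)
      then have "(cmod (quo c w))\<^sup>2 \<le> (6 * Re w)\<^sup>2"
        by (intro power_mono) auto
      from mult_left_mono[OF this, of "cmod (schwarzian f w) / 2"]
      have "cmod (schwarzian f w / 2 * (quo c w)\<^sup>2) \<le> cmod (schwarzian f w) / 2 * (6 * Re w)\<^sup>2"
        by (simp only: norm_mult norm_power norm_divide) simp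
      also have "\<dots> = 18 * ((Re w)\<^sup>2 * cmod (schwarzian f w))"
        by (simp add: power_mult_distrib)
      also have "\<dots> \<le> 18 * (1/1000)"
        by (intro mult_left_mono small ws) auto
      finally show "cmod (schwarzian f w / 2 * (quo c w)\<^sup>2) \<le> 18/1000" by simp
    qed
    have "cmod ((quo c (p s) - p s) - (quo c z0 - z0)) \<le> 18/1000 * cmod (p s - z0)"
      by (rule field_differentiable_bound[OF convex_closed_segment 1 2]) auto
    then show ?thesis
      by (simp add: p_def algebra_simps)
  qed
  have empty: "bad = {}"
  proof (rule ccontr)
    assume ne: "bad \<noteq> {}"
    have cl: "closed bad"
      unfolding bad_def
      by (rule continuous_on_closed_Collect_le) (use contp contf contd in \<open>intro continuous_intros | simp\<close>)+
    have bdd: "bdd_below bad"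
      by (rule bdd_belowI[of _ 0]) (auto simp: bad_def)
    define m where "m = Inf bad"
    have mb: "m \<in> bad"
      unfolding m_def by (rule closed_contains_Inf[OF ne bdd cl])
    have good: "cmod (f (p r) - c) < 6 * Re (p r) * cmod (den c (p r))" if "r \<in> {0..<m}" for r
    proof -
      have "r \<notin> bad"
        using that cInf_lower[OF _ bdd, of r] by (auto simp: m_def)
      moreover have "r \<in> {0..1}" using that mb by (auto simp: bad_def)
      ultimately show ?thesis by (auto simp: bad_def)
    qed
    have m01: "m \<in> {0..1}" using mb by (simp add: bad_def)
    have "cmod (f z0 - c) \<le> 2 * Re z0 * cmod (den c z0)"
      using q0 d0 by (simp add: quo_def norm_divide field_simps)
    also have "\<dots> < 6 * Re z0 * cmod (den c z0)"
      using d0 Re0 by simp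
    finally have "0 \<notin> bad"
      by (simp add: bad_def p_def)
    then have m0: "0 < m" using mb m01 by (metis atLeastAtMost_iff order_le_less)
    have lim: "cmod (f (p m) - c) \<le> 6 * Re (p m) * cmod (den c (p m))"
    proof -
      have "closed {r \<in> {0..m}. cmod (f (p r) - c) \<le> 6 * Re (p r) * cmod (den c (p r))}"
        by (rule continuous_on_closed_Collect_le)
          (intro continuous_intros continuous_on_subset[OF contp] continuous_on_subset[OF contf]
              continuous_on_subset[OF contd]; use m01 in auto)+
      then have "closure {0..<m} \<subseteq> {r \<in> {0..m}. cmod (f (p r) - c) \<le> 6 * Re (p r) * cmod (den c (p r))}"
        by (rule closure_minimal[rotated]) (use good in \<open>auto intro: less_imp_le\<close>)
      moreover have "m \<in> closure {0..<m}" using m0 by simp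
      ultimately show ?thesis by blast
    qed
    have le: "cmod (f (p r) - c) \<le> 6 * Re (p r) * cmod (den c (p r))" if "r \<in> {0..m}" for r
      using that good[of r] lim by (cases "r = m") (auto simp: less_imp_le)
    \<comment> \<open>The cone condition \<open>cmod v \<le> 3 * Re v\<close> enters here: 3 times
      1018/1000 is below 6, so the bound is strict at \<open>m\<close>, which contradicts
      \<open>m \<in> bad\<close>.\<close>
    have "cmod (quo c (p m)) \<le> cmod (quo c z0) + cmod (of_real m * v) + cmod (quo c (p m) - quo c z0 - of_real m * v)"
      by (smt (verit, del_insts) add_diff_cancel_left' diff_diff_add norm_triangle_ineq norm_triangle_sub)
    also have "\<dots> \<le> 2 * Re z0 + m * cmod v * (1018/1000)"
      using est[OF m01 le] q0 m0 by (simp add: norm_mult)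
    also have "\<dots> \<le> 2 * Re z0 + m * (3 * Re v) * (1018/1000)"
      using v m0 by (intro add_left_mono mult_right_mono mult_left_mono) auto
    also have "\<dots> < 6 * (Re z0 + m * Re v)"
      using Re0 Re_v m0 by (simp add: field_simps) (smt (verit) mult_nonneg_nonneg)
    finally have "cmod (quo c (p m)) < 6 * Re (p m)"
      by (simp add: Re_p)
    moreover have "den c (p m) \<noteq> 0"
      using nz m01 lim by blast
    ultimately have "cmod (f (p m) - c) < 6 * Re (p m) * cmod (den c (p m))"
      by (simp add: quo_def norm_divide field_simps)
    with mb show False by (simp add: bad_def)
  qed
  have le: "cmod (f (p r) - c) \<le> 6 * Re (p r) * cmod (den c (p r))" if "r \<in> {0..1}" for r
    using that empty by (force simp: bad_def)
  show "den c (z0 + v) \<noteq> 0"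
    using nz[of 1] le[of 1] by (simp add: p_def)
  have "cmod (quo c (p 1) - quo c z0 - of_real 1 * v) \<le> cmod (of_real 1 * v) * (18/1000)"
    by (rule est) (use le in auto)
  then show "cmod (quo c (z0 + v) - quo c z0 - v) \<le> cmod v / 50"
    by (simp add: p_def) (use norm_ge_zero[of v] in linarith)
qed


lemma quo_eq_0_iff: "den c z \<noteq> 0 \<Longrightarrow> quo c z = 0 \<longleftrightarrow> f z = c"
  by (simp add: quo_def)

lemma den_self: "z \<in> strip X \<Longrightarrow> den (f z) z \<noteq> 0"
  using deriv_nz by (simp add: den_def)

lemma quo_self: "quo (f z) z = 0"
  by (simp add: quo_def)

text \<open>The reciprocal of \<open>quo c\<close> is f' / (f - c) - Pf / 2, so Pf drops out of the
  difference of two reciprocals. The identity is cleared of denominators and thus holds also where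
  \<open>f z\<close> is one of the two values.\<close>

lemma quo_cross_ratio:
  assumes "den a z \<noteq> 0" "den b z \<noteq> 0"
  shows "deriv f z * (a - b) * (quo a z * quo b z) = (quo b z - quo a z) * ((f z - a) * (f z - b))"
  using assms by (simp add: quo_def divide_simps) (simp add: den_def field_simps)

text \<open>The last conclusion reproduces the hypothesis on \<open>quo c\<close>, so that the
  estimate can be continued from any later point of the ray.\<close>

lemma quo_horizontal:
  assumes z: "z \<in> strip X" and zs: "z + of_real s \<in> strip X" and s: "0 \<le> s"
    and d: "den c z \<noteq> 0" and q: "cmod (quo c z) \<le> 2 * Re z"
  shows "den c (z + of_real s) \<noteq> 0"
    and "cmod (quo c (z + of_real s) - quo c z - of_real s) \<le> s / 50"
    and "cmod (quo c (z + of_real s)) \<le> 2 * Re (z + of_real s)"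
proof -
  show "den c (z + of_real s) \<noteq> 0"
    by (rule quo_along_segment[OF z zs d q]) (use s in auto)
  show 1: "cmod (quo c (z + of_real s) - quo c z - of_real s) \<le> s / 50"
    using quo_along_segment(2)[OF z zs d q] s by simp
  have "cmod (quo c (z + of_real s)) \<le>
      cmod (quo c (z + of_real s) - quo c z - of_real s) + cmod (quo c z) + cmod (complex_of_real s)"
    by (smt (verit, best) norm_triangle_sub)
  with 1 q s show "cmod (quo c (z + of_real s)) \<le> 2 * Re (z + of_real s)"
    by simp
qed

text \<open>Since \<^term>\<open>quo a - quo b\<close> solves a linear equation with coefficient at most
  \<^term>\<open>1 / (500 * Re z)\<close>, it grows more slowly than the square root of \<^term>\<open>Re z\<close>.\<close>

lemma quo_diff_growth:
  assumes z: "z \<in> strip X" and zs: "z + of_real s \<in> strip X" and s: "0 \<le> s"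
    and da: "den a z \<noteq> 0" and qa: "cmod (quo a z) \<le> 2 * Re z"
    and db: "den b z \<noteq> 0" and qb: "cmod (quo b z) \<le> 2 * Re z"
  shows "(cmod (quo a (z + of_real s) - quo b (z + of_real s)))\<^sup>2 * Re z
       \<le> (cmod (quo a z - quo b z))\<^sup>2 * (Re z + s)"
proof -
  define m where "m w = quo a w - quo b w" for w
  \<comment> \<open>That \<open>F\<close> decreases is the square root growth. The square avoids
    differentiating the norm at a zero of \<open>m\<close>.\<close>
  define F where "F r = (cmod (m (z + of_real r)))\<^sup>2 / (Re z + r)" for r
  have Rez: "0 < Re z" using z by (simp add: strip_def)
  have "F s \<le> F 0"
  proof (rule DERIV_nonpos_imp_nonincreasing[OF s])
    fix r assume r: "0 \<le> r" "r \<le> s"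
    let ?w = "z + of_real r"
    have w: "?w \<in> strip X" using z zs r by (auto simp: strip_def)
    note A = quo_horizontal[OF z w r(1) da qa]
    note B = quo_horizontal[OF z w r(1) db qb]
    define x where "x = Re z + r"
    have x: "0 < x" using Rez r by (simp add: x_def)
    define m' where "m' = schwarzian f ?w / 2 * (quo a ?w + quo b ?w) * m ?w"
    have dm: "(m has_field_derivative m') (at ?w)"
    proof -
      have "(m has_field_derivative (1 + schwarzian f ?w / 2 * (quo a ?w)\<^sup>2) -
          (1 + schwarzian f ?w / 2 * (quo b ?w)\<^sup>2)) (at ?w)"
        unfolding m_def by (intro DERIV_diff quo_has_derivative w A B)
      moreover have "(1 + schwarzian f ?w / 2 * (quo a ?w)\<^sup>2) - (1 + schwarzian f ?w / 2 * (quo b ?w)\<^sup>2) = m'"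
        by (simp add: m'_def m_def power2_eq_square field_simps)
      ultimately show ?thesis by metis
    qed
    \<comment> \<open>The sum of the two solutions is at most \<open>4 * x\<close>, so the
      coefficient of the linear equation is at most (1/2) (1/1000) 4 / x = 1 / (500 x).\<close>
    have le: "cmod m' * x \<le> cmod (m ?w) / 500"
    proof -
      have "cmod (quo a ?w + quo b ?w) \<le> 4 * x"
        using A(3) B(3) norm_triangle_ineq[of "quo a ?w" "quo b ?w"] by (simp add: x_def)
      then have "cmod m' \<le> cmod (schwarzian f ?w) / 2 * (4 * x) * cmod (m ?w)"
        unfolding m'_def norm_mult norm_divide norm_numeral
        by (intro mult_right_mono[OF mult_left_mono]) auto
      then have "cmod m' * x \<le> cmod (schwarzian f ?w) / 2 * (4 * x) * cmod (m ?w) * x"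
        using x by (intro mult_right_mono) auto
      also have "\<dots> = 2 * ((Re ?w)\<^sup>2 * cmod (schwarzian f ?w)) * cmod (m ?w)"
        by (simp add: x_def power2_eq_square)
      also have "\<dots> \<le> 2 * (1/1000) * cmod (m ?w)"
        by (intro mult_right_mono mult_left_mono small w) auto
      finally show ?thesis by simp
    qed
    have 1: "((\<lambda>r. m (z + of_real r)) has_vector_derivative m') (at r)"
    proof -
      have "((\<lambda>r. z + of_real r) has_vector_derivative 1) (at r)"
        by (auto intro!: derivative_eq_intros)
      from field_vector_diff_chain_at[OF this dm] show ?thesis
        by (simp add: o_def)
    qed
    have 2: "((\<lambda>r. (cmod (m (z + of_real r)))\<^sup>2) has_real_derivative 2 * (m ?w \<bullet> m')) (at r)"
    proof -
      have "((\<lambda>r. m (z + of_real r) \<bullet> m (z + of_real r)) has_vector_derivative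
          (m ?w \<bullet> m' + m' \<bullet> m ?w)) (at r)"
        by (rule bounded_bilinear.has_vector_derivative[OF bounded_bilinear_inner 1 1])
      then show ?thesis
        by (simp add: has_real_derivative_iff_has_vector_derivative power2_norm_eq_inner inner_commute)
    qed
    have "(F has_real_derivative (2 * (m ?w \<bullet> m') * x - (cmod (m ?w))\<^sup>2 * 1) / (x * x)) (at r)"
      unfolding F_def x_def
      by (rule DERIV_divide[OF 2]) (use x in \<open>auto intro!: derivative_eq_intros simp: x_def\<close>)
    moreover have "2 * (m ?w \<bullet> m') * x \<le> (cmod (m ?w))\<^sup>2"
    proof -
      have "2 * (m ?w \<bullet> m') * x \<le> 2 * (cmod (m ?w) * cmod m') * x"
        using x by (intro mult_right_mono mult_left_mono norm_cauchy_schwarz) auto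
      also have "\<dots> = 2 * cmod (m ?w) * (cmod m' * x)" by simp
      also have "\<dots> \<le> 2 * cmod (m ?w) * (cmod (m ?w) / 500)"
        by (intro mult_left_mono le) auto
      also have "\<dots> \<le> (cmod (m ?w))\<^sup>2"
        by (simp add: power2_eq_square)
      finally show ?thesis .
    qed
    ultimately show "\<exists>y. (F has_real_derivative y) (at r) \<and> y \<le> 0"
      using x by (intro exI[of _ "(2 * (m ?w \<bullet> m') * x - (cmod (m ?w))\<^sup>2 * 1) / (x * x)"])
        (simp add: divide_le_0_iff)
  qed
  then show ?thesis
    using Rez s by (simp add: F_def m_def divide_simps split: if_splits)
qed


lemma quo_h_family:
  assumes z: "z + of_real t \<in> strip X" and t: "0 < t"
    and D: "1 + of_real t * pre_schwarzian f (z + of_real t) \<noteq> 0"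
  shows "den (h_family f t z) (z + of_real t) \<noteq> 0"
    and "quo (h_family f t z) (z + of_real t) = 2 * of_real t"
proof -
  let ?w = "z + of_real t"
  let ?D = "1 + of_real t * pre_schwarzian f ?w"
  have 1: "f ?w - h_family f t z = 2 * of_real t * deriv f ?w / ?D"
    by (simp add: h_family_def)
  have 2: "den (h_family f t z) ?w = deriv f ?w / ?D"
  proof -
    have "2 * a * x / d = (2 * a / d) * x" "x - 2 * a / d * x * b / 2 = x * (d - a * b) / d"
      if "d \<noteq> 0" for a b d x :: complex
      using that by (auto simp: field_simps)
    then show ?thesis
      unfolding den_def 1 using D by (metis add_diff_cancel_right' mult.right_neutral)
  qed
  show "den (h_family f t z) ?w \<noteq> 0"
    using 2 D deriv_nz[OF z] by simp
  then show "quo (h_family f t z) ?w = 2 * of_real t"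
    unfolding quo_def 1 2 using D deriv_nz[OF z] by (metis (no_types, lifting) divide_divide_eq_left
        divide_divide_eq_right nonzero_mult_div_cancel_right times_divide_eq_right)
qed

text \<open>If both points are mapped to \<open>c\<close>, then \<open>quo c\<close> equals
  \<open>2 * t\<close> at \<open>z + t\<close> and at \<open>w + t\<close>. Continued to a common
  point it is nearly \<open>2 * t + u\<close> and nearly \<open>2 * t + v\<close>, so
  \<open>z - w = v - u\<close> has modulus at most (|u| + |v|) / 50, which is less than |z -
  w|.\<close>

lemma h_family_locally_inj:
  assumes z: "0 < Re z" "Re z + t + 2 * cmod (z - w) < X" and w: "0 < Re w" and t: "0 < t"
    and Dz: "1 + of_real t * pre_schwarzian f (z + of_real t) \<noteq> 0"
    and Dw: "1 + of_real t * pre_schwarzian f (w + of_real t) \<noteq> 0"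
    and eq: "h_family f t z = h_family f t w"
  shows "z = w"
proof (rule ccontr)
  assume ne: "z \<noteq> w"
  define s where "s = cmod (z - w)"
  have s: "0 < s" using ne by (simp add: s_def)
  define c where "c = h_family f t z"
  \<comment> \<open>The common point is the midpoint moved to the right by \<open>s\<close>. This
    places both directions in the cone of \<open>quo_along_segment\<close>: their moduli are at most
    3s/2 and their real parts at least s/2.\<close>
  define u where "u = (w - z) / 2 + of_real s"
  define v where "v = (z - w) / 2 + of_real s"
  have uv: "z + of_real t + u = w + of_real t + v"
    by (simp add: u_def v_def field_simps)
  have abs: "\<bar>Re z - Re w\<bar> \<le> s"
    using abs_Re_le_cmod[of "z - w"] by (simp add: s_def)
  have nu: "cmod u \<le> 3/2 * s" and nv: "cmod v \<le> 3/2 * s"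
    using norm_triangle_ineq[of "(w - z)/2" "of_real s"] norm_triangle_ineq[of "(z - w)/2" "of_real s"] s
    by (auto simp: u_def v_def s_def norm_minus_commute norm_divide)
  have Reu: "Re u = (Re w - Re z) / 2 + s" and Rev: "Re v = (Re z - Re w) / 2 + s"
    by (simp_all add: u_def v_def Re_divide_numeral)
  have ru: "s \<le> 2 * Re u" and rv: "s \<le> 2 * Re v"
    using abs unfolding Reu Rev abs_le_iff by (simp_all add: field_simps)
  have in1: "z + of_real t \<in> strip X" "w + of_real t \<in> strip X" "z + of_real t + u \<in> strip X"
    using z w t abs[unfolded abs_le_iff] s
    unfolding strip_def s_def[symmetric] mem_Collect_eq plus_complex.sel Re_complex_of_real Reu
    by (simp_all add: field_simps)
  have in2: "w + of_real t + v \<in> strip X" using in1(3) uv by simp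
  note A = quo_h_family[OF in1(1) t Dz, folded c_def]
  note B = quo_h_family[OF in1(2) t Dw, folded eq, folded c_def]
  have a: "cmod (quo c (z + of_real t + u) - quo c (z + of_real t) - u) \<le> cmod u / 50"
    by (rule quo_along_segment(2)[OF in1(1,3) A(1)]) (use A(2) t z nu ru in \<open>auto simp: norm_mult\<close>)
  have b: "cmod (quo c (w + of_real t + v) - quo c (w + of_real t) - v) \<le> cmod v / 50"
    by (rule quo_along_segment(2)[OF in1(2) in2 B(1)]) (use B(2) t w nv rv in \<open>auto simp: norm_mult\<close>)
  have "v - u = z - w" by (simp add: u_def v_def field_simps)
  then have zw: "z - w = (quo c (z + of_real t + u) - quo c (z + of_real t) - u)
      - (quo c (w + of_real t + v) - quo c (w + of_real t) - v)"
    unfolding uv[symmetric] A(2) B(2) by (simp add: algebra_simps)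
  have "s \<le> cmod u / 50 + cmod v / 50"
    unfolding s_def zw by (rule order_trans[OF norm_triangle_ineq4 add_mono[OF a b]])
  with nu nv s show False by simp
qed

text \<open>For \<open>c = h_family f t z\<close>, \<open>c1 = f p\<close> and
  \<open>c2 = f p2\<close> the three solutions at the point \<open>T\<close> are about
  \<open>2 * t + l\<close>, \<open>l\<close> and \<open>4 * l / 5\<close>. The first two differ only
  by a multiple of sqrt t, the last two by at least \<open>l / 10\<close>. The quotient of two
  cross-ratio identities at \<open>T\<close> turns this into a comparison of \<open>c - c1\<close>
  with \<open>c1 - c2\<close>, which the hypothesis with \<open>C\<close> relates to values of
  \<open>f\<close>.\<close>

lemma h_family_close_to_f:
  assumes z: "0 < Re z" and t: "0 < t" and l: "0 < l" and X: "Re z + t + l < X"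
    and D: "1 + of_real t * pre_schwarzian f (z + of_real t) \<noteq> 0"
    and C: "cmod (f (z + of_real t) - f (z + of_real t + of_real (l/5)))
        \<le> C * cmod (f (z + of_real t + of_real l) - f (z + of_real t + of_real (l/5)))"
    and C0: "0 \<le> C" and small: "20 * C * sqrt (4 * t * X) / l \<le> 1/2"
  shows "cmod (h_family f t z - f (z + of_real t))
      \<le> 2 * (20 * C * sqrt (4 * t * X) / l) * cmod (f (z + of_real t + of_real l) - f (z + of_real t))"
proof -
  define p where "p = z + of_real t"
  define T where "T = p + of_real l"
  define p2 where "p2 = p + of_real (l/5)"
  define c where "c = h_family f t z"
  define c1 where "c1 = f p"
  define c2 where "c2 = f p2"
  define \<theta> where "\<theta> = 20 * C * sqrt (4 * t * X) / l"
  have T2: "T = p2 + of_real (4 * l/5)" by (simp add: T_def p2_def)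
  have in1: "p \<in> strip X" "T \<in> strip X" "p2 \<in> strip X"
    using z t l X by (auto simp: strip_def p_def T_def p2_def)
  have Rep: "t < Re p" using z by (simp add: p_def)
  have T': "p + of_real l \<in> strip X" "p2 + of_real (4*l/5) \<in> strip X"
    using in1(2) T2 by (auto simp: T_def)
  note H0 = quo_h_family[OF in1(1)[unfolded p_def] t D, folded c_def p_def]
  have H0': "cmod (quo c p) \<le> 2 * Re p" using H0(2) t Rep by (simp add: norm_mult)
  have H1: "den c1 p \<noteq> 0" "quo c1 p = 0" "cmod (quo c1 p) \<le> 2 * Re p"
    using in1 Rep t by (auto simp: c1_def den_self quo_self)
  have H2: "den c2 p2 \<noteq> 0" "quo c2 p2 = 0" "cmod (quo c2 p2) \<le> 2 * Re p2"
    using in1 Rep t l by (auto simp: c2_def den_self quo_self p2_def)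
  note A = quo_horizontal[OF in1(1) T'(1) less_imp_le[OF l] H0(1) H0', folded T_def]
  note B1 = quo_horizontal[OF in1(1) T'(1) less_imp_le[OF l] H1(1,3), folded T_def]
  note B2 = quo_horizontal[OF in1(3) T'(2) _ H2(1,3), folded T2]
  define A0 where "A0 = quo c T"
  define B where "B = quo c1 T"
  define E where "E = quo c2 T"
  have a: "l/2 \<le> cmod A0"
  proof -
    have "cmod (of_real (2*t + l) :: complex) \<le> cmod A0 + cmod (A0 - of_real (2*t + l))"
      by (metis norm_triangle_sub norm_minus_commute)
    moreover have "cmod (A0 - of_real (2*t + l)) \<le> l/50"
      using A(2) H0(2) by (simp add: A0_def diff_diff_eq)
    ultimately show ?thesis using t l by (simp only: norm_of_real)
  qed
  have b: "cmod (B - of_real l) \<le> l/50" and e: "cmod (E - of_real (4*l/5)) \<le> l/50"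
    using B1(2) H1(2) B2(2) H2(2) l by (auto simp: B_def E_def)
  have e2: "cmod E \<le> l"
    using e norm_triangle_sub[of E "of_real (4*l/5)"] l by (simp only: norm_of_real)
  have be: "l/10 \<le> cmod (E - B)"
  proof -
    have "of_real (l/5) = (E - of_real (4*l/5)) - (B - of_real l) - (E - B)"
      by simp
    then have "cmod (of_real (l/5) :: complex) \<le> cmod (E - of_real (4*l/5)) + cmod (B - of_real l) + cmod (E - B)"
      by (metis (no_types, lifting) add_mono_thms_linordered_semiring(3) norm_triangle_ineq4 order_trans)
    then show ?thesis using b e l by (simp only: norm_of_real)
  qed
  have B0: "B \<noteq> 0"
    using b l by auto
  have E0: "E \<noteq> 0"
    using e l by auto
  have T1: "f T \<noteq> c1" using B0 B1(1) quo_eq_0_iff by (auto simp: B_def)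
  have T3: "f T \<noteq> c2" using E0 B2(1) quo_eq_0_iff l by (auto simp: E_def)
  \<comment> \<open>The solutions differ by \<open>2 * t\<close> at \<open>p\<close>. Since
    \<open>Re p\<close> exceeds \<open>t\<close>, the square root growth leaves at most the root of
    \<open>4 * t * X\<close>.\<close>
  have m: "cmod (A0 - B) \<le> sqrt (4 * t * X)"
  proof (rule real_le_rsqrt)
    have "(cmod (A0 - B))\<^sup>2 * Re p \<le> (cmod (quo c p - quo c1 p))\<^sup>2 * (Re p + l)"
      using quo_diff_growth[OF in1(1) T'(1) less_imp_le[OF l] H0(1) H0' H1(1,3)]
      by (simp add: A0_def B_def T_def)
    also have "\<dots> = 4 * t * (t * (Re p + l))"
      using H0(2) H1(2) t by (simp add: norm_mult power2_eq_square)
    also have "\<dots> \<le> 4 * t * (Re p * X)"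
      using Rep t l X by (intro mult_left_mono mult_mono) (auto simp: p_def)
    finally have "(cmod (A0 - B))\<^sup>2 * Re p \<le> (4 * t * X) * Re p"
      by (simp add: mult_ac)
    then show "(cmod (A0 - B))\<^sup>2 \<le> 4 * t * X"
      using Rep t by (simp add: mult_le_cancel_right)
  qed
  have x1: "deriv f T * (c - c1) * (A0 * B) = (B - A0) * ((f T - c) * (f T - c1))"
    unfolding A0_def B_def by (rule quo_cross_ratio) (use A B1 in auto)
  have x2: "deriv f T * (c1 - c2) * (B * E) = (E - B) * ((f T - c1) * (f T - c2))"
    unfolding B_def E_def by (rule quo_cross_ratio) (use B1 B2 l in auto)
  \<comment> \<open>Multiplying the identities crosswise eliminates \<open>deriv f T\<close>, about
    which nothing is known.\<close>
  have "((E - B) * (f T - c2) * (c - c1) * A0) * (B * (f T - c1))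
      = ((E - B) * ((f T - c1) * (f T - c2))) * ((c - c1) * (A0 * B))"
    by (simp add: mult_ac)
  also have "\<dots> = (c1 - c2) * (B * E) * (deriv f T * (c - c1) * (A0 * B))"
    unfolding x2[symmetric] by (simp add: mult_ac)
  also have "\<dots> = ((B - A0) * (f T - c) * (c1 - c2) * E) * (B * (f T - c1))"
    unfolding x1 by (simp add: mult_ac)
  finally have "(E - B) * (f T - c2) * (c - c1) * A0 = (B - A0) * (f T - c) * (c1 - c2) * E"
    using B0 T1 by simp
  then have eq: "cmod (E - B) * cmod (f T - c2) * cmod (c - c1) * cmod A0
      = cmod (B - A0) * cmod (f T - c) * cmod (c1 - c2) * cmod E"
    by (metis norm_mult)
  have "(l/10) * cmod (f T - c2) * cmod (c - c1) * (l/2)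
      \<le> cmod (E - B) * cmod (f T - c2) * cmod (c - c1) * cmod A0"
    using be a l by (intro mult_mono) auto
  also have "\<dots> \<le> sqrt (4 * t * X) * cmod (f T - c) * (C * cmod (f T - c2)) * l"
  proof -
    have "cmod (c1 - c2) \<le> C * cmod (f T - c2)" "cmod (B - A0) \<le> sqrt (4 * t * X)"
      using C m by (auto simp: norm_minus_commute c1_def c2_def p_def p2_def T_def)
    moreover have "0 \<le> sqrt (4 * t * X)" using t z l X by simp
    ultimately show ?thesis
      unfolding eq using e2 C0 l by (intro mult_mono) auto
  qed
  finally have "cmod (c - c1) * (cmod (f T - c2) * l) \<le> \<theta> * cmod (f T - c) * (cmod (f T - c2) * l)"
    using l by (simp add: \<theta>_def field_simps)
  then have 1: "cmod (c - c1) \<le> \<theta> * cmod (f T - c)"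
    using T3 l by (subst (asm) mult_le_cancel_right) auto
  have "0 \<le> \<theta>" using C0 l z t X by (simp add: \<theta>_def)
  \<comment> \<open>Since \<open>\<theta>\<close> is at most 1/2, the contribution of
    \<open>c - c1\<close> to the right-hand side is absorbed on the left.\<close>
  have "cmod (f T - c) \<le> cmod (f T - c1) + cmod (c - c1)"
    using norm_triangle_ineq4[of "f T - c1" "c - c1"] by simp
  then have "\<theta> * cmod (f T - c) \<le> \<theta> * (cmod (f T - c1) + cmod (c - c1))"
    using \<open>0 \<le> \<theta>\<close> by (rule mult_left_mono)
  moreover have "\<theta> * cmod (c - c1) \<le> 1/2 * cmod (c - c1)"
    using small by (intro mult_right_mono) (auto simp: \<theta>_def)
  ultimately have "cmod (c - c1) \<le> 2 * \<theta> * cmod (f T - c1)"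
    using 1 by (simp add: distrib_left)
  then show ?thesis
    by (simp add: c_def c1_def p_def T_def \<theta>_def)
qed

end

section \<open>Univalence from weak quasisymmetry\<close>

lemma nonzero_difference_quotient:
  assumes A: "open A" and h: "h holomorphic_on A" and inj: "inj_on h A" and p: "p \<in> A"
  defines "\<phi> \<equiv> \<lambda>w. if w = p then deriv h p else (h w - h p) / (w - p)"
  shows "\<phi> holomorphic_on A" and "\<And>w. w \<in> A \<Longrightarrow> \<phi> w \<noteq> 0"
proof -
  show "\<phi> holomorphic_on A"
    unfolding \<phi>_def by (rule pole_lemma_open[OF h A])
  have "deriv h p \<noteq> 0"
    by (rule holomorphic_injective_imp_regular[OF h A inj p])
  then show "\<And>w. w \<in> A \<Longrightarrow> \<phi> w \<noteq> 0"
    using inj p by (auto simp: \<phi>_def inj_on_def)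
qed

lemma holomorphic_bound_on_cball:
  assumes A: "open A" "cball p r \<subseteq> A" and g: "g holomorphic_on A" and r: "0 < r"
    and bound: "\<And>w. cmod (w - p) = r \<Longrightarrow> cmod (g w) \<le> B"
    and w: "w \<in> cball p r"
  shows "cmod (g w) \<le> B"
proof (rule maximum_modulus_frontier[of g "cball p r" B w])
  show "g holomorphic_on interior (cball p r)"
    using g A(2) interior_subset by (meson holomorphic_on_subset subset_trans)
  show "continuous_on (closure (cball p r)) g"
    using g A(2) by (auto intro: holomorphic_on_imp_continuous_on holomorphic_on_subset)
  show "\<And>z. z \<in> frontier (cball p r) \<Longrightarrow> cmod (g z) \<le> B"
    using r bound by (auto simp: dist_norm norm_minus_commute)
qed (use w in auto)

text \<open>A minimum principle: the difference quotient of an injective function has no zero, so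
  the maximum principle applies to its reciprocal.\<close>

lemma deriv_lower_bound:
  assumes A: "open A" "cball p r \<subseteq> A" and h: "h holomorphic_on A" and inj: "inj_on h A" and r: "0 < r"
    and bound: "\<And>w. cmod (w - p) = r \<Longrightarrow> m \<le> cmod (h w - h p)"
  shows "m \<le> r * cmod (deriv h p)"
proof (cases "m \<le> 0")
  case True
  then show ?thesis using r by (simp add: order_trans[of m 0])
next
  case False
  have p: "p \<in> A" using A r by auto
  define \<phi> where "\<phi> = (\<lambda>w. if w = p then deriv h p else (h w - h p) / (w - p))"
  have F: "\<phi> holomorphic_on A" "\<And>w. w \<in> A \<Longrightarrow> \<phi> w \<noteq> 0"
    unfolding \<phi>_def using nonzero_difference_quotient[OF A(1) h inj p] by auto
  have "cmod (1 / \<phi> p) \<le> r / m"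
  proof (rule holomorphic_bound_on_cball[OF A, where g = "\<lambda>w. 1 / \<phi> w"])
    show "(\<lambda>w. 1 / \<phi> w) holomorphic_on A"
      using F by (intro holomorphic_intros) auto
    fix w assume w: "cmod (w - p) = r"
    then have "w \<noteq> p" using r by auto
    then show "cmod (1 / \<phi> w) \<le> r / m"
      using bound[OF w] False w r by (simp add: \<phi>_def norm_divide frac_le)
  qed (use r in auto)
  moreover have "deriv h p \<noteq> 0" using F(2)[OF p] by (simp add: \<phi>_def)
  ultimately show ?thesis
    using False by (simp add: \<phi>_def norm_divide field_simps)
qed

text \<open>Passing to difference quotients removes the common zero at \<open>p\<close>. Their ratio
  differs from 1 by at most 1/2 on the circle, hence in the disc, while a coincidence
  \<open>g w = g p\<close> would make the ratio 0.\<close>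

lemma close_to_injective_imp_ne:
  assumes A: "open A" "cball p r \<subseteq> A" and g: "g holomorphic_on A"
    and h: "h holomorphic_on A" and inj: "inj_on h A" and r: "0 < r"
    and close: "\<And>w. cmod (w - p) = r \<Longrightarrow> cmod ((g w - g p) - (h w - h p)) \<le> cmod (h w - h p) / 2"
    and w: "w \<in> cball p r" "w \<noteq> p"
  shows "g w \<noteq> g p"
proof
  assume eq: "g w = g p"
  have p: "p \<in> A" using A r by auto
  define \<phi> where "\<phi> = (\<lambda>w. if w = p then deriv h p else (h w - h p) / (w - p))"
  have F: "\<phi> holomorphic_on A" "\<And>w. w \<in> A \<Longrightarrow> \<phi> w \<noteq> 0"
    unfolding \<phi>_def using nonzero_difference_quotient[OF A(1) h inj p] by auto
  define \<psi> where "\<psi> = (\<lambda>w. if w = p then deriv g p else (g w - g p) / (w - p))"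
  have \<psi>: "\<psi> holomorphic_on A"
    unfolding \<psi>_def by (rule pole_lemma_open[OF g A(1)])
  have "cmod (\<psi> w / \<phi> w - 1) \<le> 1/2"
  proof (rule holomorphic_bound_on_cball[OF A _ r _ w(1), where g = "\<lambda>w. \<psi> w / \<phi> w - 1"])
    show "(\<lambda>w. \<psi> w / \<phi> w - 1) holomorphic_on A"
      using F \<psi> by (intro holomorphic_intros) auto
    fix w assume w: "cmod (w - p) = r"
    then have ne: "w \<noteq> p" using r by auto
    have wA: "w \<in> A" using A w by (auto simp: dist_norm norm_minus_commute)
    have "h w - h p \<noteq> 0" using inj wA p ne by (auto simp: inj_on_def)
    moreover have "\<psi> w / \<phi> w = (g w - g p) / (h w - h p)"
      using ne by (simp add: \<psi>_def \<phi>_def)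
    then have "\<psi> w / \<phi> w - 1 = ((g w - g p) - (h w - h p)) / (h w - h p)"
      using \<open>h w - h p \<noteq> 0\<close> by (simp add: diff_divide_distrib)
    then have "cmod (\<psi> w / \<phi> w - 1) = cmod ((g w - g p) - (h w - h p)) / cmod (h w - h p)"
      by (simp only: norm_divide)
    ultimately show "cmod (\<psi> w / \<phi> w - 1) \<le> 1/2"
      using close[OF w] by (simp add: divide_le_eq)
  qed
  then show False
    using w eq by (simp add: \<psi>_def)
qed

text \<open>Quasisymmetry at a single scale: both distances are compared with
  \<open>\<delta>\<close>, not with each other, and \<open>C\<close> may depend on
  \<open>\<delta>\<close>. The gap between \<delta>/4 and \<delta> leaves room for Cauchy estimates
  and for squares that separate the two ranges.\<close>

definition weakly_quasisymmetric_at :: "(complex \<Rightarrow> complex) \<Rightarrow> real \<Rightarrow> real \<Rightarrow> bool" where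
  "weakly_quasisymmetric_at h \<delta> C \<longleftrightarrow>
     (\<forall>z\<in>right_half_plane. \<forall>z'\<in>right_half_plane. \<forall>w\<in>right_half_plane.
        cmod (z' - z) \<le> \<delta> / 4 \<longrightarrow> \<delta> \<le> cmod (w - z) \<longrightarrow> cmod (h z' - h z) \<le> C * cmod (h w - h z))"

lemma open_right_half_plane: "open right_half_plane"
  unfolding right_half_plane_def by (rule open_halfspace_Re_gt)

lemma small_schwarzian_near_boundary:
  assumes "schwarzian_vanishes_at_boundary h"
  shows "\<exists>X>0. \<forall>z\<in>strip X. (Re z)\<^sup>2 * cmod (schwarzian h z) \<le> 1/1000"
proof -
  have "eventually (\<lambda>t. (SUP z\<in>{z. 0 < Re z \<and> Re z \<le> t}.
          ereal (1/2 * (2 * Re z)\<^sup>2 * cmod (schwarzian h z))) < ereal (1/1000)) (at_right 0)"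
    using assms unfolding schwarzian_vanishes_at_boundary_def
    by (rule order_tendstoD) simp
  then obtain b where b: "b > 0" and B: "\<And>t. 0 < t \<Longrightarrow> t < b \<Longrightarrow> (SUP z\<in>{z. 0 < Re z \<and> Re z \<le> t}.
          ereal (1/2 * (2 * Re z)\<^sup>2 * cmod (schwarzian h z))) < ereal (1/1000)"
    unfolding eventually_at_right[OF zero_less_one] by auto
  show ?thesis
  proof (intro exI[of _ b] conjI b ballI)
    fix z assume z: "z \<in> strip b"
    have "ereal (1/2 * (2 * Re z)\<^sup>2 * cmod (schwarzian h z)) \<le> (SUP z\<in>{w. 0 < Re w \<and> Re w \<le> Re z}.
          ereal (1/2 * (2 * Re z)\<^sup>2 * cmod (schwarzian h z)))"
      by (rule SUP_upper) (use z in \<open>auto simp: strip_def\<close>)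
    also have "\<dots> < ereal (1/1000)"
      by (rule B) (use z in \<open>auto simp: strip_def\<close>)
    finally have "2 * ((Re z)\<^sup>2 * cmod (schwarzian h z)) < 1/1000"
      by (simp add: power_mult_distrib mult_ac)
    moreover have "0 \<le> (Re z)\<^sup>2 * cmod (schwarzian h z)" by simp
    ultimately show "(Re z)\<^sup>2 * cmod (schwarzian h z) \<le> 1/1000" by linarith
  qed
qed

text \<open>Weak quasisymmetry takes the place of a distortion theorem. Cauchy estimates on the
  circle of radius \<delta>/4 bound h' and h'' from above, and \<open>deriv_lower_bound\<close> on
  the circle of radius \<delta> bounds h' from below. So |Ph| is at most 32 C / \<delta>, and for
  small \<open>t\<close> the denominator of \<open>h_family\<close> has modulus at least
  1/2.\<close>

lemma h_family_close_interior:
  assumes h: "h holomorphic_on right_half_plane" "inj_on h right_half_plane"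
    and qs: "weakly_quasisymmetric_at h \<delta> C" and \<delta>: "0 < \<delta>" and t: "0 < t"
    and p: "2 * \<delta> \<le> Re p" and tC: "64 * C * t \<le> \<delta>"
    and w: "w \<in> right_half_plane" "\<delta> \<le> cmod (w - p)"
  shows "cmod (2 * of_real t * deriv h p / (1 + of_real t * pre_schwarzian h p))
     \<le> 16 * C / \<delta> * t * cmod (h w - h p)"
proof -
  let ?H = right_half_plane
  have pH: "p \<in> ?H" using p \<delta> by (simp add: right_half_plane_def)
  have cb: "cball p \<delta> \<subseteq> ?H"
  proof
    fix z assume "z \<in> cball p \<delta>"
    then have "cmod (p - z) \<le> \<delta>" by (simp add: dist_norm)
    with abs_Re_le_cmod[of "p - z"] show "z \<in> ?H" using p \<delta> by (simp add: right_half_plane_def)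
  qed
  have cb4: "cball p (\<delta>/4) \<subseteq> ?H"
    by (rule order_trans[OF subset_cball cb]) (use \<delta> in simp)
  have QS: "cmod (h z' - h p) \<le> C * cmod (h w - h p)"
    if "cmod (z' - p) \<le> \<delta>/4" "w \<in> ?H" "\<delta> \<le> cmod (w - p)" for z' w
    using qs that pH cb4 unfolding weakly_quasisymmetric_at_def
    by (auto simp: subset_iff dist_norm norm_minus_commute)
  have d1: "deriv (\<lambda>z. h z - h p) p = deriv h p"
    and d2: "(deriv ^^ 2) (\<lambda>z. h z - h p) p = deriv (deriv h) p"
  proof -
    have fd: "h field_differentiable (at z)" if "z \<in> ?H" for z
      using h(1) that open_right_half_plane holomorphic_on_imp_differentiable_at by blast
    have eq: "deriv (\<lambda>z. h z - h p) z = deriv h z" if "z \<in> ?H" for z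
      using fd[OF that] by simp
    then show "deriv (\<lambda>z. h z - h p) p = deriv h p" using pH .
    have "eventually (\<lambda>z. deriv (\<lambda>z. h z - h p) z = deriv h z) (nhds p)"
      using eq pH open_right_half_plane eventually_nhds by blast
    then have "deriv (deriv (\<lambda>z. h z - h p)) p = deriv (deriv h) p"
      by (rule deriv_cong_ev) simp
    then show "(deriv ^^ 2) (\<lambda>z. h z - h p) p = deriv (deriv h) p"
      by (simp add: numeral_2_eq_2)
  qed
  have cauchy: "cmod ((deriv ^^ n) (\<lambda>z. h z - h p) p) \<le> fact n * B / (\<delta>/4) ^ n"
    if "\<And>z. cmod (p - z) = \<delta>/4 \<Longrightarrow> cmod (h z - h p) \<le> B" for n B
  proof (rule Cauchy_inequality)
    have "(\<lambda>z. h z - h p) holomorphic_on cball p (\<delta>/4)"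
      using h(1) cb4 by (intro holomorphic_intros) (auto intro: holomorphic_on_subset)
    then show "(\<lambda>z. h z - h p) holomorphic_on ball p (\<delta>/4)" "continuous_on (cball p (\<delta>/4)) (\<lambda>z. h z - h p)"
      by (auto intro: holomorphic_on_subset holomorphic_on_imp_continuous_on)
  qed (use \<delta> that in auto)
  have dh0: "deriv h p \<noteq> 0"
    by (rule holomorphic_injective_imp_regular[OF h(1) open_right_half_plane h(2) pH])
  have d: "cmod (deriv h p) \<le> 4 * C / \<delta> * cmod (h w - h p)"
  proof -
    have "cmod (h z - h p) \<le> C * cmod (h w - h p)" if "cmod (p - z) = \<delta>/4" for z
      using QS[of z w] w that by (simp add: norm_minus_commute)
    from cauchy[OF this, of 1] show ?thesis
      using d1 \<delta> by (simp add: field_simps)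
  qed
  \<comment> \<open>The maximum \<open>M\<close> on the small circle bounds h'' from above and,
    divided by \<open>C\<close>, bounds h' from below; it cancels in h'' / h'.\<close>
  define Mset where "Mset = (\<lambda>z. cmod (h z - h p)) ` sphere p (\<delta>/4)"
  have "h holomorphic_on sphere p (\<delta>/4)"
    by (rule holomorphic_on_subset[OF h(1)]) (use cb4 in auto)
  then have "compact Mset"
    unfolding Mset_def
    by (intro compact_continuous_image continuous_intros holomorphic_on_imp_continuous_on) auto
  moreover have "Mset \<noteq> {}" using \<delta> by (simp add: Mset_def)
  ultimately obtain M where M: "M \<in> Mset" "\<And>y. y \<in> Mset \<Longrightarrow> y \<le> M"
    using compact_attains_sup[of Mset] by blast
  then obtain z where "z \<in> sphere p (\<delta>/4)" and zM: "M = cmod (h z - h p)"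
    unfolding Mset_def by blast
  then have z: "cmod (z - p) = \<delta>/4" "M = cmod (h z - h p)"
    by (simp_all add: dist_norm norm_minus_commute)
  have zH: "z \<in> ?H" using z cb4 by (auto simp: dist_norm norm_minus_commute)
  have "z \<noteq> p" using z \<delta> by auto
  then have M0: "0 < M" using z(2) zH pH h(2) by (auto simp: inj_on_def)
  have "M \<le> C * cmod (h w - h p)" using QS[of z w] z w by simp
  then have "0 < C * cmod (h w - h p)" using M0 by simp
  then have C0: "0 < C" using zero_less_mult_pos2 norm_ge_zero
    by (metis mult_zero_right not_less_iff_gr_or_eq zero_less_mult_iff norm_not_less_zero)
  have "M / C \<le> \<delta> * cmod (deriv h p)"
  proof (rule deriv_lower_bound[OF open_right_half_plane cb h \<delta>])
    fix w assume w: "cmod (w - p) = \<delta>"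
    then have "w \<in> ?H" using cb by (auto simp: dist_norm norm_minus_commute)
    then show "M / C \<le> cmod (h w - h p)"
      using QS[of z w] z w C0 by (simp add: field_simps)
  qed
  then have MC: "M \<le> C * \<delta> * cmod (deriv h p)"
    using C0 by (simp add: field_simps)
  have "cmod (deriv (deriv h) p) \<le> 2 * M / (\<delta>/4)^2"
    using cauchy[of M 2] M(2) d2 by (auto simp: Mset_def dist_norm)
  also have "\<dots> \<le> 2 * (C * \<delta> * cmod (deriv h p)) / (\<delta>/4)^2"
    using MC by (intro divide_right_mono mult_left_mono) auto
  also have "\<dots> = 32 * C / \<delta> * cmod (deriv h p)"
    using \<delta> by (simp add: field_simps power2_eq_square)
  finally have "cmod (pre_schwarzian h p) \<le> 32 * C / \<delta>"
    using dh0 by (simp add: pre_schwarzian_def norm_divide divide_le_eq)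
  then have "cmod (of_real t * pre_schwarzian h p) \<le> t * (32 * C / \<delta>)"
    using mult_left_mono[of "cmod (pre_schwarzian h p)" "32 * C / \<delta>" t] t by (simp add: norm_mult)
  also have "\<dots> \<le> 1/2" using tC \<delta> by (simp add: field_simps)
  finally have D: "1/2 \<le> cmod (1 + of_real t * pre_schwarzian h p)"
    using norm_diff_ineq[of 1 "of_real t * pre_schwarzian h p"] by simp
  have "cmod (2 * of_real t * deriv h p / (1 + of_real t * pre_schwarzian h p))
      = 2 * t * cmod (deriv h p) / cmod (1 + of_real t * pre_schwarzian h p)"
    using t by (simp add: norm_mult norm_divide)
  also have "\<dots> \<le> 2 * t * (4 * C / \<delta> * cmod (h w - h p)) / (1/2)"
    using D d t C0 \<delta> by (intro frac_le mult_left_mono) (auto intro!: divide_nonneg_pos)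
  finally show ?thesis by (simp add: mult_ac)
qed


lemma univalent_near_0:
  assumes h: "h holomorphic_on right_half_plane" "inj_on h right_half_plane"
    and S: "schwarzian_vanishes_at_boundary h"
    and qs: "\<And>\<delta>. 0 < \<delta> \<Longrightarrow> \<exists>C>0. weakly_quasisymmetric_at h \<delta> C"
    and T: "0 < T"
    and fam: "\<And>t. t \<in> {0..T} \<Longrightarrow> h_family h t holomorphic_on right_half_plane"
    and D: "\<And>t z. t \<in> {0..T} \<Longrightarrow> z \<in> right_half_plane \<Longrightarrow>
        1 + of_real t * pre_schwarzian h (z + of_real t) \<noteq> 0"
  shows "\<exists>\<tau>. 0 < \<tau> \<and> \<tau> \<le> T \<and> (\<forall>t\<in>{0..\<tau>}. univalent_on (h_family h t) right_half_plane)"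
proof -
  let ?H = right_half_plane
  obtain X where X: "0 < X" "\<And>z. z \<in> strip X \<Longrightarrow> (Re z)\<^sup>2 * cmod (schwarzian h z) \<le> 1/1000"
    using small_schwarzian_near_boundary[OF S] by blast
  have stripH: "strip X \<subseteq> ?H" by (auto simp: strip_def right_half_plane_def)
  interpret small_schwarzian_strip h X
  proof
    show "h holomorphic_on strip X" using h(1) stripH by (rule holomorphic_on_subset)
    show "\<And>z. z \<in> strip X \<Longrightarrow> deriv h z \<noteq> 0"
      using holomorphic_injective_imp_regular[OF h(1) open_right_half_plane h(2)] stripH by blast
  qed (use X in auto)
  \<comment> \<open>Room for \<open>h_family_locally_inj\<close>: with Re z at most 2\<delta>, t
    below \<delta> and |z - w| below \<delta>, the quantity that must stay below \<open>X\<close> is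
    less than 5\<delta>.\<close>
  define \<delta> where "\<delta> = X / 8"
  have \<delta>: "0 < \<delta>" using X by (simp add: \<delta>_def)
  define l where "l = \<delta> / 4"
  have l: "0 < l" using \<delta> by (simp add: l_def)
  obtain C where C: "0 < C" "weakly_quasisymmetric_at h \<delta> C"
    using qs \<delta> by blast
  \<comment> \<open>A second scale for the points \<open>p\<close>, \<open>p + l/5\<close> and
    \<open>p + l\<close> of \<open>h_family_close_to_f\<close>: as \<open>l = \<delta> / 4\<close>,
    the distances from the middle point are (\<delta>/5)/4 and \<delta>/5.\<close>
  have "0 < \<delta> / 5" using \<delta> by simp
  then obtain C1 where C1: "0 < C1" "weakly_quasisymmetric_at h (\<delta>/5) C1"
    using qs by blast
  \<comment> \<open>The first entry is the bound near the axis with sqrt t taken out. The second is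
    the interior bound, which is linear in \<open>t\<close>, and t is at most sqrt t for t at most
    1.\<close>
  define K where "K = max (2 * (20 * C1 * sqrt (4 * X) / l) * C) (16 * C / \<delta>)"
  have "\<forall>\<^sub>F t in at_right 0. 20 * C1 * sqrt (4 * t * X) / l < 1/2"
  proof (rule order_tendstoD)
    show "((\<lambda>t. 20 * C1 * sqrt (4 * t * X) / l) \<longlongrightarrow> 20 * C1 * sqrt (4 * 0 * X) / l) (at_right 0)"
      using l by (intro tendsto_intros) auto
  qed simp
  moreover have "\<forall>\<^sub>F t in at_right 0. 64 * C * t < \<delta>"
  proof (rule order_tendstoD)
    show "((\<lambda>t. 64 * C * t) \<longlongrightarrow> 64 * C * 0) (at_right 0)"
      by (intro tendsto_intros)
  qed (use \<delta> in simp)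
  moreover have "\<forall>\<^sub>F t in at_right 0. K * sqrt t < 1/4"
  proof (rule order_tendstoD)
    show "((\<lambda>t. K * sqrt t) \<longlongrightarrow> K * sqrt 0) (at_right 0)"
      by (intro tendsto_intros)
  qed simp
  moreover have "\<forall>\<^sub>F t in at_right 0. t < min \<delta> (min 1 T)"
    using order_tendstoD(2)[OF tendsto_ident_at, of 0 "min \<delta> (min 1 T)" "{0<..}"] \<delta> T by simp
  ultimately have "\<forall>\<^sub>F t in at_right 0. 20 * C1 * sqrt (4 * t * X) / l < 1/2 \<and> 64 * C * t < \<delta> \<and>
      K * sqrt t < 1/4 \<and> t < min \<delta> (min 1 T)"
    by eventually_elim auto
  then obtain b where b: "0 < b" "\<And>t. 0 < t \<Longrightarrow> t < b \<Longrightarrow> 20 * C1 * sqrt (4 * t * X) / l < 1/2 \<and> 64 * C * t < \<delta> \<and>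
      K * sqrt t < 1/4 \<and> t < min \<delta> (min 1 T)"
    unfolding eventually_at_right[OF zero_less_one] by auto
  have close: "cmod (h_family h t z - h (z + of_real t)) \<le> cmod (h w - h (z + of_real t)) / 4"
    if t: "0 < t" "t < b" and z: "z \<in> ?H" and w: "w \<in> ?H" "\<delta> \<le> cmod (w - (z + of_real t))" for t z w
  proof -
    note bt = b(2)[OF t]
    define p where "p = z + of_real t"
    have Rez: "0 < Re z" using z by (simp add: right_half_plane_def)
    have pH: "p \<in> ?H" using Rez t by (simp add: right_half_plane_def p_def)
    have tT: "t \<in> {0..T}" using bt t by auto
    have "cmod (h_family h t z - h p) \<le> K * sqrt t * cmod (h w - h p)"
    proof (cases "2 * \<delta> \<le> Re p")
      case True
      have "h_family h t z - h p = - (2 * of_real t * deriv h p / (1 + of_real t * pre_schwarzian h p))"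
        by (simp add: h_family_def p_def)
      then have "cmod (h_family h t z - h p)
          = cmod (2 * of_real t * deriv h p / (1 + of_real t * pre_schwarzian h p))"
        by (metis norm_minus_cancel)
      also have "\<dots> \<le> 16 * C / \<delta> * t * cmod (h w - h p)"
        by (rule h_family_close_interior[OF h C(2) \<delta> t(1) True _ w[folded p_def]]) (use bt in simp)
      also have "\<dots> \<le> K * sqrt t * cmod (h w - h p)"
      proof (intro mult_right_mono mult_mono)
        have "t * t \<le> t" using bt t by (simp add: mult_left_le)
        then show "t \<le> sqrt t" using t by (intro real_le_rsqrt) (simp add: power2_eq_square)
      qed (use C \<delta> t in \<open>auto simp: K_def le_max_iff_disj\<close>)
      finally show ?thesis .
    next
      case False
      have "cmod (h_family h t z - h (z + of_real t))
        \<le> 2 * (20 * C1 * sqrt (4 * t * X) / l) * cmod (h (z + of_real t + of_real l) - h (z + of_real t))"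
      proof (rule h_family_close_to_f[OF Rez t(1) l _ D[OF tT z]])
        show "Re z + t + l < X"
          using False \<delta> by (simp add: p_def l_def \<delta>_def)
        let ?q = "z + of_real t + of_real (l/5)"
        have "?q \<in> ?H" "z + of_real t + of_real l \<in> ?H" "p \<in> ?H"
          using Rez t l by (auto simp: right_half_plane_def p_def)
        moreover have "cmod (p - ?q) \<le> (\<delta>/5)/4"
          using l by (simp add: p_def l_def norm_divide)
        moreover have "cmod (z + of_real t + of_real l - ?q) = 4 * l / 5"
        proof -
          have "z + of_real t + of_real l - ?q = of_real (4 * l / 5)" by simp
          then show ?thesis using l by (simp only: norm_of_real)
        qed
        ultimately show "cmod (h (z + of_real t) - h ?q) \<le> C1 * cmod (h (z + of_real t + of_real l) - h ?q)"
          using C1(2) unfolding weakly_quasisymmetric_at_def p_def[symmetric] by (simp add: l_def)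
      qed (use C1 bt in auto)
      also have "\<dots> \<le> 2 * (20 * C1 * sqrt (4 * t * X) / l) * (C * cmod (h w - h p))"
      proof (intro mult_left_mono)
        have "p + of_real l \<in> ?H" using pH l by (simp add: right_half_plane_def)
        then show "cmod (h (z + of_real t + of_real l) - h (z + of_real t)) \<le> C * cmod (h w - h p)"
          using C(2) pH w l unfolding weakly_quasisymmetric_at_def p_def[symmetric]
          by (simp add: l_def norm_divide)
      qed (use C1 l t X in auto)
      also have "\<dots> = 2 * (20 * C1 * sqrt (4 * X) / l) * C * sqrt t * cmod (h w - h p)"
        by (simp add: real_sqrt_mult)
      also have "\<dots> \<le> K * sqrt t * cmod (h w - h p)"
        using t by (intro mult_right_mono) (auto simp: K_def)
      finally show ?thesis by (simp add: p_def)
    qed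
    also have "\<dots> \<le> 1/4 * cmod (h w - h p)"
      using bt by (intro mult_right_mono) auto
    finally show ?thesis by (simp add: p_def)
  qed
  have inj: "inj_on (h_family h t) ?H" if t: "0 < t" "t < b" for t
  proof (rule inj_onI, rule ccontr)
    fix z w assume z: "z \<in> ?H" and w: "w \<in> ?H" and eq: "h_family h t z = h_family h t w" and ne: "z \<noteq> w"
    note bt = b(2)[OF t]
    have tT: "t \<in> {0..T}" using bt t by auto
    have zt: "x + of_real t \<in> ?H" if "x \<in> ?H" for x
      using that t by (simp add: right_half_plane_def)
    \<comment> \<open>The two quarters add up to the 1/2 that
      \<open>close_to_injective_imp_ne\<close> asks for. For distant points this alone excludes
      equal values.\<close>
    have est: "cmod ((h_family h t x - h_family h t y) - (h (x + of_real t) - h (y + of_real t)))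
        \<le> cmod (h (x + of_real t) - h (y + of_real t)) / 2"
      if x: "x \<in> ?H" "y \<in> ?H" "\<delta> \<le> cmod (x - y)" for x y
    proof -
      have 1: "cmod (h_family h t x - h (x + of_real t)) \<le> cmod (h (x + of_real t) - h (y + of_real t)) / 4"
        by (subst norm_minus_commute[of "h (x + of_real t)"], rule close[OF t x(1) zt[OF x(2)]]) (use x(3) in \<open>simp add: norm_minus_commute\<close>)
      have 2: "cmod (h_family h t y - h (y + of_real t)) \<le> cmod (h (x + of_real t) - h (y + of_real t)) / 4"
        by (rule close[OF t x(2) zt[OF x(1)]]) (use x(3) in simp)
      have "(h_family h t x - h_family h t y) - (h (x + of_real t) - h (y + of_real t))
          = (h_family h t x - h (x + of_real t)) - (h_family h t y - h (y + of_real t))"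
        by simp
      then have "cmod ((h_family h t x - h_family h t y) - (h (x + of_real t) - h (y + of_real t)))
          \<le> cmod (h_family h t x - h (x + of_real t)) + cmod (h_family h t y - h (y + of_real t))"
        by (metis norm_triangle_ineq4)
      with 1 2 show ?thesis by linarith
    qed
    consider "\<delta> \<le> cmod (z - w)" | "cmod (z - w) < \<delta>" "Re z \<le> 2 * \<delta>" | "cmod (z - w) < \<delta>" "2 * \<delta> < Re z"
      by linarith
    then show False
    proof cases
      case 1
      then have "h (z + of_real t) = h (w + of_real t)"
        using est[OF z w] eq norm_minus_commute[of "h (z + of_real t)" "h (w + of_real t)"] by simp
      then show False using inj_onD[OF h(2) _ zt zt] z w ne by fastforce
    next
      case 2
      have "z = w"
        by (rule h_family_locally_inj[OF _ _ _ t(1) D[OF tT z] D[OF tT w] eq])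
          (use z w bt 2 X in \<open>auto simp: right_half_plane_def \<delta>_def\<close>)
      then show False using ne by simp
    next
      case 3
      have cb: "cball z \<delta> \<subseteq> ?H"
      proof
        fix y assume "y \<in> cball z \<delta>"
        then have "cmod (z - y) \<le> \<delta>" by (simp add: dist_norm)
        with abs_Re_le_cmod[of "z - y"] show "y \<in> ?H" using 3 \<delta> by (simp add: right_half_plane_def)
      qed
      have "h_family h t w \<noteq> h_family h t z"
      proof (rule close_to_injective_imp_ne[OF open_right_half_plane cb fam[OF tT] _ _ \<delta>,
            where h = "\<lambda>y. h (y + of_real t)" and w = w])
        have "h \<circ> (\<lambda>y. y + of_real t) holomorphic_on ?H"
          by (rule holomorphic_on_compose_gen[OF _ h(1)]) (use zt in \<open>auto intro!: holomorphic_intros\<close>)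
        then show "(\<lambda>y. h (y + of_real t)) holomorphic_on ?H" by (simp add: o_def)
        show "inj_on (\<lambda>y. h (y + of_real t)) ?H"
          by (intro inj_onI) (use inj_onD[OF h(2) _ zt zt] in fastforce)
        fix y assume "cmod (y - z) = \<delta>"
        moreover from this have "y \<in> ?H" using cb by (auto simp: dist_norm norm_minus_commute)
        ultimately show "cmod (h_family h t y - h_family h t z - (h (y + of_real t) - h (z + of_real t)))
           \<le> cmod (h (y + of_real t) - h (z + of_real t)) / 2"
          using est z by simp
      qed (use 3 ne in \<open>auto simp: dist_norm\<close>)
      then show False using eq by simp
    qed
  qed
  define \<tau> where "\<tau> = min (b/2) T"
  have "univalent_on (h_family h t) ?H" if "t \<in> {0..\<tau>}" for t
  proof (cases "t = 0")
    case True
    have "inj_on (h_family h 0) ?H" using h(2) by (simp add: h_family_def inj_on_def)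
    then show ?thesis using fam[of t] T True by (auto simp: univalent_on_def)
  next
    case False
    then show ?thesis using fam[of t] inj[of t] that b(1) by (auto simp: univalent_on_def \<tau>_def)
  qed
  moreover have "0 < \<tau>" "\<tau> \<le> T" using b T by (auto simp: \<tau>_def)
  ultimately show ?thesis by blast
qed

section \<open>Continuous injective extension to the imaginary axis\<close>

context small_schwarzian_strip
begin

text \<open>With s = |z0 - z1|, the solutions that vanish at \<open>z0\<close> and at
  \<open>z1\<close> are both of size s at the point \<open>T'\<close>. On the way to the line Re =
  X/2 their difference, at most 7s at first, grows by a factor of order sqrt (X / s), which leaves
  order sqrt (X s). The cross-ratio identity at \<open>T\<close> converts this into a bound for
  f(z0) - f(z1), hence the Hoelder exponent 1/2.\<close>

lemma boundary_holder:
  assumes z0: "0 < Re z0" "20 * Re z0 < X" and z1: "0 < Re z1"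
    and s: "20 * cmod (z0 - z1) < X"
    and B: "\<And>z. z \<in> strip X \<Longrightarrow> cmod (f z) \<le> B"
    and m: "0 < m" "m \<le> cmod (deriv f (Complex (X/2) (Im z0)))"
  shows "cmod (f z0 - f z1) \<le> 1600 * B\<^sup>2 / (X\<^sup>2 * m) * sqrt (X * cmod (z0 - z1))"
proof (cases "z0 = z1")
  case False
  define s where "s = cmod (z0 - z1)"
  have s0: "0 < s" using False by (simp add: s_def)
  have sX: "20 * s < X" using assms(4) by (simp add: s_def)
  have X: "0 < X" using z0 by linarith
  have abs: "\<bar>Re z0 - Re z1\<bar> \<le> s"
    using abs_Re_le_cmod[of "z0 - z1"] by (simp add: s_def)
  \<comment> \<open>So far to the right that the step from \<open>z1\<close> to \<open>T'\<close>
    also lies in the cone: its real part is at least \<open>s\<close>, its modulus at most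
    \<open>3 * s\<close>.\<close>
  define T' where "T' = z0 + of_real (2 * s)"
  define T where "T = Complex (X/2) (Im z0)"
  define l where "l = X/2 - Re T'"
  have ReT': "Re T' = Re z0 + 2 * s" by (simp add: T'_def)
  have TT': "T = T' + of_real l" by (simp add: T_def l_def T'_def complex_eq_iff)
  have l: "7 / 20 * X \<le> l" using z0 sX by (simp add: l_def ReT')
  have in0: "z0 \<in> strip X" "z1 \<in> strip X" "T' \<in> strip X" "T \<in> strip X"
    using z0 z1 s0 sX X abs ReT' by (auto simp: strip_def T_def)
  define v where "v = T' - z1"
  have v: "T' = z1 + v" by (simp add: v_def)
  have Rev: "s \<le> Re v" using abs by (simp add: v_def ReT')
  have nv: "cmod v \<le> 3 * s"
  proof -
    have "v = (z0 - z1) + of_real (2 * s)" by (simp add: v_def T'_def)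
    then have "cmod v \<le> cmod (z0 - z1) + cmod (of_real (2 * s) :: complex)"
      using norm_triangle_ineq by metis
    then show ?thesis using s0 by (simp only: s_def[symmetric] norm_of_real)
  qed
  have c0: "den (f z0) z0 \<noteq> 0" "cmod (quo (f z0) z0) \<le> 2 * Re z0"
    and c1: "den (f z1) z1 \<noteq> 0" "cmod (quo (f z1) z1) \<le> 2 * Re z1"
    using in0 z0 z1 by (auto simp: den_self quo_self)
  note A = quo_along_segment[OF in0(1) _ c0, of "of_real (2 * s)", folded T'_def, OF in0(3)]
  have vle: "cmod v \<le> 3 * Re v" using nv Rev by linarith
  note B' = quo_along_segment[OF in0(2) in0(3)[unfolded v] c1 vle, folded v]
  have A1: "den (f z0) T' \<noteq> 0" and "cmod (quo (f z0) T' - of_real (2 * s)) \<le> 2 * s / 50"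
    using A s0 by (auto simp: quo_self)
  then have A2: "cmod (quo (f z0) T') \<le> 3 * s"
    using norm_triangle_sub[of "quo (f z0) T'" "of_real (2 * s)"] s0 by (simp only: norm_of_real)
  have B1: "den (f z1) T' \<noteq> 0" using B' by simp
  have "cmod (quo (f z1) T' - v) \<le> cmod v / 50"
    using B' by (simp add: quo_self)
  then have B2: "cmod (quo (f z1) T') \<le> 31 / 10 * s"
    using norm_triangle_sub[of "quo (f z1) T'" v] nv s0 by linarith
  have A3: "cmod (quo (f z0) T') \<le> 2 * Re T'" and B3: "cmod (quo (f z1) T') \<le> 2 * Re T'"
    using A2 B2 ReT' z0 s0 by linarith+
  have l0: "0 \<le> l" using l X by linarith
  note A4 = quo_horizontal[OF in0(3) in0(4)[unfolded TT'] l0 A1 A3, folded TT']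
  note B4 = quo_horizontal[OF in0(3) in0(4)[unfolded TT'] l0 B1 B3, folded TT']
  have low: "X/10 \<le> cmod q" if "cmod (q - q' - of_real l) \<le> l/50" "cmod q' \<le> 31/10 * s" for q q' :: complex
  proof -
    have "of_real l = q - q' - (q - q' - of_real l)" by simp
    then have "cmod (of_real l) \<le> cmod (q - q') + cmod (q - q' - of_real l)"
      by (metis norm_triangle_ineq4)
    moreover have "cmod (q - q') \<le> cmod q + cmod q'" by (rule norm_triangle_ineq4)
    moreover have "cmod (of_real l :: complex) = l" using l0 by simp
    ultimately show ?thesis using that l X sX by linarith
  qed
  have low0: "X/10 \<le> cmod (quo (f z0) T)" and low1: "X/10 \<le> cmod (quo (f z1) T)"
    using low[OF A4(2)] low[OF B4(2)] A2 B2 s0 by auto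
  have "(cmod (quo (f z0) T - quo (f z1) T))\<^sup>2 * Re T' \<le> (cmod (quo (f z0) T' - quo (f z1) T'))\<^sup>2 * (X/2)"
    using quo_diff_growth[OF in0(3) in0(4)[unfolded TT'] l0 A1 A3 B1 B3]
    by (simp add: TT' l_def)
  also have "\<dots> \<le> (7 * s)\<^sup>2 * (X/2)"
    using A2 B2 norm_triangle_ineq4[of "quo (f z0) T'" "quo (f z1) T'"] X s0
    by (intro mult_right_mono power_mono) auto
  finally have "(cmod (quo (f z0) T - quo (f z1) T))\<^sup>2 * (2 * s) \<le> (7 * s)\<^sup>2 * (X/2)"
    using z0 ReT' by (smt (verit) mult_left_mono zero_le_power2)
  then have "(cmod (quo (f z0) T - quo (f z1) T))\<^sup>2 \<le> 49/4 * (X * s)"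
    using s0 by (simp add: power2_eq_square mult_ac)
  also have "\<dots> \<le> (4 * sqrt (X * s))\<^sup>2"
    using X s0 by (simp add: power_mult_distrib)
  finally have m1: "cmod (quo (f z0) T - quo (f z1) T) \<le> 4 * sqrt (X * s)"
    by (rule power2_le_imp_le) (use X s0 in simp)
  have BT: "cmod (f T) \<le> B" "cmod (f z0) \<le> B" "cmod (f z1) \<le> B" using B in0 by auto
  then have B0: "0 \<le> B" using norm_ge_zero order_trans by blast
  have "m * cmod (f z0 - f z1) * ((X/10) * (X/10))
      \<le> cmod (deriv f T) * cmod (f z0 - f z1) * (cmod (quo (f z0) T) * cmod (quo (f z1) T))"
    using m low0 low1 X by (intro mult_mono) (auto simp: T_def)
  also have "\<dots> = cmod (quo (f z1) T - quo (f z0) T) * (cmod (f T - f z0) * cmod (f T - f z1))"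
    using quo_cross_ratio[OF A4(1) B4(1)] by (metis norm_mult)
  also have "\<dots> \<le> 4 * sqrt (X * s) * ((2 * B) * (2 * B))"
    using m1 BT norm_triangle_ineq4[of "f T" "f z0"] norm_triangle_ineq4[of "f T" "f z1"] X s0 B0
    by (intro mult_mono) (auto simp: norm_minus_commute)
  finally have "cmod (f z0 - f z1) \<le> 1600 * B\<^sup>2 / (X\<^sup>2 * m) * sqrt (X * s)"
    using m X by (simp add: field_simps power2_eq_square)
  then show ?thesis by (simp add: s_def)
qed simp

end

section \<open>Limits at the imaginary axis\<close>

text \<open>Moebius invariance of the Schwarzian derivative, for the maps that send one value to
  infinity. It allows passing from \<open>h\<close> to a function that is bounded near the axis, as
  \<open>boundary_holder\<close> requires. The term -2h'/(h - a) gained by the pre-Schwarzian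
  cancels in the combination.\<close>

lemma schwarzian_inversion:
  assumes A: "open A" and h: "h holomorphic_on A" and nz: "\<And>z. z \<in> A \<Longrightarrow> deriv h z \<noteq> 0"
    and a: "\<And>z. z \<in> A \<Longrightarrow> h z \<noteq> a" and z: "z \<in> A"
  shows "deriv (\<lambda>z. 1 / (h z - a)) z = - deriv h z / (h z - a)\<^sup>2"
    and "schwarzian (\<lambda>z. 1 / (h z - a)) z = schwarzian h z"
proof -
  let ?f = "\<lambda>z. 1 / (h z - a)"
  have h1: "(h has_field_derivative deriv h z) (at z)" if "z \<in> A" for z
    using h A that holomorphic_derivI by blast
  have h2: "(deriv h has_field_derivative deriv (deriv h) z) (at z)" if "z \<in> A" for z
    using holomorphic_deriv[OF h A] A that holomorphic_derivI by blast
  have P: "pre_schwarzian h holomorphic_on A"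
  proof -
    have "(\<lambda>z. deriv (deriv h) z / deriv h z) holomorphic_on A"
      using h A nz by (intro holomorphic_on_divide holomorphic_deriv) auto
    then show ?thesis by (simp add: pre_schwarzian_def[abs_def])
  qed
  have h3: "(pre_schwarzian h has_field_derivative deriv (pre_schwarzian h) z) (at z)" if "z \<in> A" for z
    using P A that holomorphic_derivI by blast
  have d1: "deriv ?f z = - deriv h z / (h z - a)\<^sup>2" if "z \<in> A" for z
  proof -
    have "((\<lambda>z. inverse (h z - a)) has_field_derivative - (deriv h z * inverse ((h z - a)\<^sup>2))) (at z)"
      using DERIV_inverse_fun[of "\<lambda>z. h z - a" "deriv h z" z UNIV] h1[OF that] a[OF that]
      by (auto intro!: derivative_eq_intros simp: power2_eq_square)
    then show ?thesis
      by (simp add: DERIV_imp_deriv divide_inverse)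
  qed
  show "deriv ?f z = - deriv h z / (h z - a)\<^sup>2" by (rule d1[OF z])
  have cong: "deriv g z = deriv g' z" if "\<And>w. w \<in> A \<Longrightarrow> g w = g' w" "z \<in> A" for g g' :: "complex \<Rightarrow> complex" and z
    by (rule deriv_cong_ev) (use that A eventually_nhds in \<open>blast, simp\<close>)
  have d2: "pre_schwarzian ?f z = pre_schwarzian h z - 2 * deriv h z / (h z - a)" if z: "z \<in> A" for z
  proof -
    have "((\<lambda>z. - deriv h z / (h z - a)\<^sup>2) has_field_derivative
        (- deriv (deriv h) z * (h z - a)\<^sup>2 + deriv h z * (2 * (h z - a) * deriv h z)) / ((h z - a)\<^sup>2 * (h z - a)\<^sup>2)) (at z)"
      by (rule derivative_eq_intros h1[OF z] h2[OF z] refl)+ (use a[OF z] in \<open>auto simp: mult_ac\<close>)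
    then have 1: "deriv (deriv ?f) z = (- deriv (deriv h) z * (h z - a)\<^sup>2 + deriv h z * (2 * (h z - a) * deriv h z)) / ((h z - a)\<^sup>2 * (h z - a)\<^sup>2)"
      using cong[OF d1 z] by (simp add: DERIV_imp_deriv)
    have *: "((- y * w\<^sup>2 + x * (2 * w * x)) / (w\<^sup>2 * w\<^sup>2)) / (- x / w\<^sup>2) = y / x - 2 * x / w"
      if "x \<noteq> 0" "w \<noteq> 0" for x y w :: complex
      using that by (simp add: divide_simps power2_eq_square) (simp add: algebra_simps)
    show ?thesis
      unfolding pre_schwarzian_def d1[OF z] 1
      by (rule *) (use nz[OF z] a[OF z] in auto)
  qed
  have "((\<lambda>z. pre_schwarzian h z - 2 * deriv h z / (h z - a)) has_field_derivative
     deriv (pre_schwarzian h) z - (2 * deriv (deriv h) z * (h z - a) - 2 * deriv h z * deriv h z) / ((h z - a) * (h z - a))) (at z)"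
    by (rule derivative_eq_intros h1[OF z] h2[OF z] h3[OF z] refl)+ (use a[OF z] in auto)
  then have "deriv (pre_schwarzian ?f) z = deriv (pre_schwarzian h) z
      - (2 * deriv (deriv h) z * (h z - a) - 2 * deriv h z * deriv h z) / ((h z - a) * (h z - a))"
    using cong[OF d2 z] by (simp add: DERIV_imp_deriv)
  moreover have "deriv (deriv h) z = pre_schwarzian h z * deriv h z"
    using nz[OF z] by (simp add: pre_schwarzian_def)
  moreover have *: "(2 * (P * x) * y - 2 * x * x) / (y * y) + (P - 2 * x / y)\<^sup>2 / 2 = P\<^sup>2 / 2" if "y \<noteq> 0" for P x y :: complex
    using that by (simp add: divide_simps) (simp add: algebra_simps power2_eq_square)
  have "(2 * (pre_schwarzian h z * deriv h z) * (h z - a) - 2 * deriv h z * deriv h z) / ((h z - a) * (h z - a))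
      = (pre_schwarzian h z)\<^sup>2 / 2 - (pre_schwarzian h z - 2 * deriv h z / (h z - a))\<^sup>2 / 2"
    unfolding eq_diff_eq by (rule *) (use a[OF z] in simp)
  ultimately show "schwarzian ?f z = schwarzian h z"
    unfolding schwarzian_def d2[OF z] by simp
qed


text \<open>The inverted function is bounded near the axis, so \<open>boundary_holder\<close> makes
  it uniformly continuous on a bounded piece of a strip, and it extends to the closure.\<close>

lemma inversion_boundary_limit:
  assumes h: "h holomorphic_on {z. 0 < Re z}" "inj_on h {z. 0 < Re z}"
    and S: "0 < X" "\<And>z. z \<in> strip X \<Longrightarrow> (Re z)\<^sup>2 * cmod (schwarzian h z) \<le> 1/1000"
    and z0: "0 < Re z0"
  shows "\<exists>L. ((\<lambda>z. 1 / (h z - h z0)) \<longlongrightarrow> L) (at (Complex 0 y) within {z. 0 < Re z})"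
proof -
  let ?H = "{z. 0 < Re z}"
  have oH: "open ?H" by (rule open_halfspace_Re_gt)
  define f where "f = (\<lambda>z. 1 / (h z - h z0))"
  \<comment> \<open>The strip of width \<open>Y\<close> misses the ball about \<open>z0\<close>, and
    by injectivity \<open>h\<close> then omits a disc about \<open>h z0\<close> on the strip. This
    is what bounds \<open>f\<close>.\<close>
  define Y where "Y = min X (Re z0 / 2)"
  have Y: "0 < Y" using S z0 by (simp add: Y_def)
  have ball: "ball z0 (Re z0 / 2) \<subseteq> ?H"
  proof
    fix z assume "z \<in> ball z0 (Re z0 / 2)"
    then show "z \<in> ?H" using abs_Re_le_cmod[of "z0 - z"] z0 by (simp add: dist_norm)
  qed
  have "open (h ` ball z0 (Re z0 / 2))"
    using h ball by (intro open_mapping_thm3) (auto intro: holomorphic_on_subset inj_on_subset)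
  then obtain r where r: "0 < r" "ball (h z0) r \<subseteq> h ` ball z0 (Re z0 / 2)"
    using z0 by (metis centre_in_ball half_gt_zero image_eqI open_contains_ball)
  have far: "r \<le> cmod (h z - h z0)" if z: "z \<in> strip Y" for z
  proof (rule ccontr)
    assume "\<not> r \<le> cmod (h z - h z0)"
    then have "h z \<in> ball (h z0) r" by (simp add: dist_norm norm_minus_commute)
    then obtain w where w: "w \<in> ball z0 (Re z0 / 2)" "h z = h w" using r by blast
    then have "z = w" using inj_onD[OF h(2) w(2)] z ball by (auto simp: strip_def)
    then show False
      using w z abs_Re_le_cmod[of "z0 - z"] by (auto simp: strip_def Y_def dist_norm)
  qed
  have sub: "strip Y \<subseteq> ?H" "strip Y \<subseteq> strip X" by (auto simp: strip_def Y_def)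
  have hY: "h holomorphic_on strip Y" using h(1) sub(1) by (rule holomorphic_on_subset)
  have hn: "deriv h z \<noteq> 0" if "z \<in> strip Y" for z
    using holomorphic_injective_imp_regular[OF h(1) oH h(2)] that sub by blast
  have ha: "h z \<noteq> h z0" if "z \<in> strip Y" for z
    using far[OF that] r by auto
  note I = schwarzian_inversion[OF open_strip hY hn ha, folded f_def]
  interpret F: small_schwarzian_strip f Y
  proof
    show "f holomorphic_on strip Y"
      unfolding f_def by (intro holomorphic_intros hY) (use ha in auto)
    show "\<And>z. z \<in> strip Y \<Longrightarrow> deriv f z \<noteq> 0"
      using I(1) hn ha by simp
    show "\<And>z. z \<in> strip Y \<Longrightarrow> (Re z)\<^sup>2 * cmod (schwarzian f z) \<le> 1/1000"
      using I(2) S sub by auto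
  qed
  define B where "B = 1 / r"
  have B: "cmod (f z) \<le> B" if "z \<in> strip Y" for z
    using far[OF that] r by (simp add: f_def B_def norm_divide frac_le)
  \<comment> \<open>A uniform lower bound of |f'| on the line Re = Y/2 is needed. It comes from
    compactness for bounded heights, which suffices for the limit at one boundary point.\<close>
  define D where "D = (\<lambda>v. cmod (deriv f (Complex (Y/2) v)))"
  have inY: "Complex (Y/2) v \<in> strip Y" for v using Y by (simp add: strip_def)
  have "continuous_on {y-1..y+1} (\<lambda>v. Complex (Y/2) v)"
    unfolding Complex_eq by (intro continuous_intros)
  then have "continuous_on {y-1..y+1} D"
    unfolding D_def
    by (intro continuous_on_norm continuous_on_compose2[OF holomorphic_on_imp_continuous_on[OF F.holo_deriv]])
       (use inY in auto)
  then obtain v0 where v0: "\<And>v. v \<in> {y-1..y+1} \<Longrightarrow> D v0 \<le> D v"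
    using continuous_attains_inf[of "{y-1..y+1}" D] by fastforce
  define m where "m = D v0"
  have m: "0 < m" using F.deriv_nz[OF inY] by (simp add: m_def D_def)
  define K where "K = 1600 * B\<^sup>2 / (Y\<^sup>2 * m)"
  have K: "0 \<le> K" using m by (simp add: K_def)
  define R where "R = {z. 0 < Re z \<and> 20 * Re z < Y \<and> \<bar>Im z - y\<bar> < 1}"
  have holder: "cmod (f z - f w) \<le> K * sqrt (Y * cmod (z - w))"
    if "z \<in> R" "w \<in> R" "20 * cmod (z - w) < Y" for z w
    unfolding K_def
    by (rule F.boundary_holder) (use that B m v0[of "Im z"] in \<open>auto simp: R_def m_def D_def abs_less_iff\<close>)
  have "uniformly_continuous_on R f"
    unfolding uniformly_continuous_on_def
  proof (intro allI impI)
    fix e :: real assume e: "0 < e"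
    define d where "d = min (Y / 20) ((e / (K + 1))\<^sup>2 / Y)"
    have "0 < d" using Y e K by (auto simp: d_def intro!: divide_pos_pos)
    moreover have "dist (f w) (f z) < e" if zw: "z \<in> R" "w \<in> R" "dist w z < d" for z w
    proof -
      have s: "cmod (w - z) < d" using zw by (simp add: dist_norm)
      have "cmod (f w - f z) \<le> K * sqrt (Y * cmod (w - z))"
        by (rule holder) (use zw s in \<open>auto simp: d_def\<close>)
      also have "\<dots> \<le> K * sqrt ((e / (K + 1))\<^sup>2)"
        using s Y K by (intro mult_left_mono real_sqrt_le_mono) (auto simp: d_def field_simps)
      also have "\<dots> = K * (e / (K + 1))" using e K by simp
      also have "\<dots> < e" using e K by (simp add: field_simps)
      finally show ?thesis by (simp add: dist_norm)
    qed
    ultimately show "\<exists>d>0. \<forall>x\<in>R. \<forall>x'\<in>R. dist x' x < d \<longrightarrow> dist (f x') (f x) < e" by blast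
  qed
  then obtain g where g: "uniformly_continuous_on (closure R) g" "\<And>x. x \<in> R \<Longrightarrow> f x = g x"
    using uniformly_continuous_on_extension_on_closure by metis
  define b where "b = Complex 0 y"
  have "b \<in> closure R"
    unfolding closure_approachable
  proof (intro allI impI)
    fix e :: real assume e: "0 < e"
    have "dist (Complex (min (e/2) (Y/40)) y) b < e"
      using e Y by (simp add: b_def dist_norm cmod_def min_def)
    moreover have "Complex (min (e/2) (Y/40)) y \<in> R" using e Y by (simp add: R_def min_def)
    ultimately show "\<exists>w\<in>R. dist w b < e" by blast
  qed
  then have "(g \<longlongrightarrow> g b) (at b within closure R)"
    using uniformly_continuous_imp_continuous[OF g(1)] by (simp add: continuous_on_def)
  then have "(g \<longlongrightarrow> g b) (at b within R)"
    by (rule tendsto_within_subset) (rule closure_subset)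
  then have lim: "(f \<longlongrightarrow> g b) (at b within R)"
    by (rule Lim_transform_eventually) (use g(2) in \<open>auto simp: eventually_at_filter\<close>)
  have "at b within R = at b within ?H"
  proof (rule at_within_nhd)
    show "b \<in> ball b (min 1 (Y/20))" using Y by simp
    show "R \<inter> ball b (min 1 (Y / 20)) - {b} = ?H \<inter> ball b (min 1 (Y / 20)) - {b}"
    proof (intro equalityI subsetI)
      fix z assume z: "z \<in> ?H \<inter> ball b (min 1 (Y / 20)) - {b}"
      then have "cmod (z - b) < 1" "cmod (z - b) < Y/20" by (auto simp: dist_norm norm_minus_commute)
      then have "\<bar>Re z\<bar> < Y/20" "\<bar>Im z - y\<bar> < 1"
        using abs_Re_le_cmod[of "z - b"] abs_Im_le_cmod[of "z - b"] by (auto simp: b_def)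
      then show "z \<in> R \<inter> ball b (min 1 (Y / 20)) - {b}" using z by (auto simp: R_def)
    qed (auto simp: R_def)
  qed auto
  then show ?thesis using lim by (auto simp: f_def b_def)
qed

section \<open>Injectivity on the circle by the Jordan curve theorem\<close>

lemma connected_subset_disjoint_open:
  assumes "connected S" "open A" "open B" "A \<inter> B = {}" "S \<subseteq> A \<union> B"
  shows "S \<subseteq> A \<or> S \<subseteq> B"
  using connectedD[OF assms(1-3)] assms(4,5) by blast

text \<open>The squared modulus equals 1 - s (1 - s) |b - a|^2. As \<open>s\<close> ranges over all
  reals, this also shows that the line through \<open>a\<close> and \<open>b\<close> meets the disc
  in the chord only.\<close>

lemma chord_in_ball:
  fixes a b :: complex
  assumes "cmod a = 1" "cmod b = 1" "a \<noteq> b"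
  shows "cmod (a + of_real s * (b - a)) < 1 \<longleftrightarrow> 0 < s \<and> s < 1"
proof -
  have a1: "(Re a)\<^sup>2 + (Im a)\<^sup>2 = 1" and b1: "(Re b)\<^sup>2 + (Im b)\<^sup>2 = 1"
    using assms by (simp_all add: cmod_power2[symmetric])
  have "(cmod (a + of_real s * (b - a)))\<^sup>2
     = (1 - s) * ((Re a)\<^sup>2 + (Im a)\<^sup>2) + s * ((Re b)\<^sup>2 + (Im b)\<^sup>2) - s * (1 - s) * (cmod (b - a))\<^sup>2"
    unfolding cmod_power2 by (simp add: algebra_simps power2_eq_square)
  then have "(cmod (a + of_real s * (b - a)))\<^sup>2 = 1 - s * (1 - s) * (cmod (b - a))\<^sup>2"
    using a1 b1 by simp
  moreover have "0 < (cmod (b - a))\<^sup>2" using assms by simp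
  moreover have "cmod (a + of_real s * (b - a)) < 1 \<longleftrightarrow> (cmod (a + of_real s * (b - a)))\<^sup>2 < 1"
    by (simp add: power_less_one_iff abs_square_less_1)
  ultimately show ?thesis
    by (simp add: zero_less_mult_iff) (smt (verit) mult_pos_pos mult_nonneg_nonpos mult_nonpos_nonneg)
qed

text \<open>The chord from \<open>\<omega>1\<close> to \<open>\<omega>2\<close> would be mapped onto a Jordan curve meeting \<^term>\<open>J\<close> in one point only.
  The rest of \<^term>\<open>J\<close> lies on one side of that curve, so that \<^term>\<open>k\<close> is constant on one of the two
  arcs of the circle.\<close>

lemma boundary_values_distinct:
  fixes k :: "complex \<Rightarrow> complex"
  assumes cont: "continuous_on (cball 0 1 - {q}) k" and inj: "inj_on k (ball 0 1 - {q})"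
    and q: "q \<in> ball 0 1" and pole: "filterlim k at_infinity (at q)"
    and J: "k ` (ball 0 1 - {q}) \<inter> J = {}" "k ` sphere 0 1 \<subseteq> J"
    and conn: "\<And>p. p \<in> J \<Longrightarrow> connected (J - {p})"
    and nonconst: "\<And>U p. open U \<Longrightarrow> U \<inter> sphere 0 1 \<noteq> {} \<Longrightarrow> \<exists>x\<in>U \<inter> sphere 0 1. k x \<noteq> p"
    and a: "a \<in> sphere 0 1" and b: "b \<in> sphere 0 1" "a \<noteq> b" and qab: "q \<notin> closed_segment a b"
  shows "k a \<noteq> k b"
proof
  assume eq: "k a = k b"
  define p where "p = k a"
  define c where "c s = a + of_real s * (b - a)" for s :: real
  have na: "cmod a = 1" "cmod b = 1" using a b by (auto simp: dist_norm)
  note chord = chord_in_ball[OF na b(2), folded c_def]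
  have c01: "c 0 = a" "c 1 = b" by (simp_all add: c_def)
  have cinj: "c x = c y \<Longrightarrow> x = y" for x y using b(2) by (simp add: c_def)
  have cq: "c s \<noteq> q" if "s \<in> {0..1}" for s
  proof -
    have "c s = (1 - s) *\<^sub>R a + s *\<^sub>R b" by (simp add: c_def scaleR_conv_of_real algebra_simps)
    then have "c s \<in> closed_segment a b" using that by (auto simp: closed_segment_def)
    then show ?thesis using qab by auto
  qed
  have cball: "c s \<in> cball 0 1 - {q}" if "s \<in> {0..1}" for s
    using chord[of s] cq[OF that] na c01 that
    by (cases "s = 0 \<or> s = 1") auto
  have copen: "c s \<in> ball 0 1 - {q}" if "0 < s" "s < 1" for s
    using chord[of s] cq[of s] that by auto
  have pJ: "p \<in> J" using J(2) a by (auto simp: p_def)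
  \<comment> \<open>Under the assumption \<open>k a = k b\<close> the image of the chord is a closed
    curve. It is bounded since \<open>q\<close> is off the chord, and it meets \<open>J\<close> only
    at its base point \<open>p\<close>.\<close>
  define \<gamma> where "\<gamma> = k \<circ> c"
  have pathg: "path \<gamma>"
    unfolding path_def \<gamma>_def
  proof (rule continuous_on_compose)
    show "continuous_on {0..1} c" unfolding c_def by (intro continuous_intros)
    show "continuous_on (c ` {0..1}) k" by (rule continuous_on_subset[OF cont]) (use cball in blast)
  qed
  have ginJ: "\<gamma> s \<notin> J" if "0 < s" "s < 1" for s
    using J(1) copen[OF that] unfolding \<gamma>_def o_def by blast
  have gend: "\<gamma> 0 = p" "\<gamma> 1 = p" using c01 eq by (simp_all add: \<gamma>_def p_def)
  have lf: "loop_free \<gamma>"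
    unfolding loop_free_def
  proof (intro ballI impI)
    fix x y :: real assume x: "x \<in> {0..1}" and y: "y \<in> {0..1}" and xy: "\<gamma> x = \<gamma> y"
    have end_iff: "\<gamma> s \<in> J \<longleftrightarrow> s = 0 \<or> s = 1" if "s \<in> {0..1}" for s
      using ginJ[of s] gend pJ that by (cases "s = 0 \<or> s = 1") auto
    show "x = y \<or> x = 0 \<and> y = 1 \<or> x = 1 \<and> y = 0"
    proof (cases "\<gamma> x \<in> J")
      case True
      then show ?thesis using end_iff x y xy by metis
    next
      case False
      then have "0 < x" "x < 1" "0 < y" "y < 1"
        using end_iff x y xy by (metis atLeastAtMost_iff order_le_less)+
      then have "c x = c y" using inj copen xy by (auto simp: \<gamma>_def inj_on_def)
      then show ?thesis using cinj by blast
    qed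
  qed
  have sp: "simple_path \<gamma>" using pathg lf by (simp add: simple_path_def)
  define C where "C = path_image \<gamma>"
  have loop: "pathfinish \<gamma> = pathstart \<gamma>" using gend by (simp add: pathfinish_def pathstart_def)
  note JI = Jordan_inside_outside[OF sp loop, folded C_def]
  have CJ: "C \<inter> J = {p}"
  proof -
    have "\<gamma> s = p" if "s \<in> {0..1}" "\<gamma> s \<in> J" for s
      using ginJ[of s] gend that by (cases "s = 0 \<or> s = 1") auto
    then show ?thesis using gend pJ by (auto simp: C_def path_image_def intro!: image_eqI[of _ _ 0])
  qed
  \<comment> \<open>Up to a factor the signed distance from the line through \<open>a\<close> and
    \<open>b\<close>.\<close>
  define \<sigma> where "\<sigma> w = Im ((w - a) * cnj (b - a))" for w
  have on_line: "\<exists>s. w = c s" if "\<sigma> w = 0" for w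
  proof -
    have ne: "b - a \<noteq> 0" using b by simp
    define r where "r = Re ((w - a) * cnj (b - a))"
    define D where "D = (cmod (b - a))\<^sup>2"
    have D: "of_real D \<noteq> (0::complex)" using ne by (simp add: D_def)
    have "(w - a) * cnj (b - a) = of_real r"
      using that by (simp add: \<sigma>_def r_def complex_eq_iff)
    then have "(w - a) * (cnj (b - a) * (b - a)) = of_real r * (b - a)"
      by (metis mult.assoc)
    moreover have "cnj (b - a) * (b - a) = of_real D"
      unfolding D_def by (metis complex_norm_square mult.commute of_real_power)
    ultimately have "w - a = of_real r * (b - a) / of_real D"
      using D by (metis nonzero_mult_div_cancel_right)
    then have "w - a = of_real (r / D) * (b - a)"
      by (metis of_real_divide times_divide_eq_left)
    then have "w = c (r / D)"
      unfolding c_def by (metis add_diff_cancel_left' diff_add_cancel add.commute)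
    then show ?thesis ..
  qed
  have sq: "\<sigma> q \<noteq> 0"
  proof
    assume "\<sigma> q = 0"
    then obtain s where "q = c s" using on_line by blast
    then show False using chord[of s] q cq[of s] by auto
  qed
  \<comment> \<open>The sign is normalised so that the pole \<open>q\<close> lies on the negative
    side, in \<open>V (-1)\<close>.\<close>
  define \<rho> where "\<rho> w = - sgn (\<sigma> q) * \<sigma> w" for w
  have \<rho>q: "\<rho> q < 0" using sq by (simp add: \<rho>_def sgn_if)
  have \<rho>0: "\<rho> w = 0 \<longleftrightarrow> \<sigma> w = 0" for w using sq by (simp add: \<rho>_def sgn_if)
  have cont\<rho>: "continuous_on UNIV \<rho>"
    unfolding \<rho>_def \<sigma>_def by (intro continuous_intros)
  define U where "U e = {w. 0 < e * \<rho> w}" for e :: real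
  have openU: "open (U e)" for e
    unfolding U_def by (intro open_Collect_less continuous_intros cont\<rho>)
  have \<rho>lin: "\<rho> (u *\<^sub>R x + v *\<^sub>R y) = u * \<rho> x + v * \<rho> y" if "u + v = 1" for u v x y
  proof -
    have \<sigma>_eq: "\<sigma> w = (Im w - Im a) * Re (b - a) - (Re w - Re a) * Im (b - a)" for w
      by (simp add: \<sigma>_def algebra_simps)
    have "v = 1 - u" using that by simp
    have "\<sigma> (u *\<^sub>R x + v *\<^sub>R y) = u * \<sigma> x + v * \<sigma> y"
      unfolding \<sigma>_eq \<open>v = 1 - u\<close> by (simp add: algebra_simps)
    then show ?thesis by (simp add: \<rho>_def algebra_simps)
  qed
  have convU: "convex (U e)" for e
    unfolding convex_def
  proof (intro ballI allI impI)
    fix x y and u v :: real assume *: "x \<in> U e" "y \<in> U e" "0 \<le> u" "0 \<le> v" "u + v = 1"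
    have "0 < u * (e * \<rho> x) + v * (e * \<rho> y)"
      using * by (cases "u = 0") (auto simp: U_def intro: add_pos_nonneg)
    then show "u *\<^sub>R x + v *\<^sub>R y \<in> U e"
      using * by (simp add: U_def \<rho>lin algebra_simps)
  qed
  define V where "V e = ball 0 1 \<inter> U e" for e
  have V: "open (V e)" "connected (V e)" for e
    using openU convU by (auto simp: V_def intro!: open_Int convex_connected convex_Int)
  have qV: "q \<in> V (-1)" "q \<notin> V 1" using q \<rho>q by (auto simp: V_def U_def)
  have split: "w \<in> V 1 \<or> w \<in> V (-1) - {q} \<or> (\<exists>s. 0 < s \<and> s < 1 \<and> w = c s)" if "w \<in> ball 0 1 - {q}" for w
  proof (cases "\<rho> w = 0")
    case True
    then obtain s where "w = c s" using on_line \<rho>0 by blast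
    then show ?thesis using chord[of s] that by auto
  qed (use that in \<open>auto simp: V_def U_def\<close>)
  have \<rho>c: "\<rho> (c s) = 0" for s
    unfolding \<rho>0 by (simp add: \<sigma>_def c_def algebra_simps)
  have kC: "k w \<notin> C" if "w \<in> V e" "w \<noteq> q" for w e
  proof
    assume "k w \<in> C"
    then obtain s where s: "s \<in> {0..1}" "k w = \<gamma> s" by (auto simp: C_def path_image_def)
    have w: "w \<in> ball 0 1 - {q}" using that by (auto simp: V_def)
    then have "k w \<notin> J" using J by blast
    then have "s \<noteq> 0" "s \<noteq> 1" using s gend pJ by auto
    then have "c s \<in> ball 0 1 - {q}" using copen[of s] s by auto
    then have "w = c s" using inj w s by (auto simp: inj_on_def \<gamma>_def)
    then show False using that \<rho>c by (auto simp: V_def U_def)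
  qed
  have contV: "continuous_on (V e - {q}) k" for e
    by (rule continuous_on_subset[OF cont]) (auto simp: V_def)
  have one_side: "k ` (V e - {q}) \<subseteq> inside C \<or> k ` (V e - {q}) \<subseteq> outside C" for e
  proof -
    have "connected (V e - {q})"
      using V by (intro connected_open_delete) auto
    then have "connected (k ` (V e - {q}))" using contV by (intro connected_continuous_image)
    moreover have "k ` (V e - {q}) \<subseteq> inside C \<union> outside C" using kC JI by auto
    ultimately show ?thesis
      using JI by (intro connected_subset_disjoint_open) auto
  qed
  \<comment> \<open>Near its pole \<open>k\<close> is unbounded, whereas \<open>inside C\<close> is
    bounded.\<close>
  have out: "k ` (V (-1) - {q}) \<subseteq> outside C"
  proof (rule ccontr)
    assume "\<not> ?thesis"
    then have "k ` (V (-1) - {q}) \<subseteq> inside C" using one_side by blast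
    then have "bounded (k ` (V (-1) - {q}))" using JI bounded_subset by blast
    then obtain B where B: "\<And>w. w \<in> V (-1) - {q} \<Longrightarrow> cmod (k w) \<le> B"
      unfolding bounded_iff by blast
    have "eventually (\<lambda>w. B < cmod (k w)) (at q)"
      using filterlim_at_infinity_imp_norm_at_top[OF pole] unfolding filterlim_at_top_dense by blast
    moreover have "eventually (\<lambda>w. w \<in> V (-1) - {q}) (at q)"
      using qV V by (auto simp: eventually_at_filter intro: eventually_mono[OF eventually_nhds_in_open])
    ultimately have "eventually (\<lambda>w. False) (at q)"
      by eventually_elim (use B in force)
    then show False by simp
  qed
  \<comment> \<open>If both halves were mapped outside, the image of the punctured disc would miss
    \<open>inside C\<close>. But that image is open and contains the point
    \<open>k (c (1/2))\<close> of the frontier of \<open>inside C\<close>.\<close>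
  have ins: "k ` (V 1 - {q}) \<subseteq> inside C"
  proof (rule ccontr)
    assume "\<not> ?thesis"
    then have o1: "k ` (V 1 - {q}) \<subseteq> outside C" using one_side by blast
    define W where "W = k ` (ball 0 1 - {q})"
    have "open W"
      unfolding W_def
      by (rule invariance_of_domain[OF continuous_on_subset[OF cont] _ inj]) auto
    moreover have "k (c (1/2)) \<in> W" using copen[of "1/2"] by (auto simp: W_def)
    moreover have "k (c (1/2)) \<in> closure (inside C)"
    proof -
      have "k (c (1/2)) \<in> C" by (auto simp: C_def path_image_def \<gamma>_def intro!: image_eqI[of _ _ "1/2"])
      then show ?thesis using JI by (auto simp: frontier_def)
    qed
    ultimately obtain y where y: "y \<in> W" "y \<in> inside C"
      by (meson closure_iff_nhds_not_empty disjoint_iff subset_refl)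
    then obtain w where w: "w \<in> ball 0 1 - {q}" "y = k w" unfolding W_def by blast
    have "y \<notin> C" if "0 < s" "s < 1" "w = c s" for s
      using y JI by blast
    moreover have "y \<in> C" if "0 < s" "s < 1" "w = c s" for s
      using that w by (auto simp: C_def path_image_def \<gamma>_def)
    ultimately have "w \<in> V 1 \<or> w \<in> V (-1) - {q}" using split[OF w(1)] by blast
    then show False
    proof
      assume "w \<in> V 1"
      then have "y \<in> outside C" using o1 w by blast
      then show False using y JI by blast
    next
      assume "w \<in> V (-1) - {q}"
      then have "y \<in> outside C" using out w by blast
      then show False using y JI by blast
    qed
  qed
  have "J - {p} \<subseteq> inside C \<or> J - {p} \<subseteq> outside C"
  proof -
    have "J - {p} \<subseteq> inside C \<union> outside C" using CJ JI by blast
    then show ?thesis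
      using JI conn[OF pJ] by (intro connected_subset_disjoint_open) auto
  qed
  \<comment> \<open>\<open>e\<close> selects the half-disc whose image lies on the side of
    \<open>C\<close> opposite to \<open>J - {p}\<close>. On the arc bounding that half
    \<open>k\<close> can then only take the value \<open>p\<close>.\<close>
  then obtain e A where e: "e \<in> {-1, 1}" and A: "open A" "J - {p} \<subseteq> A" "\<And>w. w \<in> V e - {q} \<Longrightarrow> k w \<notin> A"
  proof
    assume *: "J - {p} \<subseteq> inside C"
    have "k w \<notin> inside C" if "w \<in> V (-1) - {q}" for w using that out JI by blast
    then show ?thesis by (intro that[of "-1" "inside C"]) (use * JI in simp_all)
  next
    assume *: "J - {p} \<subseteq> outside C"
    have "k w \<notin> outside C" if "w \<in> V 1 - {q}" for w using that ins JI by blast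
    then show ?thesis by (intro that[of 1 "outside C"]) (use * JI in simp_all)
  qed
  have "U e \<inter> sphere 0 1 \<noteq> {}"
  proof -
    define d where "d = cmod (b - a)"
    have d: "0 < d" using b by (simp add: d_def)
    \<comment> \<open>\<open>u\<close> is the unit normal of the chord that points to the chosen
      side. It lies beyond the chord because |\<kappa>| / d, the distance of the line from 0, is
      less than 1.\<close>
    define \<tau> where "\<tau> = - e * sgn (\<sigma> q)"
    define u where "u = of_real (\<tau> / d) * (\<i> * (b - a))"
    have \<tau>: "\<bar>\<tau>\<bar> = 1" using e sq by (auto simp: \<tau>_def sgn_if)
    have "cmod u = \<bar>\<tau> / d\<bar> * d"
      unfolding u_def norm_mult norm_of_real d_def by simp
    then have "cmod u = 1" using d \<tau> by (simp add: abs_divide)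
    define \<kappa> where "\<kappa> = Im (a * cnj (b - a))"
    have "\<i> * (b - a) * cnj (b - a) = \<i> * of_real (d\<^sup>2)"
      by (metis complex_norm_square d_def mult.assoc of_real_power)
    then have "u * cnj (b - a) = of_real (\<tau> / d) * (\<i> * of_real (d\<^sup>2))"
      by (simp add: u_def mult_ac)
    then have su: "\<sigma> u = \<tau> * d - \<kappa>"
      using d by (simp add: \<sigma>_def \<kappa>_def left_diff_distrib power2_eq_square)
    have "\<kappa>\<^sup>2 < d\<^sup>2"
    proof -
      define R where "R = Re a * Re b + Im a * Im b"
      have a1: "(Re a)\<^sup>2 + (Im a)\<^sup>2 = 1" and b1: "(Re b)\<^sup>2 + (Im b)\<^sup>2 = 1"
        using na by (simp_all add: cmod_power2[symmetric])
      have d2: "d\<^sup>2 = 2 - 2 * R"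
        using a1 b1 unfolding d_def cmod_power2 R_def by (simp add: power2_eq_square algebra_simps)
      have "\<kappa>\<^sup>2 + R\<^sup>2 = ((Re a)\<^sup>2 + (Im a)\<^sup>2) * ((Re b)\<^sup>2 + (Im b)\<^sup>2)"
        by (simp add: \<kappa>_def R_def power2_eq_square algebra_simps)
      then have k2: "\<kappa>\<^sup>2 = 1 - R\<^sup>2" using a1 b1 by simp
      have "R \<noteq> 1" using d d2 by auto
      then have "0 < (1 - R)\<^sup>2" by simp
      then show ?thesis unfolding d2 k2 by (simp add: power2_eq_square algebra_simps)
    qed
    then have "\<bar>\<kappa>\<bar> < d" using d by (metis abs_of_pos abs_le_square_iff not_le)
    then have "0 < \<tau> * \<sigma> u"
      unfolding su using \<tau> by (cases "\<tau> = 1") (auto simp: abs_if split: if_splits)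
    then have "u \<in> U e"
      by (simp add: U_def \<rho>_def \<tau>_def mult_ac)
    then show ?thesis using \<open>cmod u = 1\<close> by auto
  qed
  then obtain x where x: "x \<in> U e \<inter> sphere 0 1" "k x \<noteq> p"
    using nonconst[OF openU] by blast
  then have "k x \<in> A" using J(2) A(2) by blast
  \<comment> \<open>Continuity on the closed disc carries membership in \<open>A\<close> from a
    point of the arc to points of the half-disc \<open>V e\<close>.\<close>
  obtain W where W: "open W" "W \<inter> (cball 0 1 - {q}) = k -` A \<inter> (cball 0 1 - {q})"
    using cont A(1) unfolding continuous_on_open_invariant by metis
  have xq: "x \<noteq> q" using x q by auto
  have "x \<in> k -` A \<inter> (cball 0 1 - {q})" using x xq \<open>k x \<in> A\<close> by simp
  then have "x \<in> W" using W(2) by blast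
  then have "x \<in> W \<inter> (U e - {q})" using x xq by blast
  moreover have "open (W \<inter> (U e - {q}))" by (intro open_Int open_delete W openU)
  moreover have "x \<in> closure (ball 0 1)" using x by auto
  ultimately have "ball 0 1 \<inter> (W \<inter> (U e - {q})) \<noteq> {}"
    unfolding closure_iff_nhds_not_empty by blast
  then obtain w where w: "w \<in> W" "w \<in> U e" "w \<noteq> q" "w \<in> ball 0 1" by blast
  then have "w \<in> W \<inter> (cball 0 1 - {q})" by simp
  then have "k w \<in> A" using W(2) by blast
  then show False using A(3)[of w] w by (auto simp: V_def)
qed

section \<open>The Cayley map from the disc to the half-plane\<close>

definition cayley :: "complex \<Rightarrow> complex" where
  "cayley w = (1 + w) / (1 - w)"

definition cayley_inv :: "complex \<Rightarrow> complex" where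
  "cayley_inv z = (z - 1) / (z + 1)"

lemma Re_cayley: "w \<noteq> 1 \<Longrightarrow> Re (cayley w) = (1 - (cmod w)\<^sup>2) / (cmod (1 - w))\<^sup>2"
  unfolding cayley_def Re_divide cmod_power2 by (simp add: power2_eq_square algebra_simps)

lemma cayley_cayley_inv: "z \<noteq> -1 \<Longrightarrow> cayley (cayley_inv z) = z"
proof -
  assume "z \<noteq> -1"
  then have "z + 1 \<noteq> 0" by (simp add: eq_neg_iff_add_eq_0)
  then show ?thesis unfolding cayley_def cayley_inv_def by (simp add: divide_simps)
qed

lemma cayley_inv_cayley: "w \<noteq> 1 \<Longrightarrow> cayley_inv (cayley w) = w"
  unfolding cayley_def cayley_inv_def by (simp add: divide_simps)

lemma cayley_inv_ne_1: "cayley_inv z \<noteq> 1"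
  unfolding cayley_inv_def by (simp add: divide_simps)

lemma cayley_pos: "w \<in> ball 0 1 \<Longrightarrow> 0 < Re (cayley w)"
proof -
  assume w: "w \<in> ball 0 1"
  then have "w \<noteq> 1" by auto
  moreover have "(cmod w)\<^sup>2 < 1" using w by (simp add: abs_square_less_1)
  ultimately show ?thesis by (simp add: Re_cayley)
qed

lemma cayley_imag: "w \<in> sphere 0 1 \<Longrightarrow> w \<noteq> 1 \<Longrightarrow> Re (cayley w) = 0"
  by (simp add: Re_cayley)

lemma cayley_inv_ball: "0 < Re z \<Longrightarrow> cayley_inv z \<in> ball 0 1"
proof -
  assume z: "0 < Re z"
  then have m1: "z \<noteq> -1" by auto
  show ?thesis
  proof (rule ccontr)
    assume "\<not> ?thesis"
    then have "1 \<le> (cmod (cayley_inv z))\<^sup>2" by (simp add: abs_square_less_1[symmetric] not_less)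
    then have "Re (cayley (cayley_inv z)) \<le> 0"
      unfolding Re_cayley[OF cayley_inv_ne_1] by (intro divide_nonpos_nonneg) auto
    then show False using z cayley_cayley_inv[OF m1] by simp
  qed
qed

lemma cayley_inv_sphere: "Re z = 0 \<Longrightarrow> cayley_inv z \<in> sphere 0 1"
proof -
  assume z: "Re z = 0"
  then have m1: "z \<noteq> -1" by auto
  have "(1 - (cmod (cayley_inv z))\<^sup>2) / (cmod (1 - cayley_inv z))\<^sup>2 = 0"
    using z cayley_cayley_inv[OF m1] Re_cayley[OF cayley_inv_ne_1[of z]] by simp
  then have "(cmod (cayley_inv z))\<^sup>2 = 1"
    using cayley_inv_ne_1[of z] by auto
  then show ?thesis by (simp add: power2_eq_1_iff) (use norm_ge_zero[of "cayley_inv z"] in linarith)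
qed

lemma continuous_cayley_inv: "continuous_on (- {-1}) cayley_inv"
proof -
  have "z + 1 \<noteq> 0" if "z \<in> - {-1}" for z :: complex
    using that by (simp add: eq_neg_iff_add_eq_0)
  then show ?thesis unfolding cayley_inv_def by (intro continuous_intros) auto
qed

text \<open>The point 1 stands for infinity. Division by zero gives it the value 0, which is also
  the value at -1, so 1 has to be removed.\<close>

lemma inj_cayley: "inj_on cayley (- {1})"
  by (rule inj_on_inverseI[of _ cayley_inv]) (simp add: cayley_inv_cayley)

lemma continuous_on_extension_by_limits:
  fixes f :: "'a::metric_space \<Rightarrow> 'b::metric_space"
  assumes S: "open S" "continuous_on S f" and B: "B \<inter> S = {}" "B \<subseteq> closure S"
    and lim: "\<And>x. x \<in> B \<Longrightarrow> (f \<longlongrightarrow> L x) (at x within S)"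
  shows "continuous_on (S \<union> B) (\<lambda>x. if x \<in> S then f x else L x)"
proof -
  define g where "g = (\<lambda>x. if x \<in> S then f x else L x)"
  have "(g \<longlongrightarrow> g x) (at x within S \<union> B)" if x: "x \<in> S \<union> B" for x
  proof (cases "x \<in> S")
    case True
    have "(f \<longlongrightarrow> f x) (at x)"
      using S True by (simp add: continuous_on_eq_continuous_at isCont_def)
    moreover have "eventually (\<lambda>y. f y = g y) (at x)"
      using eventually_nhds_in_open[OF S(1) True]
      by (auto simp: g_def eventually_at_filter elim: eventually_mono)
    ultimately have "(g \<longlongrightarrow> f x) (at x)" by (rule Lim_transform_eventually)
    then show ?thesis using True by (simp add: g_def tendsto_within_subset[OF _ subset_UNIV])
  next
    case False
    then have xB: "x \<in> B" using x by auto
    show ?thesis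
      unfolding tendsto_iff
    proof (intro allI impI)
      fix e :: real assume e: "0 < e"
      have "eventually (\<lambda>y. dist (f y) (L x) < e/2) (at x within S)"
        using lim[OF xB] half_gt_zero[OF e] unfolding tendsto_iff by blast
      then obtain d where d: "0 < d" "\<And>y. y \<in> S \<Longrightarrow> y \<noteq> x \<Longrightarrow> dist y x < d \<Longrightarrow> dist (f y) (L x) < e/2"
        by (auto simp: eventually_at)
      have "dist (g y) (g x) < e" if y: "y \<in> S \<union> B" "y \<noteq> x" "dist y x < d" for y
      proof (cases "y \<in> S")
        case True
        then show ?thesis using d(2)[of y] y e False by (simp add: g_def)
      next
        case notS: False
        then have yB: "y \<in> B" using y by auto
        \<comment> \<open>When \<open>y\<close> is a boundary point too, \<open>L y\<close> is
          itself a limit of values of \<open>f\<close> at points close to \<open>x\<close>, so the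
          estimate passes to the limit in non-strict form.\<close>
        have "eventually (\<lambda>z. z \<in> S \<inter> ball x d) (at y within S)"
          using y(3) by (auto simp: eventually_at_filter dist_commute intro: eventually_mono[OF eventually_nhds_in_open[of "ball x d" y]])
        then have "eventually (\<lambda>z. dist (f z) (L x) \<le> e/2) (at y within S)"
        proof eventually_elim
          case (elim z)
          then have "z \<in> S" "z \<noteq> x" "dist z x < d" using False by (auto simp: dist_commute)
          then show ?case using d(2) by (simp add: less_imp_le)
        qed
        moreover have "at y within S \<noteq> bot"
          using yB B notS by (metis closure_def at_within_eq_bot_iff subset_iff UnE mem_Collect_eq
              trivial_limit_within)
        ultimately have "dist (L y) (L x) \<le> e/2"
          using lim[OF yB] by (intro tendsto_upperbound[OF tendsto_dist[OF _ tendsto_const]])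
        then show ?thesis using e notS False by (simp add: g_def)
      qed
      then show "eventually (\<lambda>y. dist (g y) (g x) < e) (at x within S \<union> B)"
        unfolding eventually_at using d(1) by blast
    qed
  qed
  then show ?thesis by (simp add: continuous_on_def g_def)
qed

text \<open>The circle is run through once as a closed simple path that starts and ends at the
  removed point.\<close>

lemma connected_circle_minus_point:
  fixes x :: complex
  assumes "x \<in> sphere 0 1"
  shows "connected (sphere 0 1 - {x})"
proof -
  obtain t where t: "x = exp (\<i> * of_real t)"
    using assms complex_unimodular_polar[of x] by (auto simp: cis_conv_exp[symmetric] cis.ctr complex_eq_iff)
  define c where "c = part_circlepath 0 1 t (t + 2 * pi)"
  have "simple_path c"
    unfolding c_def by (simp add: simple_path_part_circlepath)
  then have "connected (path_image c - {pathstart c, pathfinish c})"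
    by (rule connected_simple_path_endless)
  moreover have "path_image c = sphere 0 1"
  proof -
    have "sphere 0 1 \<subseteq> path_image c"
    proof
      fix z :: complex assume "z \<in> sphere 0 1"
      then have "cmod (z / x) = 1" using assms by (simp add: norm_divide)
      then obtain s where s: "0 \<le> s" "s < 2 * pi" "z / x = exp (\<i> * of_real s)"
        using complex_unimodular_polar[of "z / x"] by (metis cis_conv_exp cis.ctr)
      have x0: "x \<noteq> 0" using assms by auto
      have "z = x * exp (\<i> * of_real s)" using s(3) x0 by (simp add: field_simps)
      then have "z = exp (\<i> * of_real (t + s))" by (simp add: t exp_add[symmetric] algebra_simps)
      then show "z \<in> path_image c"
        unfolding c_def path_image_part_circlepath[of t "t + 2 * pi" 0 1, simplified]
        using s by (auto intro!: exI[of _ "t + s"])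
    qed
    moreover have "path_image c \<subseteq> sphere 0 1"
      unfolding c_def by (rule path_image_part_circlepath_subset) auto
    ultimately show ?thesis by blast
  qed
  moreover have "pathstart c = x" "pathfinish c = x"
    using t by (simp_all add: c_def exp_add algebra_simps mult.assoc exp_two_pi_i' exp_two_pi_i)
  ultimately show ?thesis by simp
qed

section \<open>Jordan curves of the Riemann sphere in an affine chart\<close>

text \<open>The chart w -> 1 / (w - a), which takes the sphere without \<open>Some a\<close> to the
  plane. At \<open>Some a\<close> the HOL value is 0 instead of infinity, so this point is always
  removed.\<close>

definition sphere_inversion :: "complex \<Rightarrow> complex option \<Rightarrow> complex" where
  "sphere_inversion a x = (case x of None \<Rightarrow> 0 | Some v \<Rightarrow> 1 / (v - a))"

lemma topspace_riemann_sphere [simp]: "topspace riemann_sphere = UNIV"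
proof -
  have "x \<in> insert None (range Some)" for x :: "complex option" by (cases x) auto
  then show ?thesis by (auto simp: riemann_sphere_def)
qed

lemma openin_riemann_sphere_Some: "open U \<Longrightarrow> openin riemann_sphere (Some ` U)"
  by (simp add: riemann_sphere_def)

lemma openin_riemann_sphere_None: "compact K \<Longrightarrow> openin riemann_sphere (insert None (Some ` (- K)))"
  unfolding riemann_sphere_def openin_Alexandroff_compactification
  by (rule disjI2, rule exI[of _ K]) (auto simp: compact_imp_closed Compl_eq_Diff_UNIV)

lemma continuous_sphere_inversion:
  "continuous_map (subtopology riemann_sphere (- {Some a})) euclidean (sphere_inversion a)"
  unfolding continuous_map_def
proof (intro conjI allI impI)
  fix U :: "complex set" assume "openin euclidean U"
  then have U: "open U" by simp
  define O' where "O' = {v. v \<noteq> a \<and> 1 / (v - a) \<in> U}"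
  have "open O'"
  proof -
    have "continuous_on (- {a}) (\<lambda>v. 1 / (v - a))" by (intro continuous_intros) auto
    then have "open ((- {a}) \<inter> (\<lambda>v. 1 / (v - a)) -` U)"
      by (rule continuous_open_preimage) (use U in auto)
    moreover have "(- {a}) \<inter> (\<lambda>v. 1 / (v - a)) -` U = O'" by (auto simp: O'_def)
    ultimately show ?thesis by simp
  qed
  have "\<exists>W. openin riemann_sphere W \<and>
     {x \<in> topspace (subtopology riemann_sphere (- {Some a})). sphere_inversion a x \<in> U} = W \<inter> (- {Some a})"
  proof (cases "0 \<in> U")
    case False
    have "{x \<in> topspace (subtopology riemann_sphere (- {Some a})). sphere_inversion a x \<in> U} = Some ` O' \<inter> (- {Some a})"
      using False by (auto simp: O'_def sphere_inversion_def split: option.splits)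
    then show ?thesis using openin_riemann_sphere_Some[OF \<open>open O'\<close>] by blast
  next
    case True
    then obtain e where e: "0 < e" "ball 0 e \<subseteq> U" using U open_contains_ball by blast
    \<comment> \<open>A neighbourhood of 0 must pull back to a neighbourhood of infinity: the
      complement of \<open>O'\<close> is bounded, hence compact.\<close>
    have "- O' \<subseteq> cball a (1/e)"
    proof
      fix v assume "v \<in> - O'"
      consider "v = a" | "v \<noteq> a" "e \<le> cmod (1 / (v - a))"
      proof -
        assume *: "v = a \<Longrightarrow> thesis" "v \<noteq> a \<Longrightarrow> e \<le> cmod (1 / (v - a)) \<Longrightarrow> thesis"
        show thesis
        proof (cases "v = a")
          case False
          with \<open>v \<in> - O'\<close> have "1 / (v - a) \<notin> ball 0 e" using e(2) by (auto simp: O'_def)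
          then show thesis using *(2)[OF False] by (simp add: not_less)
        qed (rule *(1))
      qed
      then show "v \<in> cball a (1/e)"
      proof cases
        case 2
        then have "e * cmod (v - a) \<le> 1" by (simp add: norm_divide pos_le_divide_eq)
        then show ?thesis using e(1) by (simp add: dist_norm norm_minus_commute field_simps)
      qed (use e in auto)
    qed
    then have "compact (- O')"
      using \<open>open O'\<close> by (meson bounded_cball bounded_subset closed_Compl compact_eq_bounded_closed)
    then have "openin riemann_sphere (insert None (Some ` O'))"
      using openin_riemann_sphere_None[of "- O'"] by simp
    moreover have "{x \<in> topspace (subtopology riemann_sphere (- {Some a})). sphere_inversion a x \<in> U}
        = insert None (Some ` O') \<inter> (- {Some a})"
      using True by (auto simp: O'_def sphere_inversion_def split: option.splits)
    ultimately show ?thesis by blast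
  qed
  then show "openin (subtopology riemann_sphere (- {Some a}))
      {x \<in> topspace (subtopology riemann_sphere (- {Some a})). sphere_inversion a x \<in> U}"
    by (simp add: openin_subtopology)
qed auto

lemma frontier_of_riemann_sphere_None:
  assumes "\<not> bounded D"
  shows "None \<in> riemann_sphere frontier_of (Some ` D)"
proof -
  have "None \<in> riemann_sphere closure_of (Some ` D)"
    unfolding in_closure_of
  proof (intro conjI allI impI)
    fix T assume T: "None \<in> T \<and> openin riemann_sphere T"
    then obtain K where K: "compact K" "T = insert None (Some ` (UNIV - K))"
      unfolding riemann_sphere_def openin_Alexandroff_compactification by auto
    then have "\<not> D \<subseteq> K" using assms bounded_subset compact_imp_bounded by blast
    then show "\<exists>y. y \<in> Some ` D \<and> y \<in> T" using K by auto
  qed simp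
  moreover have "None \<notin> riemann_sphere interior_of (Some ` D)"
    using interior_of_subset[of riemann_sphere "Some ` D"] by auto
  ultimately show ?thesis by (simp add: frontier_of_def)
qed

lemma frontier_of_riemann_sphere_Some:
  assumes D: "open D"
  shows "Some v \<in> riemann_sphere frontier_of (Some ` D) \<longleftrightarrow> v \<in> frontier D"
proof -
  have int: "riemann_sphere interior_of (Some ` D) = Some ` D"
    using openin_riemann_sphere_Some[OF D] by (simp add: interior_of_openin)
  have "Some v \<in> riemann_sphere closure_of (Some ` D) \<longleftrightarrow> v \<in> closure D"
  proof
    assume cl: "Some v \<in> riemann_sphere closure_of (Some ` D)"
    show "v \<in> closure D"
      unfolding closure_iff_nhds_not_empty
    proof (intro allI impI)
      fix A V assume V: "V \<subseteq> A" "v \<in> V" "open V"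
      then have "\<exists>y. y \<in> Some ` D \<and> y \<in> Some ` V"
        using cl openin_riemann_sphere_Some[OF V(3)] by (meson imageI in_closure_of)
      then show "D \<inter> A \<noteq> {}" using V(1) by auto
    qed
  next
    assume cl: "v \<in> closure D"
    show "Some v \<in> riemann_sphere closure_of (Some ` D)"
      unfolding in_closure_of
    proof (intro conjI allI impI)
      fix T assume T: "Some v \<in> T \<and> openin riemann_sphere T"
      have "open (Some -` T)"
        using T openin_continuous_map_preimage[OF continuous_map_Some[of euclidean], of T]
        by (simp add: riemann_sphere_def vimage_def)
      then have "D \<inter> (Some -` T) \<noteq> {}"
        using cl T by (auto simp: closure_iff_nhds_not_empty)
      then show "\<exists>y. y \<in> Some ` D \<and> y \<in> T" by blast
    qed simp
  qed
  then show ?thesis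
    using D by (auto simp: frontier_of_def frontier_def int interior_open)
qed

text \<open>Supplies the connectedness hypothesis of \<open>boundary_values_distinct\<close>: the
  property of the circle is carried to the sphere by a homeomorphism and to the plane by the
  chart.\<close>

lemma connected_inversion_jordan_curve:
  assumes J: "jordan_curve J" and a: "Some a \<notin> J" and p: "p \<in> sphere_inversion a ` J"
  shows "connected (sphere_inversion a ` J - {p})"
proof -
  obtain q where q: "q \<in> J" "p = sphere_inversion a q" using p by blast
  obtain f where f: "homeomorphic_map (subtopology riemann_sphere J) (top_of_set (sphere (0::complex) 1)) f"
    using J unfolding jordan_curve_def homeomorphic_space by blast
  have bij: "bij_betw f J (sphere 0 1)"
    using homeomorphic_imp_surjective_map[OF f] homeomorphic_imp_injective_map[OF f]
    by (simp add: bij_betw_def)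
  then have "f ` (J - {q}) = sphere 0 1 - {f q}"
    using q by (auto simp: bij_betw_def inj_on_def)
  moreover have "f q \<in> sphere 0 1" using bij q by (auto simp: bij_betw_def)
  ultimately have "connectedin (top_of_set (sphere 0 1)) (f ` (J - {q}))"
    using connected_circle_minus_point by (simp add: connectedin_subtopology)
  then have "connectedin (subtopology riemann_sphere J) (J - {q})"
    using homeomorphic_map_connectedness[OF f, of "J - {q}"] by auto
  then have "connectedin riemann_sphere (J - {q})"
    by (simp add: connectedin_subtopology)
  then have "connectedin (subtopology riemann_sphere (- {Some a})) (J - {q})"
    using a by (auto simp: connectedin_subtopology)
  then have "connectedin euclidean (sphere_inversion a ` (J - {q}))"
    by (rule connectedin_continuous_map_image[OF continuous_sphere_inversion])
  moreover have "inj_on (sphere_inversion a) J"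
    using a by (auto simp: inj_on_def sphere_inversion_def split: option.splits)
  then have "sphere_inversion a ` (J - {q}) = sphere_inversion a ` J - {p}"
    using q by (auto simp: inj_on_def)
  ultimately show ?thesis by simp
qed


section \<open>Boundary values of a map onto a Jordan domain\<close>

locale jordan_half_plane_map =
  fixes h :: "complex \<Rightarrow> complex" and X :: real
  assumes holo: "h holomorphic_on {z. 0 < Re z}" and inj: "inj_on h {z. 0 < Re z}"
    and at_inf: "filterlim h at_infinity (inf at_infinity (principal {z. 0 < Re z}))"
    and jordan: "jordan_domain (Some ` h ` {z. 0 < Re z})"
    and X: "0 < X" and small: "\<And>z. z \<in> strip X \<Longrightarrow> (Re z)\<^sup>2 * cmod (schwarzian h z) \<le> 1/1000"
begin

abbreviation "H \<equiv> {z. 0 < Re z}"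

lemma open_H: "open H"
  by (rule open_halfspace_Re_gt)

lemma open_image: "open (h ` A)" if "open A" "A \<subseteq> H"
  using that holo inj by (intro open_mapping_thm3) (auto intro: holomorphic_on_subset inj_on_subset)

lemma unbounded_image: "\<not> bounded (h ` H)"
proof
  assume "bounded (h ` H)"
  then obtain B where B: "\<And>z. z \<in> H \<Longrightarrow> cmod (h z) \<le> B"
    unfolding bounded_iff by blast
  have "eventually (\<lambda>z. B < cmod (h z)) (inf at_infinity (principal H))"
    using filterlim_at_infinity_imp_norm_at_top[OF at_inf] unfolding filterlim_at_top_dense by blast
  then obtain b where b: "\<And>z. b \<le> cmod z \<Longrightarrow> z \<in> H \<Longrightarrow> B < cmod (h z)"
    unfolding eventually_inf_principal eventually_at_infinity by auto
  have "complex_of_real (max b 1) \<in> H" by simp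
  moreover have "b \<le> cmod (complex_of_real (max b 1))" by simp
  ultimately show False using b B by fastforce
qed

lemma boundary_value_not_in_image:
  assumes y: "Re b = 0" and lim: "(h \<longlongrightarrow> v) (at b within H)"
  shows "v \<notin> h ` H" and "v \<in> closure (h ` H)"
proof -
  have nontriv: "at b within H \<noteq> bot"
  proof -
    show ?thesis
      unfolding not_trivial_limit_within_ball
    proof (intro allI impI)
      fix e :: real assume "0 < e"
      then have "b + of_real (e/2) \<in> H \<inter> ball b e - {b}" using y by (auto simp: dist_norm)
      then show "H \<inter> ball b e - {b} \<noteq> {}" by blast
    qed
  qed
  show "v \<notin> h ` H"
  proof
    assume "v \<in> h ` H"
    then obtain z where z: "z \<in> H" "v = h z" by blast
    \<comment> \<open>By openness and injectivity values near \<open>h z\<close> are taken only in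
      the ball about \<open>z\<close>, where the real part exceeds \<open>r\<close>. Points tending
      to \<open>b\<close> have real part below \<open>r\<close>.\<close>
    define r where "r = Re z / 2"
    have r: "0 < r" using z by (simp add: r_def)
    have Re: "r < Re w" if "w \<in> ball z r" for w
      using abs_Re_le_cmod[of "z - w"] that by (auto simp: r_def dist_norm)
    then have sub: "ball z r \<subseteq> H" using r by force
    have "eventually (\<lambda>w. h w \<in> h ` ball z r) (at b within H)"
      by (rule topological_tendstoD[OF lim open_image]) (use sub r z in auto)
    moreover have "eventually (\<lambda>w. w \<in> H) (at b within H)"
      by (simp add: eventually_at_filter)
    moreover have "eventually (\<lambda>w. Re w < r) (at b within H)"
      by (rule order_tendstoD(2)[OF tendsto_Re[OF tendsto_ident_at]]) (use y r in simp)
    ultimately have "eventually (\<lambda>w. False) (at b within H)"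
    proof eventually_elim
      case (elim w)
      then obtain u where u: "u \<in> ball z r" "h w = h u" by blast
      then have "w = u" using inj_onD[OF inj u(2)] elim sub by auto
      then show False using Re[OF u(1)] elim by simp
    qed
    then show False using nontriv by simp
  qed
  show "v \<in> closure (h ` H)"
    by (rule Lim_in_closed_set[OF closed_closure _ nontriv lim])
      (auto simp: eventually_at_filter intro!: always_eventually closure_subset[THEN subsetD])
qed

end

lemma cayley_at_infinity: "filterlim cayley at_infinity (at 1)"
proof -
  have "filterlim (\<lambda>w::complex. 1 - w) (at 0) (at 1)"
    unfolding filterlim_at by (auto intro!: tendsto_eq_intros simp: eventually_at_filter)
  moreover have "((\<lambda>w::complex. 1 + w) \<longlongrightarrow> 2) (at 1)"
    by (auto intro!: tendsto_eq_intros)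
  ultimately show ?thesis
    unfolding cayley_def by (intro filterlim_divide_at_infinity) auto
qed

lemma isCont_cayley: "w \<noteq> 1 \<Longrightarrow> isCont cayley w"
  unfolding cayley_def by (intro continuous_intros) auto

lemma cayley_filterlim:
  assumes "w \<in> sphere 0 1" "w \<noteq> 1"
  shows "filterlim cayley (at (cayley w) within {z. 0 < Re z}) (at w within ball 0 1)"
  unfolding filterlim_at
proof
  show "eventually (\<lambda>x. cayley x \<in> {z. 0 < Re z} \<and> cayley x \<noteq> cayley w) (at w within ball 0 1)"
  proof -
    have "0 < Re (cayley x) \<and> cayley x \<noteq> cayley w" if "x \<in> ball 0 1" for x
      using cayley_pos[OF that] cayley_imag[OF assms] by (metis less_irrefl)
    then show ?thesis
      unfolding eventually_at_filter by (intro always_eventually) auto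
  qed
  have "(cayley \<longlongrightarrow> cayley w) (at w)"
    using isCont_cayley[OF assms(2)] by (simp add: isCont_def)
  then show "(cayley \<longlongrightarrow> cayley w) (at w within ball 0 1)"
    by (rule tendsto_within_subset) simp
qed

lemma at_within_ball_nontrivial: "w \<in> sphere 0 1 \<Longrightarrow> at w within ball (0::complex) 1 \<noteq> bot"
proof -
  assume w: "w \<in> sphere (0::complex) 1"
  then have "ball 0 1 - {w} = ball 0 1" "w \<in> closure (ball 0 1)" by auto
  then show ?thesis using not_trivial_limit_within[of w "ball 0 1"] by metis
qed

context jordan_half_plane_map
begin

text \<open>To compare the boundary values at two points of the circle, the pole \<^term>\<open>q\<close> is chosen off the
  chord joining them, so that the image of the chord is bounded.\<close>

definition disc_inv :: "complex \<Rightarrow> complex \<Rightarrow> complex" where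
  "disc_inv q w = 1 / (h (cayley w) - h (cayley q))"

lemma cayley_in_H: "w \<in> ball 0 1 \<Longrightarrow> cayley w \<in> H"
  using cayley_pos by blast

lemma h_cayley_ne: "w \<in> ball 0 1 - {q} \<Longrightarrow> q \<in> ball 0 1 \<Longrightarrow> h (cayley w) \<noteq> h (cayley q)"
proof
  assume w: "w \<in> ball 0 1 - {q}" and q: "q \<in> ball 0 1" and "h (cayley w) = h (cayley q)"
  then have "cayley w = cayley q"
    using inj_onD[OF inj _ cayley_in_H cayley_in_H] by blast
  moreover have "w \<in> - {1}" "q \<in> - {1}" using w q by auto
  ultimately show False using inj_onD[OF inj_cayley, of w q] w by blast
qed

lemma disc_inv_limit:
  assumes q: "q \<in> ball 0 1" and w: "w \<in> sphere 0 1"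
  shows "\<exists>L. (disc_inv q \<longlongrightarrow> L) (at w within ball 0 1)"
proof (cases "w = 1")
  case True
  have "filterlim cayley (inf at_infinity (principal H)) (at 1 within ball 0 1)"
    unfolding filterlim_inf filterlim_principal
    using cayley_pos filterlim_mono[OF cayley_at_infinity order_refl, of "at 1 within ball 0 1"]
    by (auto simp: at_le eventually_at_filter)
  then have "filterlim (\<lambda>w. h (cayley w)) at_infinity (at 1 within ball 0 1)"
    by (rule filterlim_compose[OF at_inf])
  then have "filterlim (\<lambda>w. h (cayley w) - h (cayley q)) at_infinity (at 1 within ball 0 1)"
    using tendsto_add_filterlim_at_infinity'[OF _ tendsto_const[of "- h (cayley q)"]] by simp
  then have "((\<lambda>w. inverse (h (cayley w) - h (cayley q))) \<longlongrightarrow> 0) (at 1 within ball 0 1)"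
    by (rule filterlim_compose[OF tendsto_inverse_0])
  then show ?thesis using True by (auto simp: disc_inv_def[abs_def] inverse_eq_divide)
next
  case False
  have "cayley w = Complex 0 (Im (cayley w))" using cayley_imag[OF w False] by (simp add: complex_eq_iff)
  moreover obtain L where "((\<lambda>z. 1 / (h z - h (cayley q))) \<longlongrightarrow> L) (at (Complex 0 (Im (cayley w))) within H)"
    using inversion_boundary_limit[OF holo inj X small cayley_pos[OF q]] by blast
  ultimately have "((\<lambda>z. 1 / (h z - h (cayley q))) \<longlongrightarrow> L) (at (cayley w) within H)" by simp
  from filterlim_compose[OF this cayley_filterlim[OF w False]] show ?thesis
    by (auto simp: disc_inv_def[abs_def])
qed

definition disc_bd :: "complex \<Rightarrow> complex \<Rightarrow> complex" where
  "disc_bd q w = Lim (at w within ball 0 1) (disc_inv q)"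

lemma disc_bd_limit:
  assumes q: "q \<in> ball 0 1" and w: "w \<in> sphere 0 1"
  shows "(disc_inv q \<longlongrightarrow> disc_bd q w) (at w within ball 0 1)"
  using disc_inv_limit[OF assms] tendsto_Lim[OF at_within_ball_nontrivial[OF w]]
  unfolding disc_bd_def by metis

lemma disc_bd_1:
  assumes q: "q \<in> ball 0 1"
  shows "disc_bd q 1 = 0"
proof -
  have "filterlim cayley (inf at_infinity (principal H)) (at 1 within ball 0 1)"
    unfolding filterlim_inf filterlim_principal
    using cayley_pos filterlim_mono[OF cayley_at_infinity order_refl, of "at 1 within ball 0 1"]
    by (auto simp: at_le eventually_at_filter)
  then have "filterlim (\<lambda>w. h (cayley w)) at_infinity (at 1 within ball 0 1)"
    by (rule filterlim_compose[OF at_inf])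
  then have "filterlim (\<lambda>w. h (cayley w) - h (cayley q)) at_infinity (at 1 within ball 0 1)"
    using tendsto_add_filterlim_at_infinity'[OF _ tendsto_const[of "- h (cayley q)"]] by simp
  then have "((\<lambda>w. inverse (h (cayley w) - h (cayley q))) \<longlongrightarrow> 0) (at 1 within ball 0 1)"
    by (rule filterlim_compose[OF tendsto_inverse_0])
  then have "(disc_inv q \<longlongrightarrow> 0) (at 1 within ball 0 1)"
    by (simp add: disc_inv_def[abs_def] inverse_eq_divide)
  moreover have "at (1::complex) within ball 0 1 \<noteq> bot"
    by (rule at_within_ball_nontrivial) simp
  ultimately show ?thesis by (simp add: disc_bd_def tendsto_Lim)
qed

lemma h_limit_from_disc:
  assumes q: "q \<in> ball 0 1" and w: "w \<in> sphere 0 1" "w \<noteq> 1" and nz: "disc_bd q w \<noteq> 0"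
  shows "(h \<longlongrightarrow> h (cayley q) + 1 / disc_bd q w) (at (cayley w) within H)"
proof -
  have "((\<lambda>x. h (cayley q) + 1 / disc_inv q x) \<longlongrightarrow> h (cayley q) + 1 / disc_bd q w) (at w within ball 0 1)"
    by (intro tendsto_intros disc_bd_limit q w nz)
  then have 1: "((\<lambda>x. h (cayley x)) \<longlongrightarrow> h (cayley q) + 1 / disc_bd q w) (at w within ball 0 1)"
    by (simp add: disc_inv_def[abs_def])
  have "filterlim cayley_inv (at w within ball 0 1) (at (cayley w) within H)"
    unfolding filterlim_at
  proof
    have ne: "cayley w \<noteq> -1" using cayley_imag[OF w] by auto
    have cw: "cayley_inv (cayley w) = w" using cayley_inv_cayley w by blast
    have "(cayley_inv \<longlongrightarrow> cayley_inv (cayley w)) (at (cayley w))"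
      using continuous_on_eq_continuous_at[of "- {-1}" cayley_inv] continuous_cayley_inv ne
      by (simp add: isCont_def open_Compl)
    then show "(cayley_inv \<longlongrightarrow> w) (at (cayley w) within H)"
      unfolding cw by (rule tendsto_within_subset) simp
    show "eventually (\<lambda>x. cayley_inv x \<in> ball 0 1 \<and> cayley_inv x \<noteq> w) (at (cayley w) within H)"
      proof -
      have "cayley_inv x \<in> ball 0 1 \<and> cayley_inv x \<noteq> w" if "x \<in> H" for x
        using cayley_inv_ball[of x] that w by auto
      then show ?thesis
        unfolding eventually_at_filter by (intro always_eventually) auto
    qed
  qed
  from filterlim_compose[OF 1 this]
  have "((\<lambda>x. h (cayley (cayley_inv x))) \<longlongrightarrow> h (cayley q) + 1 / disc_bd q w) (at (cayley w) within H)" .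
  then show ?thesis
  proof (rule Lim_transform_eventually)
    have "cayley (cayley_inv x) = x" if "x \<in> H" for x
      by (rule cayley_cayley_inv) (use that in auto)
    then show "eventually (\<lambda>x. h (cayley (cayley_inv x)) = h x) (at (cayley w) within H)"
      by (simp add: eventually_at_filter)
  qed
qed

text \<open>Meant on the closed disc without the pole \<open>q\<close>. The value at
  \<open>q\<close> itself has no meaning, since the second branch takes it from
  \<open>disc_bd\<close>.\<close>

definition disc_ext :: "complex \<Rightarrow> complex \<Rightarrow> complex" where
  "disc_ext q w = (if w \<in> ball 0 1 - {q} then disc_inv q w else disc_bd q w)"

lemma holo_disc_inv:
  assumes q: "q \<in> ball 0 1"
  shows "disc_inv q holomorphic_on ball 0 1 - {q}"
proof -
  have "cayley holomorphic_on ball 0 1 - {q}"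
    unfolding cayley_def by (intro holomorphic_intros) auto
  then have "h \<circ> cayley holomorphic_on ball 0 1 - {q}"
    by (rule holomorphic_on_compose_gen[OF _ holo]) (use cayley_pos in auto)
  then show ?thesis
    unfolding disc_inv_def[abs_def] o_def using h_cayley_ne[OF _ q]
    by (intro holomorphic_intros) auto
qed

lemma continuous_disc_ext:
  assumes q: "q \<in> ball 0 1"
  shows "continuous_on (cball 0 1 - {q}) (disc_ext q)"
proof -
  have "continuous_on ((ball 0 1 - {q}) \<union> sphere 0 1)
      (\<lambda>w. if w \<in> ball 0 1 - {q} then disc_inv q w else disc_bd q w)"
  proof (rule continuous_on_extension_by_limits)
    show "continuous_on (ball 0 1 - {q}) (disc_inv q)"
      by (rule holomorphic_on_imp_continuous_on[OF holo_disc_inv[OF q]])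
    show "sphere 0 1 \<inter> (ball 0 1 - {q}) = {}" by auto
    show "sphere 0 1 \<subseteq> closure (ball 0 1 - {q})"
    proof
      fix x :: complex assume x: "x \<in> sphere 0 1"
      have "x \<in> (- {q}) \<inter> closure (ball 0 1)" using x q by auto
      also have "\<dots> \<subseteq> closure (- {q} \<inter> ball 0 1)"
        by (rule open_Int_closure_subset) auto
      also have "- {q} \<inter> ball 0 1 = ball 0 1 - {q}" by auto
      finally show "x \<in> closure (ball 0 1 - {q})" .
    qed
    show "(disc_inv q \<longlongrightarrow> disc_bd q x) (at x within ball 0 1 - {q})" if "x \<in> sphere 0 1" for x
      using disc_bd_limit[OF q that] by (rule tendsto_within_subset) auto
  qed auto
  moreover have "(ball 0 1 - {q}) \<union> sphere 0 1 = cball 0 1 - {q}" using q by auto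
  ultimately show ?thesis by (simp add: disc_ext_def[abs_def])
qed

text \<open>If the boundary values were constant on an arc, Schwarz reflection across it and the
  identity theorem would make \<open>disc_inv q\<close> constant on an open set, although it is
  injective.\<close>

lemma disc_bd_nonconstant:
  assumes q: "q \<in> ball 0 1" and U: "open U" "U \<inter> sphere 0 1 \<noteq> {}"
  shows "\<exists>x\<in>U \<inter> sphere 0 1. disc_ext q x \<noteq> p"
proof (rule ccontr)
  assume "\<not> ?thesis"
  then have const: "disc_ext q x = p" if "x \<in> U" "x \<in> sphere 0 1" for x using that by blast
  obtain x0 where x0: "x0 \<in> U" "x0 \<in> sphere 0 1" using U by blast
  \<comment> \<open>A point other than 1 is wanted, so that its Cayley image is finite.\<close>
  have "\<exists>x\<in>U \<inter> sphere 0 1. x \<noteq> 1"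
  proof (cases "x0 = 1")
    case True
    have "isCont (\<lambda>t. cis t) 0" unfolding cis_conv_exp by (intro continuous_intros)
    then have "(cis \<longlongrightarrow> 1) (at_right 0)"
      unfolding isCont_def by (auto intro: tendsto_within_subset)
    then have "eventually (\<lambda>t. cis t \<in> U) (at_right 0)"
      using U(1) x0 True by (auto intro: topological_tendstoD)
    moreover have "eventually (\<lambda>t::real. t \<in> {0<..<pi}) (at_right 0)"
      by (rule eventually_at_right_real) simp
    ultimately have "eventually (\<lambda>t. cis t \<in> U \<and> t \<in> {0<..<pi}) (at_right 0)"
      by eventually_elim simp
    then obtain t where t: "cis t \<in> U" "0 < t" "t < pi"
      using eventually_happens'[OF trivial_limit_at_right_real] by force
    then have "sin t > 0" by (simp add: sin_gt_zero)
    then have "cis t \<noteq> 1" by (auto simp: complex_eq_iff)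
    then show ?thesis using t by force
  qed (use x0 in auto)
  then obtain x where x: "x \<in> U" "x \<in> sphere 0 1" "x \<noteq> 1" by blast
  define y where "y = - Im (cayley x)"
  have cx: "cayley x = - \<i> * of_real y" using cayley_imag[OF x(2,3)] by (simp add: y_def complex_eq_iff)
  \<comment> \<open>The rotation turns the right half-plane into the upper one, for which
    \<open>Schwarz_reflection\<close> is formulated.\<close>
  define \<psi> where "\<psi> \<zeta> = cayley_inv (- \<i> * \<zeta>)" for \<zeta>
  have \<psi>x: "\<psi> (of_real y) = x" unfolding \<psi>_def cx[symmetric] by (rule cayley_inv_cayley[OF x(3)])
  have cont\<psi>: "continuous_on {\<zeta>. 0 \<le> Im \<zeta>} \<psi>"
    unfolding \<psi>_def
    by (rule continuous_on_compose2[OF continuous_cayley_inv]) (auto intro!: continuous_intros simp: complex_eq_iff)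
  have "open (U - {q})" using U by auto
  then obtain e where e: "0 < e" "\<And>\<zeta>. 0 \<le> Im \<zeta> \<Longrightarrow> dist \<zeta> (of_real y) < e \<Longrightarrow> \<psi> \<zeta> \<in> U - {q}"
  proof -
    assume "open (U - {q})"
    have "(\<psi> \<longlongrightarrow> x) (at (of_real y) within {\<zeta>. 0 \<le> Im \<zeta>})"
      using cont\<psi> \<psi>x unfolding continuous_on_def by force
    then have "eventually (\<lambda>\<zeta>. \<psi> \<zeta> \<in> U - {q}) (at (of_real y) within {\<zeta>. 0 \<le> Im \<zeta>})"
      using x q \<open>open (U - {q})\<close> by (intro topological_tendstoD) auto
    then obtain e where "0 < e" "\<And>\<zeta>. 0 \<le> Im \<zeta> \<Longrightarrow> \<zeta> \<noteq> of_real y \<Longrightarrow> dist \<zeta> (of_real y) < e \<Longrightarrow> \<psi> \<zeta> \<in> U - {q}"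
      by (auto simp: eventually_at)
    then show thesis using that x q \<psi>x by (metis DiffI singletonD dist_self mem_ball_0 mem_sphere_0 order_less_irrefl)
  qed
  define S where "S = ball (complex_of_real y) e"
  define F where "F = (\<lambda>\<zeta>. disc_ext q (\<psi> \<zeta>) - p)"
  have up: "\<psi> \<zeta> \<in> ball 0 1" if "0 < Im \<zeta>" for \<zeta>
    unfolding \<psi>_def by (rule cayley_inv_ball) (use that in simp)
  have re: "\<psi> \<zeta> \<in> sphere 0 1" if "Im \<zeta> = 0" for \<zeta>
    unfolding \<psi>_def by (rule cayley_inv_sphere) (use that in simp)
  have holF: "F holomorphic_on (S \<inter> {\<zeta>. 0 < Im \<zeta>})"
  proof -
    have "\<psi> holomorphic_on (S \<inter> {\<zeta>. 0 < Im \<zeta>})"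
      unfolding \<psi>_def cayley_inv_def by (intro holomorphic_intros) (auto simp: complex_eq_iff)
    then have "disc_inv q \<circ> \<psi> holomorphic_on (S \<inter> {\<zeta>. 0 < Im \<zeta>})"
      by (rule holomorphic_on_compose_gen[OF _ holo_disc_inv[OF q]])
        (use up e(2) in \<open>force simp: S_def dist_commute\<close>)
    then have "(\<lambda>\<zeta>. (disc_inv q \<circ> \<psi>) \<zeta> - p) holomorphic_on (S \<inter> {\<zeta>. 0 < Im \<zeta>})"
      by (intro holomorphic_intros)
    then show ?thesis
      by (rule holomorphic_transform)
        (use up e(2) in \<open>force simp: F_def disc_ext_def S_def dist_commute\<close>)
  qed
  have contF: "continuous_on (S \<inter> {\<zeta>. 0 \<le> Im \<zeta>}) F"
  proof -
    have "continuous_on (S \<inter> {\<zeta>. 0 \<le> Im \<zeta>}) (\<lambda>\<zeta>. disc_ext q (\<psi> \<zeta>))"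
    proof (rule continuous_on_compose2[OF continuous_disc_ext[OF q]])
      show "continuous_on (S \<inter> {\<zeta>. 0 \<le> Im \<zeta>}) \<psi>"
        by (rule continuous_on_subset[OF cont\<psi>]) auto
      show "\<psi> ` (S \<inter> {\<zeta>. 0 \<le> Im \<zeta>}) \<subseteq> cball 0 1 - {q}"
      proof
        fix v assume "v \<in> \<psi> ` (S \<inter> {\<zeta>. 0 \<le> Im \<zeta>})"
        then obtain \<zeta> where z: "\<zeta> \<in> S" "0 \<le> Im \<zeta>" "v = \<psi> \<zeta>" by blast
        then have "v \<noteq> q" using e(2) by (auto simp: S_def dist_commute)
        moreover have "v \<in> cball 0 1"
          using up[of \<zeta>] re[of \<zeta>] z by (cases "Im \<zeta> = 0") auto
        ultimately show "v \<in> cball 0 1 - {q}" by blast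
      qed
    qed
    then show ?thesis unfolding F_def by (intro continuous_intros)
  qed
  have F0: "F \<zeta> = 0" if "\<zeta> \<in> S" "Im \<zeta> = 0" for \<zeta>
    using const[of "\<psi> \<zeta>"] re[of \<zeta>] e(2)[of \<zeta>] that by (auto simp: F_def S_def dist_commute)
  define E where "E = (\<lambda>\<zeta>. if 0 \<le> Im \<zeta> then F \<zeta> else cnj (F (cnj \<zeta>)))"
  have "E holomorphic_on S"
    unfolding E_def
  proof (rule Schwarz_reflection)
    show "cnj ` S \<subseteq> S"
    proof
      fix v assume "v \<in> cnj ` S"
      then obtain \<zeta> where z: "\<zeta> \<in> S" "v = cnj \<zeta>" by blast
      have "dist (of_real y) (cnj \<zeta>) = cmod (cnj (of_real y - \<zeta>))" by (simp add: dist_norm)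
      then show "v \<in> S" using z by (simp only: complex_mod_cnj) (simp add: S_def dist_norm)
    qed
    show "F \<zeta> \<in> \<real>" if "\<zeta> \<in> S" "\<zeta> \<in> \<real>" for \<zeta>
      using F0 that by (auto simp: complex_is_Real_iff)
  qed (use holF contF in \<open>auto simp: S_def\<close>)
  have E0: "E \<zeta> = 0" if "\<zeta> \<in> S" for \<zeta>
  proof (rule analytic_continuation[OF \<open>E holomorphic_on S\<close>, where U = "S \<inter> \<real>" and \<xi> = "of_real y"])
    show "of_real y islimpt S \<inter> \<real>"
      unfolding islimpt_approachable
    proof (intro allI impI)
      fix d :: real assume d: "0 < d"
      define v where "v = complex_of_real (y + min d e / 2)"
      have "v - of_real y = of_real (min d e / 2)" by (simp add: v_def)
      then have "dist v (of_real y) = min d e / 2"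
        using d e(1) by (simp only: dist_norm norm_of_real)
      then have "v \<in> S \<inter> \<real>" "v \<noteq> of_real y" "dist v (of_real y) < d"
        using d e(1) by (auto simp: S_def v_def dist_commute min_def)
      then show "\<exists>v\<in>S \<inter> \<real>. v \<noteq> of_real y \<and> dist v (of_real y) < d" by blast
    qed
    show "\<And>z. z \<in> S \<inter> \<real> \<Longrightarrow> E z = 0"
      using F0 by (auto simp: E_def complex_is_Real_iff)
  qed (use that e in \<open>auto simp: S_def\<close>)
  \<comment> \<open>Two distinct points of the upper half-plane with the same value contradict
    injectivity.\<close>
  define \<zeta>1 \<zeta>2 where "\<zeta>1 = Complex y (e/2)" and "\<zeta>2 = Complex y (e/3)"
  have z12: "\<zeta>1 \<in> S" "\<zeta>2 \<in> S" "0 < Im \<zeta>1" "0 < Im \<zeta>2"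
    using e(1) by (auto simp: S_def \<zeta>1_def \<zeta>2_def dist_norm cmod_def)
  then have "F \<zeta>1 = 0" "F \<zeta>2 = 0" using E0[of \<zeta>1] E0[of \<zeta>2] by (auto simp: E_def)
  moreover have in12: "\<psi> \<zeta>1 \<in> ball 0 1 - {q}" "\<psi> \<zeta>2 \<in> ball 0 1 - {q}"
    using up[OF z12(3)] up[OF z12(4)] e(2)[of \<zeta>1] e(2)[of \<zeta>2] z12 by (auto simp: S_def dist_commute)
  ultimately have "disc_inv q (\<psi> \<zeta>1) = disc_inv q (\<psi> \<zeta>2)"
    by (simp add: F_def disc_ext_def)
  then have "h (cayley (\<psi> \<zeta>1)) = h (cayley (\<psi> \<zeta>2))"
    using h_cayley_ne[OF in12(1) q] h_cayley_ne[OF in12(2) q] by (simp add: disc_inv_def)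
  then have "cayley (\<psi> \<zeta>1) = cayley (\<psi> \<zeta>2)"
    using inj_onD[OF inj] cayley_in_H in12 by blast
  moreover have "cayley (\<psi> \<zeta>) = - \<i> * \<zeta>" if "0 < Im \<zeta>" for \<zeta>
    unfolding \<psi>_def by (rule cayley_cayley_inv) (use that in \<open>auto simp: complex_eq_iff\<close>)
  ultimately have "\<zeta>1 = \<zeta>2" using z12 by simp
  then show False using e(1) by (simp add: \<zeta>1_def \<zeta>2_def)
qed


text \<open>\<open>boundary_values_distinct\<close> is applied to the image of the spherical
  frontier of h(H) under the same inversion. This curve contains 0, the image of infinity, because
  h(H) is unbounded; it misses the image of the open disc, because h(H) is open.\<close>

lemma disc_bd_distinct:
  assumes q: "q \<in> ball 0 1" and w: "w1 \<in> sphere 0 1" "w2 \<in> sphere 0 1" "w1 \<noteq> w2"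
    and qw: "q \<notin> closed_segment w1 w2"
  shows "disc_bd q w1 \<noteq> disc_bd q w2"
proof -
  define a where "a = h (cayley q)"
  define J where "J = riemann_sphere frontier_of (Some ` h ` H)"
  have oD: "open (h ` H)" by (rule open_image) (auto simp: open_H)
  have J_None: "None \<in> J"
    unfolding J_def by (rule frontier_of_riemann_sphere_None[OF unbounded_image])
  have J_Some: "Some v \<in> J \<longleftrightarrow> v \<in> frontier (h ` H)" for v
    unfolding J_def by (rule frontier_of_riemann_sphere_Some[OF oD])
  have fr: "v \<notin> frontier (h ` H)" if "v \<in> h ` H" for v
    using that oD by (simp add: frontier_def interior_open)
  have aD: "a \<in> h ` H" using cayley_in_H[OF q] by (simp add: a_def)
  have aJ: "Some a \<notin> J" using fr[OF aD] J_Some by blast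
  have jJ: "jordan_curve J" using jordan by (simp add: jordan_domain_def J_def)
  have ext_sphere: "disc_ext q w = disc_bd q w" if "w \<in> sphere 0 1" for w
    using that by (auto simp: disc_ext_def)
  have "disc_ext q w1 \<noteq> disc_ext q w2"
  proof (rule boundary_values_distinct[OF continuous_disc_ext[OF q], where J = "sphere_inversion a ` J"])
    have "inj_on (disc_inv q) (ball 0 1 - {q})"
    proof (rule inj_onI)
      fix x y assume xy: "x \<in> ball 0 1 - {q}" "y \<in> ball 0 1 - {q}" "disc_inv q x = disc_inv q y"
      then have "h (cayley x) = h (cayley y)"
        using h_cayley_ne[OF xy(1) q] h_cayley_ne[OF xy(2) q] by (simp add: disc_inv_def)
      then have "cayley x = cayley y" using inj_onD[OF inj] cayley_in_H xy by blast
      moreover have "x \<in> - {1}" "y \<in> - {1}" using xy by auto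
      ultimately show "x = y" using inj_onD[OF inj_cayley] by blast
    qed
    then show "inj_on (disc_ext q) (ball 0 1 - {q})"
      by (simp add: disc_ext_def inj_on_def)
    show "filterlim (disc_ext q) at_infinity (at q)"
    proof -
      have "q \<noteq> 1" using q by auto
      have "isCont cayley q"
        using \<open>q \<noteq> 1\<close> by (rule isCont_cayley)
      moreover have "isCont h (cayley q)"
        using holomorphic_on_imp_continuous_on[OF holo] cayley_in_H[OF q] open_H
        by (simp add: continuous_on_eq_continuous_at)
      ultimately have "isCont (\<lambda>w. h (cayley w)) q" by (rule isCont_o2)
      then have "((\<lambda>w. h (cayley w) - a) \<longlongrightarrow> a - a) (at q)"
        unfolding isCont_def a_def by (intro tendsto_intros)
      moreover have ev: "eventually (\<lambda>w. w \<in> ball 0 1 - {q}) (at q)"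
        using q by (auto simp: eventually_at_filter intro: eventually_mono[OF eventually_nhds_in_open[of "ball 0 1"]])
      then have "eventually (\<lambda>w. h (cayley w) - a \<noteq> 0) (at q)"
        by eventually_elim (use h_cayley_ne[OF _ q] in \<open>auto simp: a_def\<close>)
      ultimately have "filterlim (\<lambda>w. h (cayley w) - a) (at 0) (at q)"
        by (simp add: filterlim_at)
      then have "filterlim (\<lambda>w. inverse (h (cayley w) - a)) at_infinity (at q)"
        by (rule filterlim_compose[OF filterlim_inverse_at_infinity])
      then show ?thesis
        by (rule filterlim_cong[OF refl refl, THEN iffD1, rotated])
          (use ev in \<open>eventually_elim, auto simp: disc_ext_def disc_inv_def a_def inverse_eq_divide\<close>)
    qed
    show "disc_ext q ` (ball 0 1 - {q}) \<inter> sphere_inversion a ` J = {}"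
    proof (rule ccontr)
      assume "\<not> ?thesis"
      then obtain u where u: "u \<in> disc_ext q ` (ball 0 1 - {q})" "u \<in> sphere_inversion a ` J" by blast
      then obtain w where w: "w \<in> ball 0 1 - {q}" and uw: "u = disc_ext q w" by blast
      obtain x where "u = sphere_inversion a x" and x: "x \<in> J" by (rule imageE[OF u(2)])
      then have x: "x \<in> J" "disc_ext q w = sphere_inversion a x" using uw by simp_all
      have *: "disc_ext q w = 1 / (h (cayley w) - a)" "h (cayley w) \<noteq> a"
        using w h_cayley_ne[OF w q] by (auto simp: disc_ext_def disc_inv_def a_def)
      obtain v where v: "x = Some v"
        using x * by (cases x) (auto simp: sphere_inversion_def)
      have "v \<noteq> a" using v x aJ by auto
      then have "v = h (cayley w)" using v x * by (simp add: sphere_inversion_def)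
      then show False using fr[of v] x v J_Some cayley_in_H[of w] w by auto
    qed
    show "disc_ext q ` sphere 0 1 \<subseteq> sphere_inversion a ` J"
    proof
      fix u assume "u \<in> disc_ext q ` sphere 0 1"
      then obtain w where w: "w \<in> sphere 0 1" "u = disc_bd q w" using ext_sphere by auto
      show "u \<in> sphere_inversion a ` J"
      proof (cases "u = 0")
        case True
        then show ?thesis using J_None by (auto simp: sphere_inversion_def intro!: image_eqI[of _ _ None])
      next
        case False
        then have "w \<noteq> 1" using disc_bd_1[OF q] w by auto
        then have lim: "(h \<longlongrightarrow> a + 1 / u) (at (cayley w) within H)"
          using h_limit_from_disc[OF q w(1)] w False by (simp add: a_def)
        have "Re (cayley w) = 0" using cayley_imag w \<open>w \<noteq> 1\<close> by blast
        from boundary_value_not_in_image[OF this lim]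
        have "a + 1 / u \<in> frontier (h ` H)" using oD by (simp add: frontier_def interior_open)
        then show ?thesis
          using J_Some by (intro image_eqI[of _ _ "Some (a + 1 / u)"]) (auto simp: sphere_inversion_def)
      qed
    qed
    show "connected (sphere_inversion a ` J - {p})" if "p \<in> sphere_inversion a ` J" for p
      by (rule connected_inversion_jordan_curve[OF jJ aJ that])
    show "\<exists>x\<in>U \<inter> sphere 0 1. disc_ext q x \<noteq> p" if "open U" "U \<inter> sphere 0 1 \<noteq> {}" for U p
      by (rule disc_bd_nonconstant[OF q that])
  qed (use q w qw in auto)
  then show ?thesis using ext_sphere w by simp
qed

lemma exists_off_chord: "\<exists>q\<in>ball 0 1. q \<notin> closed_segment w1 (w2 :: complex)"
proof (rule ccontr)
  assume "\<not> ?thesis"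
  then have "ball 0 1 \<subseteq> interior (closed_segment w1 w2)"
    by (intro interior_maximal) auto
  then show False using interior_closed_segment_ge2[of w1 w2] by simp
qed

text \<open>The value 0 is taken at the point 1, so distinctness excludes it elsewhere:
  \<open>h\<close> has a finite limit at each finite boundary point.\<close>

lemma disc_bd_nonzero:
  assumes q: "q \<in> ball 0 1" and w: "w \<in> sphere 0 1" "w \<noteq> 1" and qw: "q \<notin> closed_segment w 1"
  shows "disc_bd q w \<noteq> 0"
  using disc_bd_distinct[OF q w(1) _ w(2) qw] disc_bd_1[OF q] by simp

lemma boundary_extension:
  obtains g where "continuous_on {z. 0 \<le> Re z} g" "inj_on g {z. 0 \<le> Re z}" "\<And>z. z \<in> H \<Longrightarrow> g z = h z"
proof -
  have ex: "\<exists>l. (h \<longlongrightarrow> l) (at z within H)" if z: "Re z = 0" for z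
  proof -
    define w where "w = cayley_inv z"
    have w: "w \<in> sphere 0 1" "w \<noteq> 1" using cayley_inv_sphere[OF z] cayley_inv_ne_1 by (auto simp: w_def)
    obtain q where q: "q \<in> ball 0 1" "q \<notin> closed_segment w 1" using exists_off_chord by blast
    have "cayley w = z" unfolding w_def by (rule cayley_cayley_inv) (use z in auto)
    then show ?thesis using h_limit_from_disc[OF q(1) w disc_bd_nonzero[OF q(1) w q(2)]] by auto
  qed
  define L where "L z = (SOME l. (h \<longlongrightarrow> l) (at z within H))" for z
  have L: "(h \<longlongrightarrow> L z) (at z within H)" if "Re z = 0" for z
    unfolding L_def using ex[OF that] by (rule someI_ex)
  \<comment> \<open>The limit \<open>L z\<close> does not depend on the pole. Each pair of boundary
    points may therefore be compared through a pole chosen for that pair.\<close>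
  have L_disc: "disc_bd q (cayley_inv z) = 1 / (L z - h (cayley q))" "L z \<noteq> h (cayley q)"
    if z: "Re z = 0" and q: "q \<in> ball 0 1" for z q
  proof -
    define w where "w = cayley_inv z"
    have w: "w \<in> sphere 0 1" "w \<noteq> 1" using cayley_inv_sphere[OF z] cayley_inv_ne_1 by (auto simp: w_def)
    have cw: "cayley w = z" unfolding w_def by (rule cayley_cayley_inv) (use z in auto)
    show ne: "L z \<noteq> h (cayley q)"
      using boundary_value_not_in_image(1)[OF z L[OF z]] cayley_in_H[OF q] by blast
    have "((\<lambda>x. h (cayley x)) \<longlongrightarrow> L z) (at w within ball 0 1)"
      using filterlim_compose[OF L[OF z, folded cw] cayley_filterlim[OF w]] cw by simp
    then have "(disc_inv q \<longlongrightarrow> 1 / (L z - h (cayley q))) (at w within ball 0 1)"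
      unfolding disc_inv_def[abs_def] using ne by (intro tendsto_intros) auto
    then show "disc_bd q (cayley_inv z) = 1 / (L z - h (cayley q))"
      using tendsto_unique[OF at_within_ball_nontrivial[OF w(1)] disc_bd_limit[OF q w(1)]]
      by (simp add: w_def)
  qed
  define g where "g = (\<lambda>z. if z \<in> H then h z else L z)"
  have "continuous_on (H \<union> {z. Re z = 0}) g"
    unfolding g_def
  proof (rule continuous_on_extension_by_limits)
    show "{z. Re z = 0} \<subseteq> closure H"
    proof
      fix z :: complex assume z: "z \<in> {z. Re z = 0}"
      show "z \<in> closure H"
        unfolding closure_approachable
      proof (intro allI impI)
        fix e :: real assume e: "0 < e"
        have "z + of_real (e/2) \<in> H" using z e by simp
        moreover have "dist (z + of_real (e/2)) z < e" using e by (simp add: dist_norm)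
        ultimately show "\<exists>y\<in>H. dist y z < e" by blast
      qed
    qed
  qed (use open_H holomorphic_on_imp_continuous_on[OF holo] L in auto)
  moreover have "H \<union> {z. Re z = 0} = {z. 0 \<le> Re z}" by auto
  moreover have "inj_on g {z. 0 \<le> Re z}"
  proof (rule inj_onI)
    fix x y assume xy: "x \<in> {z. 0 \<le> Re z}" "y \<in> {z. 0 \<le> Re z}" "g x = g y"
    have in_bd: "g u \<noteq> g v" if "u \<in> H" "Re v = 0" for u v
    proof -
      have "g u = h u" "g v = L v" "h u \<in> h ` H" using that by (auto simp: g_def)
      then show ?thesis using boundary_value_not_in_image(1)[OF that(2) L[OF that(2)]] by metis
    qed
    consider "x \<in> H" "y \<in> H" | "x \<in> H" "Re y = 0" | "Re x = 0" "y \<in> H" | "Re x = 0" "Re y = 0"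
      using xy by fastforce
    then show "x = y"
    proof cases
      case 1
      then show ?thesis using xy inj by (auto simp: g_def inj_on_def)
    next
      case 4
      show ?thesis
      proof (rule ccontr)
        assume ne: "x \<noteq> y"
        have m1: "x \<noteq> -1" "y \<noteq> -1" using 4 by auto
        have ne': "cayley_inv x \<noteq> cayley_inv y" using ne cayley_cayley_inv m1 by metis
        obtain q where q: "q \<in> ball 0 1" "q \<notin> closed_segment (cayley_inv x) (cayley_inv y)"
          using exists_off_chord by blast
        have "L x = L y" using xy 4 by (simp add: g_def)
        then have "disc_bd q (cayley_inv x) = disc_bd q (cayley_inv y)"
          using L_disc 4 q by simp
        then show False
          using disc_bd_distinct[OF q(1) cayley_inv_sphere[OF 4(1)] cayley_inv_sphere[OF 4(2)] ne' q(2)] by simp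
      qed
    qed (use in_bd xy in \<open>metis\<close>)+
  qed
  ultimately show thesis using that[of g] by (simp add: g_def)
qed

end

section \<open>Length and area of quasiconformal mappings\<close>

text \<open>Changes of variables are carried out in \<open>real^2\<close>, where the Jacobian is the
  determinant of a matrix; the identification preserves Lebesgue measure.\<close>

definition complex_of_vec :: "real^2 \<Rightarrow> complex" where
  "complex_of_vec v = Complex (v $ 1) (v $ 2)"

definition vec_of_complex :: "complex \<Rightarrow> real^2" where
  "vec_of_complex z = (\<chi> i. if i = 1 then Re z else Im z)"

lemma vec_of_complex_nth [simp]: "vec_of_complex z $ 1 = Re z" "vec_of_complex z $ 2 = Im z"
  by (simp_all add: vec_of_complex_def)

lemma complex_of_vec_inverse [simp]: "vec_of_complex (complex_of_vec v) = v"
  by (simp add: vec_eq_iff forall_2 complex_of_vec_def)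

lemma vec_of_complex_inverse [simp]: "complex_of_vec (vec_of_complex z) = z"
  by (simp add: complex_of_vec_def)

lemma bounded_linear_complex_of_vec: "bounded_linear complex_of_vec"
proof -
  have "linear complex_of_vec"
    by (intro linearI) (simp_all add: complex_of_vec_def complex_eq_iff)
  then show ?thesis by (rule linear_conv_bounded_linear[THEN iffD1])
qed

lemma bounded_linear_vec_of_complex: "bounded_linear vec_of_complex"
proof -
  have "linear vec_of_complex"
    by (intro linearI) (simp_all add: vec_eq_iff forall_2)
  then show ?thesis by (rule linear_conv_bounded_linear[THEN iffD1])
qed

lemma distr_complex_of_vec: "distr lborel borel complex_of_vec = lborel"
proof (rule lborel_eqI[symmetric])
  fix l u :: complex assume le: "\<And>b. b \<in> Basis \<Longrightarrow> l \<bullet> b \<le> u \<bullet> b"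
  have m: "complex_of_vec \<in> borel_measurable lborel"
    using bounded_linear_complex_of_vec by (simp add: borel_measurable_continuous_onI linear_continuous_on)
  have "complex_of_vec -` box l u = box (vec_of_complex l) (vec_of_complex u)"
    by (auto simp: box_def Basis_complex_def Basis_vec_def complex_of_vec_def inner_axis forall_2 exhaust_2)
  moreover have "\<And>b. b \<in> Basis \<Longrightarrow> vec_of_complex l \<bullet> b \<le> vec_of_complex u \<bullet> b"
    using le[of 1] le[of \<i>] by (auto simp: Basis_vec_def inner_axis Basis_complex_def vec_of_complex_def)
  moreover have "(\<Prod>b\<in>Basis. (vec_of_complex u - vec_of_complex l) \<bullet> b) = (Re u - Re l) * (Im u - Im l)"
  proof -
    have B: "(Basis :: (real^2) set) = {axis 1 1, axis 2 1}"
      by (auto simp: Basis_vec_def UNIV_2)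
    have "axis 1 (1::real) \<noteq> (axis 2 1 :: real^2)" by (simp add: axis_eq_axis)
    then show ?thesis unfolding B by (simp add: inner_axis)
  qed
  ultimately show "emeasure (distr lborel borel complex_of_vec) (box l u) = ennreal (\<Prod>b\<in>Basis. (u - l) \<bullet> b)"
    using m by (simp add: emeasure_distr emeasure_lborel_box Basis_complex_def)
qed simp

lemma distr_Complex: "distr (lborel \<Otimes>\<^sub>M lborel) borel (\<lambda>(x, y). Complex x y) = lborel"
proof (rule lborel_eqI[symmetric])
  fix l u :: complex assume le: "\<And>b. b \<in> Basis \<Longrightarrow> l \<bullet> b \<le> u \<bullet> b"
  have m: "(\<lambda>(x, y). Complex x y) \<in> borel_measurable (lborel \<Otimes>\<^sub>M lborel)"
    unfolding lborel_prod by (simp add: borel_measurable_continuous_onI Complex_eq case_prod_unfold continuous_intros)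
  have "(\<lambda>(x, y). Complex x y) -` box l u = box (Re l) (Re u) \<times> box (Im l) (Im u)"
    by (auto simp: box_def Basis_complex_def)
  moreover have "Re l \<le> Re u" "Im l \<le> Im u"
    using le[of 1] le[of \<i>] by (auto simp: Basis_complex_def)
  ultimately show "emeasure (distr (lborel \<Otimes>\<^sub>M lborel) borel (\<lambda>(x, y). Complex x y)) (box l u) = ennreal (\<Prod>b\<in>Basis. (u - l) \<bullet> b)"
    using m by (simp add: emeasure_distr space_pair_measure lborel.emeasure_pair_measure_Times ennreal_mult' Basis_complex_def)
qed simp

lemma nn_integral_complex:
  assumes "f \<in> borel_measurable borel"
  shows "(\<integral>\<^sup>+z. f z \<partial>lborel) = (\<integral>\<^sup>+y. \<integral>\<^sup>+x. f (Complex x y) \<partial>lborel \<partial>lborel)"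
    and "(\<integral>\<^sup>+z. f z \<partial>lborel) = (\<integral>\<^sup>+x. \<integral>\<^sup>+y. f (Complex x y) \<partial>lborel \<partial>lborel)"
proof -
  have m: "(\<lambda>(x, y). Complex x y) \<in> borel_measurable (lborel \<Otimes>\<^sub>M lborel)"
    unfolding lborel_prod by (simp add: borel_measurable_continuous_onI Complex_eq case_prod_unfold continuous_intros)
  have fm: "(\<lambda>(x, y). f (Complex x y)) \<in> borel_measurable (lborel \<Otimes>\<^sub>M lborel)"
    using measurable_compose[OF m assms] by (simp add: case_prod_unfold)
  have 1: "(\<integral>\<^sup>+z. f z \<partial>lborel) = (\<integral>\<^sup>+(x, y). f (Complex x y) \<partial>(lborel \<Otimes>\<^sub>M lborel))"
    unfolding distr_Complex[symmetric] using m assms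
    by (subst nn_integral_distr) (simp_all add: case_prod_unfold)
  show "(\<integral>\<^sup>+z. f z \<partial>lborel) = (\<integral>\<^sup>+y. \<integral>\<^sup>+x. f (Complex x y) \<partial>lborel \<partial>lborel)"
    unfolding 1 using lborel_pair.nn_integral_snd[OF fm] by (simp add: case_prod_unfold)
  show "(\<integral>\<^sup>+z. f z \<partial>lborel) = (\<integral>\<^sup>+x. \<integral>\<^sup>+y. f (Complex x y) \<partial>lborel \<partial>lborel)"
    unfolding 1 using lborel.nn_integral_fst[OF fm] by (simp add: case_prod_unfold)
qed

lemma AE_complex:
  assumes "AE z in lborel. P z"
  shows "AE y in lborel. AE x in lborel. P (Complex x y)"
    and "AE x in lborel. AE y in lborel. P (Complex x y)"
proof -
  have m: "(\<lambda>(x, y). Complex x y) \<in> borel_measurable (lborel \<Otimes>\<^sub>M lborel)"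
    unfolding lborel_prod by (simp add: borel_measurable_continuous_onI Complex_eq case_prod_unfold continuous_intros)
  obtain N where N: "N \<in> null_sets lborel" "{z. \<not> P z} \<subseteq> N"
    using assms by (auto elim: AE_E simp: null_sets_def)
  then have NB: "N \<in> sets borel" by auto
  have "AE z in distr (lborel \<Otimes>\<^sub>M lborel) borel (\<lambda>(x, y). Complex x y). z \<notin> N"
    unfolding distr_Complex using N(1) by (rule AE_not_in)
  then have AE1: "AE (x, y) in lborel \<Otimes>\<^sub>M lborel. Complex x y \<notin> N"
    using m NB by (subst (asm) AE_distr_iff) (auto simp: case_prod_unfold)
  have "AE x in lborel. AE y in lborel. Complex x y \<notin> N"
    using lborel_pair.AE_pair[OF AE1] by simp
  then have "AE x in lborel. AE y in lborel. P (Complex x y)"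
    and swap: "AE y in lborel. AE x in lborel. Complex x y \<notin> N"
  proof -
    assume *: "AE x in lborel. AE y in lborel. Complex x y \<notin> N"
    show "AE x in lborel. AE y in lborel. P (Complex x y)"
      using *
    proof eventually_elim
      case (elim x)
      then show ?case by eventually_elim (use N(2) in auto)
    qed
    have "(\<lambda>p. Complex (fst p) (snd p)) -` (- N) \<in> sets (lborel \<Otimes>\<^sub>M lborel)"
      using measurable_sets[OF m, of "- N"] NB by (simp add: case_prod_unfold space_pair_measure)
    then have "{p \<in> space (lborel \<Otimes>\<^sub>M lborel). Complex (fst p) (snd p) \<notin> N} \<in> sets (lborel \<Otimes>\<^sub>M lborel)"
      by (simp add: vimage_def space_pair_measure)
    from lborel_pair.AE_commute[OF this] * show "AE y in lborel. AE x in lborel. Complex x y \<notin> N"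
      by simp
  qed
  then show "AE x in lborel. AE y in lborel. P (Complex x y)" by simp
  show "AE y in lborel. AE x in lborel. P (Complex x y)"
    using swap
  proof eventually_elim
    case (elim y)
    then show ?case by eventually_elim (use N(2) in auto)
  qed
qed

text \<open>The derivative is taken relative to \<open>S\<close>, which may have empty interior: the
  lemma serves for the compact pieces of an Egorov exhaustion. The determinant with columns
  \<open>a\<close> and \<open>b\<close> is \<open>Im (cnj a * b)\<close>.\<close>

lemma nn_integral_jacobian_le:
  fixes F :: "complex \<Rightarrow> complex"
  assumes S: "compact S" and inj: "inj_on F S"
    and der: "\<And>z. z \<in> S \<Longrightarrow> (F has_derivative (\<lambda>h. of_real (Re h) * a z + of_real (Im h) * b z)) (at z within S)"
    and meas: "a \<in> borel_measurable borel" "b \<in> borel_measurable borel"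
  shows "(\<integral>\<^sup>+z. ennreal \<bar>Im (cnj (a z) * b z)\<bar> * indicator S z \<partial>lborel) \<le> emeasure lborel (F ` S)"
proof -
  define S' where "S' = vec_of_complex ` S"
  define f where "f = (\<lambda>v. vec_of_complex (F (complex_of_vec v)))"
  define f' where "f' = (\<lambda>v h. vec_of_complex (of_real (Re (complex_of_vec h)) * a (complex_of_vec v)
      + of_real (Im (complex_of_vec h)) * b (complex_of_vec v)))"
  have im: "complex_of_vec ` S' = S" by (force simp: S'_def image_image)
  have cS': "compact S'"
    unfolding S'_def using S bounded_linear_vec_of_complex
    by (intro compact_continuous_image linear_continuous_on)
  have contF: "continuous_on S F"
    using has_derivative_continuous[OF der] by (auto simp: continuous_on_eq_continuous_within)
  have derf: "(f has_derivative f' v) (at v within S')" if v: "v \<in> S'" for v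
  proof -
    have vS: "complex_of_vec v \<in> S" using v im by blast
    have 1: "(complex_of_vec has_derivative complex_of_vec) (at v within S')"
      by (rule bounded_linear.has_derivative[OF bounded_linear_complex_of_vec]) (rule has_derivative_ident)
    have 2: "((\<lambda>v. F (complex_of_vec v)) has_derivative
        (\<lambda>h. of_real (Re (complex_of_vec h)) * a (complex_of_vec v) + of_real (Im (complex_of_vec h)) * b (complex_of_vec v))) (at v within S')"
      using has_derivative_in_compose[OF 1, of F] der[OF vS] im by simp
    show ?thesis
      unfolding f_def f'_def by (rule bounded_linear.has_derivative[OF bounded_linear_vec_of_complex 2])
  qed
  have injf: "inj_on f S'"
    using inj im unfolding f_def inj_on_def
    by (metis complex_of_vec_inverse imageI vec_of_complex_inverse)
  have fS: "f ` S' = vec_of_complex ` F ` S"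
    unfolding f_def image_image[symmetric] using im by (metis image_image)
  have cfS: "compact (f ` S')"
    unfolding fS
    by (rule compact_continuous_image[OF linear_continuous_on[OF bounded_linear_vec_of_complex]
          compact_continuous_image[OF contF S]])
  have det: "det (matrix (f' v)) = Im (cnj (a (complex_of_vec v)) * b (complex_of_vec v))" for v
    unfolding det_2 matrix_def f'_def
    by (simp add: complex_of_vec_def axis_def algebra_simps)
  have "((\<lambda>v. \<bar>det (matrix (f' v))\<bar>) has_integral measure lebesgue (f ` S')) S'"
    using has_measure_differentiable_image[OF _ derf injf, of "measure lebesgue (f ` S')"] cS' cfS
    by (simp add: lmeasurable_compact compact_imp_closed borel_closed sets_completionI_sets lmeasurable_compact fmeasurableD)
  from nn_integral_has_integral_lebesgue[OF _ this]
  have "(\<integral>\<^sup>+v. ennreal (indicat_real S' v * \<bar>det (matrix (f' v))\<bar>) \<partial>lborel) = ennreal (measure lebesgue (f ` S'))"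
    by simp
  moreover have "ennreal (indicat_real S' v * \<bar>det (matrix (f' v))\<bar>) = indicator S' v * ennreal \<bar>det (matrix (f' v))\<bar>" for v
    by (simp add: indicator_def)
  ultimately have "(\<integral>\<^sup>+v. indicator S' v * ennreal \<bar>det (matrix (f' v))\<bar> \<partial>lborel) = ennreal (measure lebesgue (f ` S'))"
    by simp
  also have "\<dots> = emeasure lebesgue (f ` S')"
    by (rule emeasure_eq_measure2[OF lmeasurable_compact[OF cfS], symmetric])
  also have "\<dots> = emeasure lborel (f ` S')"
    using cfS by (simp add: compact_imp_closed borel_closed)
  finally have 1: "(\<integral>\<^sup>+v. indicator S' v * ennreal \<bar>det (matrix (f' v))\<bar> \<partial>lborel) = emeasure lborel (f ` S')" .
  have mT: "complex_of_vec \<in> borel_measurable borel" "vec_of_complex \<in> borel_measurable borel"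
    using bounded_linear_complex_of_vec bounded_linear_vec_of_complex
    by (simp_all add: borel_measurable_continuous_onI linear_continuous_on)
  have cFS: "compact (F ` S)" using S contF by (intro compact_continuous_image)
  have 2: "emeasure lborel (F ` S) = emeasure lborel (f ` S')"
  proof -
    have "complex_of_vec -` F ` S = f ` S'"
      unfolding fS
    proof (intro equalityI subsetI)
      fix v assume "v \<in> complex_of_vec -` F ` S"
      then have "vec_of_complex (complex_of_vec v) \<in> vec_of_complex ` F ` S" by blast
      then show "v \<in> vec_of_complex ` F ` S" by simp
    qed auto
    then show ?thesis
      unfolding distr_complex_of_vec[symmetric] using mT cFS
      by (subst emeasure_distr) (auto simp: compact_imp_closed borel_closed)
  qed
  have "(\<integral>\<^sup>+z. ennreal \<bar>Im (cnj (a z) * b z)\<bar> * indicator S z \<partial>lborel)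
      = (\<integral>\<^sup>+v. ennreal \<bar>Im (cnj (a (complex_of_vec v)) * b (complex_of_vec v))\<bar> * indicator S (complex_of_vec v) \<partial>lborel)"
    unfolding distr_complex_of_vec[symmetric] using mT meas S
    by (subst nn_integral_distr) (auto simp: compact_imp_closed borel_closed)
  also have "\<dots> = (\<integral>\<^sup>+v. indicator S' v * ennreal \<bar>det (matrix (f' v))\<bar> \<partial>lborel)"
  proof (intro nn_integral_cong)
    fix v
    have "complex_of_vec v \<in> S \<longleftrightarrow> v \<in> S'" unfolding S'_def by (force simp: image_iff)
    then show "ennreal \<bar>Im (cnj (a (complex_of_vec v)) * b (complex_of_vec v))\<bar> * indicator S (complex_of_vec v)
      = indicator S' v * ennreal \<bar>det (matrix (f' v))\<bar>"
      by (simp add: det indicator_def)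
  qed
  finally show ?thesis using 1 2 by simp
qed

text \<open>Shown directly for the gauge integral, so that integrability of \<open>f'\<close> is a
  result. Intervals tagged outside the null set \<open>N\<close> are treated by differentiability at
  the tag. Those tagged in \<open>N\<close> carry the value 0 and lie in an open set of measure
  below \<delta>, where absolute continuity bounds the total increment.\<close>

lemma abs_continuous_fundamental_theorem:
  fixes f :: "real \<Rightarrow> complex"
  assumes ab: "a \<le> b" and ac: "abs_continuous_on_interval f a b"
    and der: "AE x in lborel. x \<in> {a..b} \<longrightarrow> (f has_vector_derivative f' x) (at x)"
  shows "(f' has_integral f b - f a) {a..b}"
proof -
  have "AE x in lebesgue. x \<in> {a..b} \<longrightarrow> (f has_vector_derivative f' x) (at x)"
    using der by (rule AE_completion)
  then obtain N where N: "negligible N"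
    "\<And>x. x \<in> {a..b} \<Longrightarrow> x \<notin> N \<Longrightarrow> (f has_vector_derivative f' x) (at x)"
  proof -
    assume "AE x in lebesgue. x \<in> {a..b} \<longrightarrow> (f has_vector_derivative f' x) (at x)"
    then obtain M where M: "{x \<in> space lebesgue. \<not> (x \<in> {a..b} \<longrightarrow> (f has_vector_derivative f' x) (at x))} \<subseteq> M"
      "emeasure lebesgue M = 0" "M \<in> sets lebesgue"
      by (rule AE_E)
    then have "negligible M" by (simp add: negligible_iff_null_sets null_sets_def)
    then show thesis using that M(1) by auto
  qed
  define g where "g = (\<lambda>x. if x \<in> N then 0 else f' x)"
  have "(g has_integral f b - f a) (cbox a b)"
    unfolding has_integral
  proof (intro allI impI)
    fix e :: real assume e: "0 < e"
    then obtain \<delta> where \<delta>: "0 < \<delta>" "\<And>d t. d division_of t \<Longrightarrow> t \<subseteq> {a..b} \<Longrightarrow> (\<Sum>I\<in>d. Sup I - Inf I) < \<delta> \<Longrightarrow>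
        (\<Sum>I\<in>d. cmod (f (Sup I) - f (Inf I))) < e / 2"
      using ac unfolding abs_continuous_on_interval_def by (metis half_gt_zero)
    have "N \<in> sets lebesgue" "emeasure lebesgue N = 0"
      using N(1) by (auto simp: negligible_iff_null_sets)
    then obtain T where T: "open T" "N \<subseteq> T" "emeasure lebesgue (T - N) < ennreal \<delta>"
      using sets_lebesgue_outer_open[of N \<delta>] \<delta>(1) by metis
    have Tm: "emeasure lebesgue T < ennreal \<delta>"
    proof -
      have Ts: "T \<in> sets lebesgue" using T(1) by (simp add: borel_open)
      have "emeasure lebesgue T \<le> emeasure lebesgue (T - N) + emeasure lebesgue N"
        using emeasure_subadditive[of "T - N" lebesgue N] T(2) Ts \<open>N \<in> sets lebesgue\<close>
        by (simp add: Un_absorb2)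
      then show ?thesis using T(3) \<open>emeasure lebesgue N = 0\<close> by simp
    qed
    \<comment> \<open>Chosen such that \<eta> (b - a) stays below e/2; the summand 1 covers the case
      a = b.\<close>
    define \<eta> where "\<eta> = e / (4 * (b - a + 1))"
    have \<eta>: "0 < \<eta>" using e ab by (simp add: \<eta>_def)
    have "\<exists>r>0. (x \<in> N \<longrightarrow> ball x r \<subseteq> T) \<and> (x \<in> {a..b} - N \<longrightarrow>
        (\<forall>y. \<bar>y - x\<bar> < r \<longrightarrow> cmod (f y - f x - (y - x) *\<^sub>R f' x) \<le> \<eta> * \<bar>y - x\<bar>))" for x
    proof (cases "x \<in> N")
      case True
      then show ?thesis using T(1,2) open_contains_ball by blast
    next
      case False
      show ?thesis
      proof (cases "x \<in> {a..b}")
        case True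
        then have "(f has_derivative (\<lambda>h. h *\<^sub>R f' x)) (at x)"
          using N(2) False by (simp add: has_vector_derivative_def)
        then obtain r where "0 < r" "\<forall>y. norm (y - x) < r \<longrightarrow> cmod (f y - f x - (y - x) *\<^sub>R f' x) \<le> \<eta> * norm (y - x)"
          using \<eta> unfolding has_derivative_at_alt by blast
        then show ?thesis using False by (intro exI[of _ r]) auto
      next
        case out: False
        then show ?thesis using False by (intro exI[of _ 1]) auto
      qed
    qed
    then obtain r where r: "\<And>x. 0 < r x" "\<And>x. x \<in> N \<Longrightarrow> ball x (r x) \<subseteq> T"
      "\<And>x y. x \<in> {a..b} - N \<Longrightarrow> \<bar>y - x\<bar> < r x \<Longrightarrow> cmod (f y - f x - (y - x) *\<^sub>R f' x) \<le> \<eta> * \<bar>y - x\<bar>"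
      by metis
    show "\<exists>\<gamma>. gauge \<gamma> \<and> (\<forall>D. D tagged_division_of cbox a b \<and> \<gamma> fine D \<longrightarrow>
            norm ((\<Sum>(x,k)\<in>D. measure lborel k *\<^sub>R g x) - (f b - f a)) < e)"
    proof (intro exI conjI allI impI)
      show "gauge (\<lambda>x. ball x (r x))" using r(1) by (simp add: gauge_def)
      fix D assume "D tagged_division_of cbox a b \<and> (\<lambda>x. ball x (r x)) fine D"
      then have D: "D tagged_division_of {a..b}" and fine: "(\<lambda>x. ball x (r x)) fine D" by auto
      have fin: "finite D" using D by blast
      have kD: "\<exists>u v. k = {u..v} \<and> u \<le> x \<and> x \<le> v \<and> a \<le> u \<and> v \<le> b \<and> {u..v} \<subseteq> ball x (r x)"
        if xk: "(x, k) \<in> D" for x k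
      proof -
        obtain u v where uv: "k = cbox u v" using tagged_division_ofD(4)[OF D xk] by blast
        have "x \<in> k" "k \<subseteq> {a..b}" using tagged_division_ofD(2,3)[OF D xk] by auto
        moreover have "k \<subseteq> ball x (r x)" using fine xk by (auto simp: fine_def)
        ultimately show ?thesis using uv by (intro exI[of _ u] exI[of _ v]) auto
      qed
      define D1 where "D1 = {(x, k) \<in> D. x \<in> N}"
      define D2 where "D2 = {(x, k) \<in> D. x \<notin> N}"
      have D12: "D = D1 \<union> D2" "D1 \<inter> D2 = {}" by (auto simp: D1_def D2_def)
      define F where "F = (\<lambda>k. f (Sup k) - f (Inf k))"
      have "(\<Sum>(x,k)\<in>D. F k) = f b - f a"
        unfolding F_def by (rule additive_tagged_division_1[OF ab D])
      then have "(\<Sum>(x,k)\<in>D. measure lborel k *\<^sub>R g x) - (f b - f a) = (\<Sum>(x,k)\<in>D. measure lborel k *\<^sub>R g x - F k)"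
        by (simp add: case_prod_unfold sum_subtractf)
      also have "\<dots> = (\<Sum>(x,k)\<in>D1. measure lborel k *\<^sub>R g x - F k) + (\<Sum>(x,k)\<in>D2. measure lborel k *\<^sub>R g x - F k)"
      proof -
        have "finite D1" "finite D2" using fin D12(1) by (auto intro: finite_subset)
        then show ?thesis unfolding D12(1) by (rule sum.union_disjoint[OF _ _ D12(2)])
      qed
      finally have eq: "(\<Sum>(x,k)\<in>D. measure lborel k *\<^sub>R g x) - (f b - f a) = \<dots>" .
      have "cmod (\<Sum>(x,k)\<in>D2. measure lborel k *\<^sub>R g x - F k) \<le> (\<Sum>(x,k)\<in>D2. \<eta> * measure lborel k)"
      proof (rule sum_norm_le, clarify)
        fix x k assume xk: "(x, k) \<in> D2"
        then have xD: "(x, k) \<in> D" "x \<notin> N" by (auto simp: D2_def)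
        obtain u v where k: "k = {u..v}" "u \<le> x" "x \<le> v" "a \<le> u" "v \<le> b" "{u..v} \<subseteq> ball x (r x)"
          using kD[OF xD(1)] by blast
        have uv: "u \<in> ball x (r x)" "v \<in> ball x (r x)" using k by (auto simp: subset_iff)
        have xab: "x \<in> {a..b} - N" using k xD by auto
        have 1: "cmod (f v - f x - (v - x) *\<^sub>R f' x) \<le> \<eta> * \<bar>v - x\<bar>"
          and 2: "cmod (f u - f x - (u - x) *\<^sub>R f' x) \<le> \<eta> * \<bar>u - x\<bar>"
          using r(3)[OF xab, of u] r(3)[OF xab, of v] uv by (auto simp: dist_real_def)
        have "measure lborel k *\<^sub>R g x - F k = (f u - f x - (u - x) *\<^sub>R f' x) - (f v - f x - (v - x) *\<^sub>R f' x)"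
          using k xD by (simp add: g_def F_def algebra_simps)
        then have "cmod (measure lborel k *\<^sub>R g x - F k) \<le> \<eta> * \<bar>u - x\<bar> + \<eta> * \<bar>v - x\<bar>"
          by (simp only:) (rule order_trans[OF norm_triangle_ineq4 add_mono[OF 2 1]])
        also have "\<dots> = \<eta> * measure lborel k" using k by (simp add: algebra_simps)
        finally show "cmod (measure lborel k *\<^sub>R g x - F k) \<le> \<eta> * measure lborel k" .
      qed
      also have "\<dots> \<le> (\<Sum>(x,k)\<in>D. \<eta> * measure lborel k)"
        using fin \<eta> D12(1) by (intro sum_mono2) auto
      also have "\<dots> = \<eta> * (\<Sum>(x,k)\<in>D. measure lborel k)"
        by (simp add: sum_distrib_left case_prod_unfold)
      also have "(\<Sum>(x,k)\<in>D. measure lborel k) = b - a"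
        using additive_content_tagged_division[of D a b] D ab by simp
      also have "\<eta> * (b - a) < e / 2"
        using mult_strict_left_mono[of "b - a" "2 * (b - a + 1)" e] e ab by (simp add: \<eta>_def field_simps)
      finally have b2: "cmod (\<Sum>(x,k)\<in>D2. measure lborel k *\<^sub>R g x - F k) < e / 2" .
      have D1p: "D1 tagged_partial_division_of {a..b}"
        using tagged_partial_division_subset[of D "{a..b}" D1] D D12 by (auto simp: tagged_division_of_def)
      define t where "t = \<Union>(snd ` D1)"
      have D1t: "D1 tagged_division_of t"
        unfolding t_def by (rule tagged_partial_division_of_Union_self[OF D1p])
      have div: "snd ` D1 division_of t" by (rule division_of_tagged_division[OF D1t])
      have tT: "t \<subseteq> T"
        unfolding t_def using kD r(2) by (fastforce simp: D1_def)
      have tab: "t \<subseteq> {a..b}"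
        unfolding t_def using kD by (fastforce simp: D1_def)
      have "(\<Sum>I\<in>snd ` D1. Sup I - Inf I) = (\<Sum>I\<in>snd ` D1. measure lebesgue I)"
      proof (rule sum.cong)
        fix I assume "I \<in> snd ` D1"
        then obtain x where "(x, I) \<in> D" by (auto simp: D1_def)
        from kD[OF this] obtain u v where "I = {u..v}" "u \<le> x" "x \<le> v" by blast
        then show "Sup I - Inf I = measure lebesgue I" by simp
      qed simp
      also have "\<dots> = measure lebesgue t" using content_division[OF div] by simp
      finally have sm: "(\<Sum>I\<in>snd ` D1. Sup I - Inf I) = measure lebesgue t" .
      have "ennreal (measure lebesgue t) \<le> emeasure lebesgue T"
      proof -
        have "t \<in> lmeasurable" using div lmeasurable_division by blast
        then have "ennreal (measure lebesgue t) = emeasure lebesgue t"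
          by (rule emeasure_eq_measure2[symmetric])
        also have "\<dots> \<le> emeasure lebesgue T" using tT T(1) by (intro emeasure_mono) (auto simp: borel_open)
        finally show ?thesis .
      qed
      then have "measure lebesgue t < \<delta>"
        using Tm \<delta>(1) by (metis ennreal_less_iff le_less_trans measure_nonneg)
      then have "(\<Sum>I\<in>snd ` D1. cmod (F I)) < e / 2"
        unfolding F_def using \<delta>(2)[OF div tab] sm by simp
      moreover have "(\<Sum>(x,k)\<in>D1. cmod (F k)) = (\<Sum>I\<in>snd ` D1. cmod (F I))"
      proof -
        \<comment> \<open>Absolute continuity sums over the set of intervals, the Riemann sum over
          tagged ones. The lemma that compares the two sums wants a function that vanishes on
          degenerate intervals, including the empty one, where \<open>Sup\<close> and
          \<open>Inf\<close> carry no information.\<close>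
        define F' where "F' = (\<lambda>k. if k = {} then 0 else cmod (F k))"
        have ne: "k \<noteq> {}" if "(x, k) \<in> D1" for x k
        proof -
          have "(x, k) \<in> D" using that by (simp add: D1_def)
          from kD[OF this] show ?thesis by auto
        qed
        have "(\<Sum>(x,k)\<in>D1. F' k) = (\<Sum>I\<in>snd ` D1. F' I)"
        proof (rule sum.over_tagged_division_lemma[OF D1t])
          fix u v :: real assume "box u v = {}"
          then consider "cbox u v = {}" | "u = v" by (fastforce simp: box_eq_empty)
          then show "F' (cbox u v) = 0" by cases (auto simp: F'_def F_def)
        qed
        moreover have "(\<Sum>(x,k)\<in>D1. F' k) = (\<Sum>(x,k)\<in>D1. cmod (F k))"
          by (rule sum.cong) (use ne in \<open>auto simp: F'_def\<close>)
        moreover have "(\<Sum>I\<in>snd ` D1. F' I) = (\<Sum>I\<in>snd ` D1. cmod (F I))"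
          by (rule sum.cong) (use ne in \<open>auto simp: F'_def\<close>)
        ultimately show ?thesis by simp
      qed
      moreover have "cmod (\<Sum>(x,k)\<in>D1. measure lborel k *\<^sub>R g x - F k) \<le> (\<Sum>(x,k)\<in>D1. cmod (F k))"
        by (rule sum_norm_le) (auto simp: D1_def g_def)
      ultimately have b1: "cmod (\<Sum>(x,k)\<in>D1. measure lborel k *\<^sub>R g x - F k) < e / 2" by simp
      show "norm ((\<Sum>(x,k)\<in>D. measure lborel k *\<^sub>R g x) - (f b - f a)) < e"
        unfolding eq using b1 b2 norm_triangle_ineq by (smt (verit) field_sum_of_halves)
    qed
  qed
  then have "(g has_integral f b - f a) {a..b}" by simp
  then show ?thesis
    by (rule has_integral_spike[OF N(1), rotated]) (auto simp: g_def)
qed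

lemma abs_continuous_subinterval:
  assumes "abs_continuous_on_interval f a b" "a \<le> c" "d \<le> b"
  shows "abs_continuous_on_interval f c d"
  unfolding abs_continuous_on_interval_def
proof (intro allI impI)
  fix \<epsilon> :: real assume "0 < \<epsilon>"
  moreover have "{c..d} \<subseteq> {a..b}" using assms by auto
  ultimately show "\<exists>\<delta>>0. \<forall>D t. D division_of t \<and> t \<subseteq> {c..d} \<and> (\<Sum>I\<in>D. Sup I - Inf I) < \<delta> \<longrightarrow>
        (\<Sum>I\<in>D. cmod (f (Sup I) - f (Inf I))) < \<epsilon>"
    using assms(1) unfolding abs_continuous_on_interval_def by (meson order_trans)
qed

lemma abs_continuous_lipschitz_compose:
  fixes \<Psi> :: "complex \<Rightarrow> real"
  assumes ac: "abs_continuous_on_interval f a b" and L: "0 < L" "\<And>w w'. \<bar>\<Psi> w - \<Psi> w'\<bar> \<le> L * cmod (w - w')"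
  shows "abs_continuous_on_interval (\<lambda>x. of_real (\<Psi> (f x))) a b"
  unfolding abs_continuous_on_interval_def
proof (intro allI impI)
  fix \<epsilon> :: real assume e: "0 < \<epsilon>"
  then obtain \<delta> where \<delta>: "0 < \<delta>" "\<And>D t. D division_of t \<Longrightarrow> t \<subseteq> {a..b} \<Longrightarrow> (\<Sum>I\<in>D. Sup I - Inf I) < \<delta> \<Longrightarrow>
        (\<Sum>I\<in>D. cmod (f (Sup I) - f (Inf I))) < \<epsilon> / L"
    using ac L(1) unfolding abs_continuous_on_interval_def by (metis divide_pos_pos)
  show "\<exists>\<delta>>0. \<forall>D t. D division_of t \<and> t \<subseteq> {a..b} \<and> (\<Sum>I\<in>D. Sup I - Inf I) < \<delta> \<longrightarrow>
        (\<Sum>I\<in>D. cmod (complex_of_real (\<Psi> (f (Sup I))) - complex_of_real (\<Psi> (f (Inf I))))) < \<epsilon>"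
  proof (intro exI conjI allI impI)
    fix D t assume *: "D division_of t \<and> t \<subseteq> {a..b} \<and> (\<Sum>I\<in>D. Sup I - Inf I) < \<delta>"
    have "(\<Sum>I\<in>D. cmod (complex_of_real (\<Psi> (f (Sup I))) - complex_of_real (\<Psi> (f (Inf I)))))
        \<le> (\<Sum>I\<in>D. L * cmod (f (Sup I) - f (Inf I)))"
    proof (rule sum_mono)
      fix I
      have "cmod (complex_of_real (\<Psi> (f (Sup I))) - complex_of_real (\<Psi> (f (Inf I)))) = \<bar>\<Psi> (f (Sup I)) - \<Psi> (f (Inf I))\<bar>"
        by (metis norm_of_real of_real_diff)
      then show "cmod (complex_of_real (\<Psi> (f (Sup I))) - complex_of_real (\<Psi> (f (Inf I)))) \<le> L * cmod (f (Sup I) - f (Inf I))"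
        using L(2) by simp
    qed
    also have "\<dots> = L * (\<Sum>I\<in>D. cmod (f (Sup I) - f (Inf I)))" by (simp add: sum_distrib_left)
    also have "\<dots> < \<epsilon>" using \<delta>(2)[of D t] * L(1) by (simp add: field_simps)
    finally show "(\<Sum>I\<in>D. cmod (complex_of_real (\<Psi> (f (Sup I))) - complex_of_real (\<Psi> (f (Inf I))))) < \<epsilon>" .
  qed (rule \<delta>(1))
qed

text \<open>The Lipschitz constant \<open>L\<close> makes the composite with \<open>\<gamma>\<close>
  absolutely continuous, and its derivative is at most g |\<gamma>'|. If the integral is infinite
  there is nothing to show; otherwise it provides an integrable majorant.\<close>

lemma oscillation_along_line:
  fixes \<Psi> :: "complex \<Rightarrow> real" and \<gamma> \<gamma>' :: "real \<Rightarrow> complex"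
  assumes ac: "abs_continuous_on_interval \<gamma> u v"
    and der: "AE x in lborel. x \<in> {u..v} \<longrightarrow> (\<gamma> has_vector_derivative \<gamma>' x) (at x)"
    and \<Psi>: "\<And>w. (\<Psi> has_derivative D\<Psi> w) (at w)" "\<And>w h. \<bar>D\<Psi> w h\<bar> \<le> g w * cmod h" "\<And>w. g w \<le> L"
    and L: "0 < L" and g0: "\<And>w. 0 \<le> g w"
    and meas: "(\<lambda>x. ennreal (g (\<gamma> x) * cmod (\<gamma>' x)) * indicator {u..v} x) \<in> borel_measurable borel"
    and x: "x1 \<in> {u..v}" "x2 \<in> {u..v}"
  shows "ennreal \<bar>\<Psi> (\<gamma> x2) - \<Psi> (\<gamma> x1)\<bar> \<le> (\<integral>\<^sup>+x. ennreal (g (\<gamma> x) * cmod (\<gamma>' x)) * indicator {u..v} x \<partial>lborel)"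
  using x
proof (induction x1 x2 rule: linorder_wlog)
  case (sym a b)
  then show ?case by (simp add: abs_minus_commute)
next
  case (le x1 x2)
  let ?I = "\<integral>\<^sup>+x. ennreal (g (\<gamma> x) * cmod (\<gamma>' x)) * indicator {u..v} x \<partial>lborel"
  show ?case
  proof (cases "?I = \<infinity>")
    case False
    have lip: "\<bar>\<Psi> w - \<Psi> w'\<bar> \<le> L * cmod (w - w')" for w w'
    proof -
      have "norm (\<Psi> w - \<Psi> w') \<le> L * norm (w - w')"
      proof (rule differentiable_bound[where S = UNIV])
        show "onorm (D\<Psi> x) \<le> L" for x
        proof (rule onorm_le)
          fix h show "norm (D\<Psi> x h) \<le> L * norm h"
            using \<Psi>(2)[of x h] \<Psi>(3)[of x] by (simp add: order_trans[OF _ mult_right_mono])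
        qed
      qed (use \<Psi>(1) in auto)
      then show ?thesis by simp
    qed
    define G where "G = (\<lambda>x. complex_of_real (\<Psi> (\<gamma> x)))"
    define G' where "G' = (\<lambda>x. complex_of_real (D\<Psi> (\<gamma> x) (\<gamma>' x)))"
    define B where "B = (\<lambda>x. g (\<gamma> x) * cmod (\<gamma>' x) * indicator {u..v} x)"
    have B0: "0 \<le> B x" for x using g0 by (simp add: B_def)
    have Beq: "ennreal (B x) = ennreal (g (\<gamma> x) * cmod (\<gamma>' x)) * indicator {u..v} x" for x
      by (simp add: B_def indicator_def)
    have ac': "abs_continuous_on_interval G x1 x2"
      unfolding G_def using le
      by (intro abs_continuous_subinterval[OF abs_continuous_lipschitz_compose[OF ac L lip]]) auto
    have "AE x in lborel. x \<in> {x1..x2} \<longrightarrow> (G has_vector_derivative G' x) (at x)"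
      using der
    proof eventually_elim
      case (elim x)
      show ?case
      proof
        assume "x \<in> {x1..x2}"
        then have "(\<gamma> has_derivative (\<lambda>h. h *\<^sub>R \<gamma>' x)) (at x)"
          using elim le by (auto simp: has_vector_derivative_def)
        from has_derivative_compose[OF this \<Psi>(1)]
        have "((\<lambda>x. \<Psi> (\<gamma> x)) has_derivative (\<lambda>h. D\<Psi> (\<gamma> x) (h *\<^sub>R \<gamma>' x))) (at x)" .
        moreover have "D\<Psi> (\<gamma> x) (h *\<^sub>R \<gamma>' x) = h * D\<Psi> (\<gamma> x) (\<gamma>' x)" for h
          using linear_scale[OF has_derivative_linear[OF \<Psi>(1)]] by simp
        ultimately have "((\<lambda>x. \<Psi> (\<gamma> x)) has_vector_derivative D\<Psi> (\<gamma> x) (\<gamma>' x)) (at x)"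
          by (simp add: has_vector_derivative_def)
        then show "(G has_vector_derivative G' x) (at x)"
          unfolding G_def G'_def by (rule bounded_linear.has_vector_derivative[OF bounded_linear_of_real])
      qed
    qed
    then have int: "(G' has_integral G x2 - G x1) {x1..x2}"
      by (intro abs_continuous_fundamental_theorem le(1) ac')
    have mB: "(\<lambda>x. ennreal (B x)) \<in> borel_measurable borel" unfolding Beq by (rule meas)
    then have mB': "B \<in> borel_measurable borel"
      using borel_measurable_enn2real[OF mB] B0 by simp
    have fin: "(\<integral>\<^sup>+x. ennreal (B x) \<partial>lborel) = ennreal (enn2real ?I)"
      using False by (simp add: Beq less_top)
    have intB: "(B has_integral enn2real ?I) UNIV"
      by (rule nn_integral_has_integral[OF _ B0 fin]) (use mB' in auto)
    then have "B integrable_on {x1..x2}"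
      by (metis B0 atLeastAtMost_borel has_integral_integrable integrable_on_subcbox box_real(2) subset_UNIV)
    have "cmod (G x2 - G x1) = norm (integral {x1..x2} G')" using int by (simp add: integral_unique)
    also have "\<dots> \<le> integral {x1..x2} B"
    proof (rule integral_norm_bound_integral)
      show "G' integrable_on {x1..x2}" using int by blast
      show "norm (G' x) \<le> B x" if "x \<in> {x1..x2}" for x
        using \<Psi>(2) that le by (simp add: G'_def B_def)
    qed fact
    also have "\<dots> \<le> integral UNIV B"
      using intB \<open>B integrable_on {x1..x2}\<close> B0 by (intro integral_subset_le) auto
    also have "\<dots> = enn2real ?I" using intB by (rule integral_unique)
    finally have "\<bar>\<Psi> (\<gamma> x2) - \<Psi> (\<gamma> x1)\<bar> \<le> enn2real ?I"
      unfolding G_def by (metis norm_of_real of_real_diff)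
    then have "ennreal \<bar>\<Psi> (\<gamma> x2) - \<Psi> (\<gamma> x1)\<bar> \<le> ennreal (enn2real ?I)" by (rule ennreal_leI)
    also have "ennreal (enn2real ?I) = ?I"
      by (rule ennreal_enn2real) (use False in \<open>simp add: less_top\<close>)
    finally show ?thesis .
  qed simp
qed

section \<open>Partial derivatives and the area inequality for quasiconformal maps\<close>

locale qc_map =
  fixes F :: "complex \<Rightarrow> complex" and \<Omega> :: "complex set" and k :: real
  assumes open_\<Omega>: "open \<Omega>" and cont: "continuous_on \<Omega> F" and inj: "inj_on F \<Omega>"
    and acl: "ACL_on F \<Omega>" and k: "0 \<le> k" "k < 1"
    and qc: "AE z in lebesgue. z \<in> \<Omega> \<longrightarrow>
          (\<exists>a b. ((\<lambda>s. F (z + of_real s)) has_vector_derivative a) (at 0) \<and>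
                 ((\<lambda>s. F (z + \<i> * of_real s)) has_vector_derivative b) (at 0) \<and>
                 cmod ((a + \<i> * b) / 2) \<le> k * cmod ((a - \<i> * b) / 2))"
begin

text \<open>Extension by 0 makes the difference quotients Borel functions on the whole plane. As
  \<open>\<Omega>\<close> is open, sufficiently small steps at a point of it see only
  \<open>F\<close>.\<close>

definition F0 :: "complex \<Rightarrow> complex" where
  "F0 z = (if z \<in> \<Omega> then F z else 0)"

definition dquo :: "complex \<Rightarrow> real \<Rightarrow> complex \<Rightarrow> complex" where
  "dquo e s z = (F0 (z + of_real s * e) - F0 z) / of_real s"

text \<open>A limit along one sequence of steps is Borel. Where the sequence diverges the value is
  arbitrary; \<open>partial_eq\<close> identifies it where the full limit exists.\<close>

definition partial :: "complex \<Rightarrow> complex \<Rightarrow> complex" where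
  "partial e z = lim (\<lambda>n. dquo e (1 / real (Suc n)) z)"

definition jac :: "complex \<Rightarrow> real" where
  "jac z = Im (cnj (partial 1 z) * partial \<i> z)"

lemma measurable_F0 [measurable]: "F0 \<in> borel_measurable borel"
  unfolding F0_def[abs_def]
  by (rule borel_measurable_continuous_on_if) (use open_\<Omega> cont in \<open>auto simp: borel_open\<close>)

lemma measurable_dquo [measurable]: "dquo e s \<in> borel_measurable borel"
  unfolding dquo_def[abs_def] by measurable

lemma measurable_partial [measurable]: "partial e \<in> borel_measurable borel"
  unfolding partial_def[abs_def] by (rule borel_measurable_lim_metric) measurable

lemma measurable_jac [measurable]: "jac \<in> borel_measurable borel"
proof -
  have "(\<lambda>z. cnj (partial 1 z) * partial \<i> z) \<in> borel_measurable borel"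
    by (intro borel_measurable_times measurable_partial measurable_compose[OF measurable_partial]
        borel_measurable_continuous_onI continuous_intros)
  then show ?thesis unfolding jac_def[abs_def] by (rule measurable_compose) simp
qed

lemma dquo_tendsto:
  assumes z: "z \<in> \<Omega>" and d: "((\<lambda>s. F (z + of_real s * e)) has_vector_derivative a) (at 0)"
  shows "((\<lambda>s. dquo e s z) \<longlongrightarrow> a) (at 0)"
proof -
  have "((\<lambda>s. norm (F (z + of_real s * e) - F z - s *\<^sub>R a) / norm s) \<longlongrightarrow> 0) (at 0)"
    using d unfolding has_vector_derivative_def has_derivative_at by simp
  moreover have "eventually (\<lambda>s::real. z + of_real s * e \<in> \<Omega>) (at 0)"
  proof (rule topological_tendstoD[OF _ open_\<Omega>])
    have "((\<lambda>s. z + of_real s * e) \<longlongrightarrow> z + of_real 0 * e) (at 0)" by (intro tendsto_intros)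
    then show "((\<lambda>s. z + of_real s * e) \<longlongrightarrow> z) (at 0)" by simp
  qed (rule z)
  then have "eventually (\<lambda>s. norm (F (z + of_real s * e) - F z - s *\<^sub>R a) / norm s = norm (dquo e s z - a)) (at 0)"
    using eventually_neq_at_within[of 0 0 UNIV]
  proof eventually_elim
    case (elim s)
    then have "dquo e s z - a = (F (z + of_real s * e) - F z - s *\<^sub>R a) / of_real s"
      using z by (simp add: dquo_def F0_def scaleR_conv_of_real diff_divide_distrib)
    then show ?case by (simp add: norm_divide)
  qed
  ultimately have "((\<lambda>s. norm (dquo e s z - a)) \<longlongrightarrow> 0) (at 0)"
    by (rule Lim_transform_eventually)
  then show ?thesis using Lim_null tendsto_norm_zero_iff by metis
qed

lemma partial_eq: "((\<lambda>s. dquo e s z) \<longlongrightarrow> a) (at 0) \<Longrightarrow> partial e z = a"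
  unfolding partial_def
proof (rule limI)
  assume *: "((\<lambda>s. dquo e s z) \<longlongrightarrow> a) (at 0)"
  have "filterlim (\<lambda>n. 1 / real (Suc n)) (at 0) sequentially"
    unfolding filterlim_at using LIMSEQ_inverse_real_of_nat by (simp add: inverse_eq_divide)
  then show "(\<lambda>n. dquo e (1 / real (Suc n)) z) \<longlonglongrightarrow> a"
    by (rule filterlim_compose[OF *])
qed

text \<open>Let \<open>p\<close> and \<open>q\<close> be F_z and F_zbar. Both partial derivatives
  are at most (1 + k) |p|, and the Jacobian |p|^2 - |q|^2 is at least (1 - k^2) |p|^2. The constant
  is (1 + k)^2 / (1 - k^2).\<close>

lemma AE_partials:
  "AE z in lborel. z \<in> \<Omega> \<longrightarrow>
     ((\<lambda>s. F (z + of_real s * 1)) has_vector_derivative partial 1 z) (at 0) \<and>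
     ((\<lambda>s. F (z + of_real s * \<i>)) has_vector_derivative partial \<i> z) (at 0) \<and>
     (cmod (partial 1 z))\<^sup>2 \<le> (1 + k) / (1 - k) * jac z \<and> (cmod (partial \<i> z))\<^sup>2 \<le> (1 + k) / (1 - k) * jac z"
proof -
  have "AE z in lborel. z \<in> \<Omega> \<longrightarrow>
          (\<exists>a b. ((\<lambda>s. F (z + of_real s)) has_vector_derivative a) (at 0) \<and>
                 ((\<lambda>s. F (z + \<i> * of_real s)) has_vector_derivative b) (at 0) \<and>
                 cmod ((a + \<i> * b) / 2) \<le> k * cmod ((a - \<i> * b) / 2))"
    using qc by (simp add: AE_completion_iff)
  then show ?thesis
  proof eventually_elim
    case (elim z)
    show ?case
    proof
      assume z: "z \<in> \<Omega>"
      then obtain a b where a: "((\<lambda>s. F (z + of_real s * 1)) has_vector_derivative a) (at 0)"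
        and b: "((\<lambda>s. F (z + of_real s * \<i>)) has_vector_derivative b) (at 0)"
        and ab: "cmod ((a + \<i> * b) / 2) \<le> k * cmod ((a - \<i> * b) / 2)"
        using elim by (auto simp: mult.commute)
      have pa: "partial 1 z = a" and pb: "partial \<i> z = b"
        using partial_eq dquo_tendsto[OF z a] dquo_tendsto[OF z b] by auto
      define p where "p = (a - \<i> * b) / 2"
      define q where "q = (a + \<i> * b) / 2"
      have aq: "a = p + q" and bq: "b = \<i> * (p - q)" by (simp_all add: p_def q_def field_simps)
      have J: "jac z = (cmod p)\<^sup>2 - (cmod q)\<^sup>2"
        unfolding jac_def pa pb aq bq cmod_power2 by (simp add: algebra_simps power2_eq_square)
      have qk: "cmod q \<le> k * cmod p" using ab by (simp add: p_def q_def)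
      then have "(cmod q)\<^sup>2 \<le> (k * cmod p)\<^sup>2" by (intro power_mono) auto
      then have J1: "(1 - k\<^sup>2) * (cmod p)\<^sup>2 \<le> jac z" unfolding J by (simp add: power_mult_distrib algebra_simps)
      have "(1 + k)\<^sup>2 * (cmod p)\<^sup>2 = (1 + k) / (1 - k) * ((1 - k\<^sup>2) * (cmod p)\<^sup>2)"
        using k by (simp add: field_simps power2_eq_square)
      also have "\<dots> \<le> (1 + k) / (1 - k) * jac z" using J1 k by (intro mult_left_mono) auto
      finally have K: "((1 + k) * cmod p)\<^sup>2 \<le> (1 + k) / (1 - k) * jac z" by (simp add: power_mult_distrib)
      have "cmod a \<le> (1 + k) * cmod p" "cmod b \<le> (1 + k) * cmod p"
      proof -
        have "cmod a = cmod (p + q)" "cmod b = cmod (p - q)"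
          unfolding aq bq norm_mult by simp_all
        then show "cmod a \<le> (1 + k) * cmod p" "cmod b \<le> (1 + k) * cmod p"
          using norm_triangle_ineq[of p q] norm_triangle_ineq4[of p q] qk by (simp_all add: distrib_right)
      qed
      then have "(cmod a)\<^sup>2 \<le> ((1 + k) * cmod p)\<^sup>2" "(cmod b)\<^sup>2 \<le> ((1 + k) * cmod p)\<^sup>2"
        by (auto intro!: power_mono)
      then show "((\<lambda>s. F (z + of_real s * 1)) has_vector_derivative partial 1 z) (at 0) \<and>
         ((\<lambda>s. F (z + of_real s * \<i>)) has_vector_derivative partial \<i> z) (at 0) \<and>
         (cmod (partial 1 z))\<^sup>2 \<le> (1 + k) / (1 - k) * jac z \<and> (cmod (partial \<i> z))\<^sup>2 \<le> (1 + k) / (1 - k) * jac z"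
        using a b K unfolding pa pb by auto
    qed
  qed
qed

text \<open>On a set where both difference quotients converge uniformly, \<^term>\<open>F\<close> is differentiable relative
  to the set: two points of the set are joined by an L-shaped path whose corner need not belong to it.\<close>

lemma has_derivative_within_uniform_set:
  assumes S: "S \<subseteq> Q" and z: "z \<in> S" and r0: "0 < r0"
    and Q: "\<And>w s e. w \<in> Q \<Longrightarrow> \<bar>s\<bar> \<le> r0 \<Longrightarrow> e \<in> {1, \<i>} \<Longrightarrow> w + of_real s * e \<in> \<Omega>"
    and unif: "\<And>\<epsilon>. 0 < \<epsilon> \<Longrightarrow> \<exists>\<rho>>0. \<rho> \<le> r0 \<and> (\<forall>w\<in>S. \<forall>e\<in>{1, \<i>}. \<forall>s s'. 0 < \<bar>s\<bar> \<and> \<bar>s\<bar> \<le> \<rho> \<and> 0 < \<bar>s'\<bar> \<and> \<bar>s'\<bar> \<le> \<rho>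
        \<longrightarrow> cmod (dquo e s w - dquo e s' w) \<le> \<epsilon>)"
  shows "(F has_derivative (\<lambda>h. of_real (Re h) * partial 1 z + of_real (Im h) * partial \<i> z)) (at z within S)"
proof -
  have Q0: "w \<in> \<Omega>" if "w \<in> Q" for w using Q[OF that, of 0 1] r0 by simp
  have close: "cmod (dquo e s w - partial e w) \<le> \<epsilon>"
    if "0 < \<epsilon>" "w \<in> S" "e \<in> {1, \<i>}" "0 < \<bar>s\<bar>" "\<bar>s\<bar> \<le> \<rho>"
      and \<rho>: "0 < \<rho>" "\<forall>w\<in>S. \<forall>e\<in>{1, \<i>}. \<forall>s s'. 0 < \<bar>s\<bar> \<and> \<bar>s\<bar> \<le> \<rho> \<and> 0 < \<bar>s'\<bar> \<and> \<bar>s'\<bar> \<le> \<rho>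
        \<longrightarrow> cmod (dquo e s w - dquo e s' w) \<le> \<epsilon>" for \<epsilon> w e s \<rho>
  proof -
    \<comment> \<open>\<open>partial\<close> is defined by \<open>lim\<close>, so convergence has to
      be established first; then \<open>s'\<close> is sent to 0 in the uniform estimate.\<close>
    define x where "x n = dquo e (1 / real (Suc n)) w" for n
    have ev: "eventually (\<lambda>n. 1 / real (Suc n) \<le> \<rho>') sequentially" if "0 < \<rho>'" for \<rho>'
      using order_tendstoD(2)[OF LIMSEQ_inverse_real_of_nat that]
      by eventually_elim (simp add: inverse_eq_divide)
    have "Cauchy x"
      unfolding Cauchy_def
    proof (intro allI impI)
      fix e' :: real assume e': "0 < e'"
      obtain \<rho>' where \<rho>': "\<rho>' > 0" "\<forall>w\<in>S. \<forall>e\<in>{1, \<i>}. \<forall>s s'. 0 < \<bar>s\<bar> \<and> \<bar>s\<bar> \<le> \<rho>' \<and> 0 < \<bar>s'\<bar> \<and> \<bar>s'\<bar> \<le> \<rho>'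
        \<longrightarrow> cmod (dquo e s w - dquo e s' w) \<le> e'/2" using unif[of "e'/2"] e' by auto
      obtain M where M: "\<And>n. M \<le> n \<Longrightarrow> 1 / real (Suc n) \<le> \<rho>'"
        using ev[OF \<rho>'(1)] unfolding eventually_sequentially by blast
      have "dist (x m) (x n) < e'" if "M \<le> m" "M \<le> n" for m n
      proof -
        have "cmod (x m - x n) \<le> e'/2"
          unfolding x_def using \<rho>'(2) \<open>w \<in> S\<close> \<open>e \<in> {1, \<i>}\<close> M[OF that(1)] M[OF that(2)] by auto
        then show ?thesis using e' by (simp add: dist_norm)
      qed
      then show "\<exists>M. \<forall>m\<ge>M. \<forall>n\<ge>M. dist (x m) (x n) < e'" by blast
    qed
    then have "convergent x" by (rule Cauchy_convergent)
    then have "x \<longlonglongrightarrow> partial e w"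
      unfolding partial_def x_def[abs_def, symmetric] by (simp add: convergent_LIMSEQ_iff)
    then have "(\<lambda>n. cmod (dquo e s w - x n)) \<longlonglongrightarrow> cmod (dquo e s w - partial e w)"
      by (intro tendsto_intros)
    moreover have "eventually (\<lambda>n. cmod (dquo e s w - x n) \<le> \<epsilon>) sequentially"
      using ev[OF \<rho>(1)] by eventually_elim (use \<rho>(2) that in \<open>auto simp: x_def\<close>)
    ultimately show ?thesis by (intro tendsto_upperbound) auto
  qed
  show ?thesis
    unfolding has_derivative_within_alt
  proof (intro conjI allI impI)
    show "bounded_linear (\<lambda>h. of_real (Re h) * partial 1 z + of_real (Im h) * partial \<i> z)"
      by (intro bounded_linear_add bounded_linear_mult_left[THEN bounded_linear_compose]
          bounded_linear_compose[OF bounded_linear_of_real] bounded_linear_Re bounded_linear_Im)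
    fix \<epsilon> :: real assume e: "0 < \<epsilon>"
    \<comment> \<open>One share for each leg of the path, and three for replacing
      \<open>partial \<i> y\<close> by \<open>partial \<i> z\<close>.\<close>
    define \<epsilon>' where "\<epsilon>' = \<epsilon> / 5"
    have e': "0 < \<epsilon>'" using e by (simp add: \<epsilon>'_def)
    obtain \<rho> where \<rho>: "0 < \<rho>" "\<rho> \<le> r0" "\<forall>w\<in>S. \<forall>e\<in>{1, \<i>}. \<forall>s s'. 0 < \<bar>s\<bar> \<and> \<bar>s\<bar> \<le> \<rho> \<and> 0 < \<bar>s'\<bar> \<and> \<bar>s'\<bar> \<le> \<rho>
        \<longrightarrow> cmod (dquo e s w - dquo e s' w) \<le> \<epsilon>'" using unif[OF e'] by blast
    \<comment> \<open>The difference quotient of a fixed step is continuous and uniformly close to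
      the partial derivative on \<open>S\<close>, so the latter varies little on \<open>S\<close>
      near \<open>z\<close>.\<close>
    have cq: "isCont (dquo \<i> \<rho>) z"
    proof -
      have "isCont F0 w" if "w \<in> \<Omega>" for w
      proof -
        have "isCont F w" using cont open_\<Omega> that by (simp add: continuous_on_eq_continuous_at)
        moreover have "eventually (\<lambda>x. F x = F0 x) (nhds w)"
          using eventually_nhds_in_open[OF open_\<Omega> that] by eventually_elim (simp add: F0_def)
        ultimately show ?thesis using isCont_cong by blast
      qed
      then have "isCont F0 z" "isCont F0 (z + of_real \<rho> * \<i>)"
        using Q[of z \<rho> \<i>] Q0[of z] S z \<rho> by auto
      then have "isCont (\<lambda>z. F0 (z + of_real \<rho> * \<i>)) z" "isCont F0 z"
        by (auto intro!: isCont_o2[of z "\<lambda>z. z + of_real \<rho> * \<i>" F0] continuous_intros)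
      then show ?thesis unfolding dquo_def[abs_def] using \<rho>(1) by (intro continuous_intros) auto
    qed
    then obtain d where d: "0 < d" "\<And>y. cmod (y - z) < d \<Longrightarrow> cmod (dquo \<i> \<rho> y - dquo \<i> \<rho> z) < \<epsilon>'"
      using e' unfolding continuous_at_eps_delta dist_norm by blast
    show "\<exists>d>0. \<forall>y\<in>S. norm (y - z) < d \<longrightarrow>
        norm (F y - F z - (of_real (Re (y - z)) * partial 1 z + of_real (Im (y - z)) * partial \<i> z)) \<le> \<epsilon> * norm (y - z)"
    proof (intro exI conjI ballI impI)
      show "0 < min d \<rho>" using d \<rho> by simp
      fix y assume y: "y \<in> S" "norm (y - z) < min d \<rho>"
      define \<xi> where "\<xi> = Re (y - z)"
      define \<eta> where "\<eta> = Im (y - z)"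
      have le: "\<bar>\<xi>\<bar> \<le> cmod (y - z)" "\<bar>\<eta>\<bar> \<le> cmod (y - z)"
        unfolding \<xi>_def \<eta>_def by (rule abs_Re_le_cmod, rule abs_Im_le_cmod)
      have xe: "\<bar>\<xi>\<bar> \<le> \<rho>" "\<bar>\<eta>\<bar> \<le> \<rho>" using le y by auto
      \<comment> \<open>The corner is reached horizontally from \<open>z\<close> and vertically from
        \<open>y\<close>, so each leg uses a difference quotient based at a point of
        \<open>S\<close>.\<close>
      define c where "c = z + of_real \<xi> * 1"
      have c': "c = y + of_real (-\<eta>) * \<i>"
        by (simp add: c_def \<xi>_def \<eta>_def complex_eq_iff)
      have om: "c \<in> \<Omega>" "y \<in> \<Omega>" "z \<in> \<Omega>"
        using Q[of z \<xi> 1] Q0 S z y xe \<rho> by (auto simp: c_def)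
      have A: "cmod (F c - F z - of_real \<xi> * partial 1 z) \<le> \<bar>\<xi>\<bar> * \<epsilon>'"
      proof (cases "\<xi> = 0")
        case False
        have "cmod (dquo 1 \<xi> z - partial 1 z) \<le> \<epsilon>'"
          by (rule close[OF e' z _ _ xe(1) \<rho>(1,3)]) (use False in auto)
        moreover have "of_real \<xi> * dquo 1 \<xi> z = F c - F z"
          using False om by (simp add: dquo_def F0_def c_def)
        then have "F c - F z - of_real \<xi> * partial 1 z = of_real \<xi> * (dquo 1 \<xi> z - partial 1 z)"
          by (simp add: right_diff_distrib)
        ultimately show ?thesis by (simp add: norm_mult mult_left_mono)
      qed (simp add: c_def)
      have dp: "cmod (partial \<i> y - partial \<i> z) \<le> 3 * \<epsilon>'"
      proof -
        have 1: "cmod (dquo \<i> \<rho> y - partial \<i> y) \<le> \<epsilon>'" "cmod (dquo \<i> \<rho> z - partial \<i> z) \<le> \<epsilon>'"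
          using close[OF e' _ _ _ _ \<rho>(1,3), of _ \<i> \<rho>] y z \<rho>(1) by auto
        have 2: "cmod (dquo \<i> \<rho> y - dquo \<i> \<rho> z) \<le> \<epsilon>'" using d(2)[of y] y by simp
        have "partial \<i> y - partial \<i> z = (dquo \<i> \<rho> y - dquo \<i> \<rho> z) - (dquo \<i> \<rho> y - partial \<i> y) + (dquo \<i> \<rho> z - partial \<i> z)"
          by simp
        also have "cmod \<dots> \<le> \<epsilon>' + \<epsilon>' + \<epsilon>'"
          by (rule norm_triangle_le[OF add_mono[OF order_trans[OF norm_triangle_ineq4 add_mono[OF 2 1(1)]] 1(2)]])
        finally show ?thesis by simp
      qed
      have B: "cmod (F y - F c - of_real \<eta> * partial \<i> y) \<le> \<bar>\<eta>\<bar> * \<epsilon>'"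
      proof (cases "\<eta> = 0")
        case False
        have "cmod (dquo \<i> (-\<eta>) y - partial \<i> y) \<le> \<epsilon>'"
          by (rule close[OF e' y(1) _ _ _ \<rho>(1,3)]) (use False xe in auto)
        moreover have "F y - F c - of_real \<eta> * partial \<i> y = of_real \<eta> * (dquo \<i> (-\<eta>) y - partial \<i> y)"
          using False om unfolding dquo_def c'[symmetric] F0_def by (simp add: field_simps)
        ultimately show ?thesis by (simp add: norm_mult mult_left_mono)
      qed (use c' in simp)
      have C: "cmod (of_real \<eta> * (partial \<i> y - partial \<i> z)) \<le> \<bar>\<eta>\<bar> * (3 * \<epsilon>')"
        using dp by (simp add: norm_mult mult_left_mono)
      have "F y - F z - (of_real \<xi> * partial 1 z + of_real \<eta> * partial \<i> z)
          = (F c - F z - of_real \<xi> * partial 1 z) + (F y - F c - of_real \<eta> * partial \<i> y) + of_real \<eta> * (partial \<i> y - partial \<i> z)"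
        by (simp add: algebra_simps)
      also have "cmod \<dots> \<le> \<bar>\<xi>\<bar> * \<epsilon>' + \<bar>\<eta>\<bar> * \<epsilon>' + \<bar>\<eta>\<bar> * (3 * \<epsilon>')"
        by (rule norm_triangle_le[OF add_mono[OF order_trans[OF norm_triangle_ineq add_mono[OF A B]] C]])
      also have "\<dots> \<le> cmod (y - z) * \<epsilon>' + cmod (y - z) * \<epsilon>' + cmod (y - z) * (3 * \<epsilon>')"
        using le e' by (intro add_mono mult_right_mono) auto
      also have "\<dots> = \<epsilon> * cmod (y - z)" by (simp add: \<epsilon>'_def)
      finally show "norm (F y - F z - (of_real (Re (y - z)) * partial 1 z + of_real (Im (y - z)) * partial \<i> z)) \<le> \<epsilon> * norm (y - z)"
        by (simp add: \<xi>_def \<eta>_def)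
    qed
  qed
qed


text \<open>Egorov's argument. On \<open>G j n\<close> all difference quotients with steps up to
  \<open>rad n\<close> agree within 1/(j + 1); the set is closed since each quotient is continuous
  on \<open>Q\<close>. For each \<open>j\<close> an index is chosen that loses at most measure
  2^(-m) 2^(-j), and the intersection over \<open>j\<close> is \<open>S m\<close>.\<close>

lemma exhausting_uniform_sets:
  assumes Q: "compact Q" and r0: "0 < r0"
    and Q\<Omega>: "\<And>w s e. w \<in> Q \<Longrightarrow> \<bar>s\<bar> \<le> r0 \<Longrightarrow> e \<in> {1, \<i>} \<Longrightarrow> w + of_real s * e \<in> \<Omega>"
  obtains S :: "nat \<Rightarrow> complex set" where "incseq S" "\<And>m. compact (S m)" "\<And>m. S m \<subseteq> Q"
    "AE z in lborel. z \<in> Q \<longrightarrow> (\<exists>m. z \<in> S m)"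
    "\<And>m \<epsilon>. 0 < \<epsilon> \<Longrightarrow> \<exists>\<rho>>0. \<rho> \<le> r0 \<and> (\<forall>w\<in>S m. \<forall>e\<in>{1, \<i>}. \<forall>s s'. 0 < \<bar>s\<bar> \<and> \<bar>s\<bar> \<le> \<rho> \<and> 0 < \<bar>s'\<bar> \<and> \<bar>s'\<bar> \<le> \<rho>
        \<longrightarrow> cmod (dquo e s w - dquo e s' w) \<le> \<epsilon>)"
proof -
  have Q0: "w \<in> \<Omega>" if "w \<in> Q" for w using Q\<Omega>[OF that, of 0 1] r0 by simp
  define rad where "rad n = r0 / real (Suc n)" for n
  have rad: "0 < rad n" "rad n \<le> r0" for n using r0 by (auto simp: rad_def field_simps)
  have rad_mono: "rad n \<le> rad m" if "m \<le> n" for m n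
    unfolding rad_def using r0 that by (intro divide_left_mono) auto
  define I where "I n = {(e, s, s'). e \<in> {1, \<i>} \<and> 0 < \<bar>s\<bar> \<and> \<bar>s\<bar> \<le> rad n \<and> 0 < \<bar>s'\<bar> \<and> \<bar>s'\<bar> \<le> rad n}" for n
  define G where "G j n = Q \<inter> (\<Inter>(e, s, s')\<in>I n. {w \<in> Q. cmod (dquo e s w - dquo e s' w) \<le> 1 / real (Suc j)})" for j n
  have contF0: "continuous_on \<Omega> F0"
    using cont by (rule continuous_on_cong[THEN iffD1, rotated -1]) (auto simp: F0_def)
  have contdq: "continuous_on Q (dquo e s)" if "e \<in> {1, \<i>}" "\<bar>s\<bar> \<le> r0" "s \<noteq> 0" for e s
    unfolding dquo_def[abs_def]
    by (intro continuous_intros continuous_on_compose2[OF contF0]) (use that Q\<Omega> Q0 in auto)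
  have closedG: "closed (G j n)" for j n
    unfolding G_def
  proof (intro closed_Int closed_INT ballI)
    fix x assume "x \<in> I n"
    then obtain e s s' where x: "x = (e, s, s')" "e \<in> {1, \<i>}" "s \<noteq> 0" "\<bar>s\<bar> \<le> r0" "s' \<noteq> 0" "\<bar>s'\<bar> \<le> r0"
      using rad(2)[of n] by (auto simp: I_def)
    have "closed {w \<in> Q. cmod (dquo e s w - dquo e s' w) \<le> 1 / real (Suc j)}"
      by (rule continuous_on_closed_Collect_le)
        (use x contdq Q in \<open>auto intro!: continuous_intros simp: compact_imp_closed\<close>)
    then show "closed (case x of (e, s, s') \<Rightarrow> {w \<in> Q. cmod (dquo e s w - dquo e s' w) \<le> 1 / real (Suc j)})"
      using x by simp
  qed (use Q in \<open>simp add: compact_imp_closed\<close>)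
  have GQ: "G j n \<subseteq> Q" for j n by (auto simp: G_def)
  have G_mono: "G j m \<subseteq> G j n" if "m \<le> n" for j m n
  proof -
    have "I n \<subseteq> I m" using rad_mono[OF that] by (auto simp: I_def)
    then show ?thesis unfolding G_def by blast
  qed
  have GI: "cmod (dquo e s w - dquo e s' w) \<le> 1 / real (Suc j)"
    if "w \<in> G j n" "e \<in> {1, \<i>}" "0 < \<bar>s\<bar>" "\<bar>s\<bar> \<le> rad n" "0 < \<bar>s'\<bar>" "\<bar>s'\<bar> \<le> rad n" for j n w e s s'
  proof -
    have "(e, s, s') \<in> I n" using that by (auto simp: I_def)
    then show ?thesis using that(1) unfolding G_def by blast
  qed
  have AEG: "AE z in lborel. z \<in> Q \<longrightarrow> (\<exists>n. z \<in> G j n)" for j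
    using AE_partials
  proof eventually_elim
    case (elim z)
    show ?case
    proof
      assume zQ: "z \<in> Q"
      have "\<exists>n. \<forall>s s'. 0 < \<bar>s\<bar> \<and> \<bar>s\<bar> \<le> rad n \<and> 0 < \<bar>s'\<bar> \<and> \<bar>s'\<bar> \<le> rad n \<longrightarrow>
          cmod (dquo e s z - dquo e s' z) \<le> 1 / real (Suc j)"
        if e: "((\<lambda>s. F (z + of_real s * e)) has_vector_derivative a) (at 0)" for e a
      proof -
        have "eventually (\<lambda>s. dist (dquo e s z) a < 1 / (2 * real (Suc j))) (at 0)"
          using dquo_tendsto[OF Q0[OF zQ] e] by (rule tendstoD) simp
        then obtain d where d: "0 < d" "\<And>s. s \<noteq> 0 \<Longrightarrow> \<bar>s\<bar> < d \<Longrightarrow> dist (dquo e s z) a < 1 / (2 * real (Suc j))"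
          by (auto simp: eventually_at)
        obtain n where n: "rad n < d"
        proof -
          have "(\<lambda>n. r0 * inverse (real (Suc n))) \<longlonglongrightarrow> r0 * 0"
            by (intro tendsto_intros LIMSEQ_inverse_real_of_nat)
          then have "eventually (\<lambda>n. r0 * inverse (real (Suc n)) < d) sequentially"
            using d(1) by (intro order_tendstoD(2)) auto
          then show thesis using that by (auto simp: eventually_sequentially rad_def divide_inverse)
        qed
        have "cmod (dquo e s z - dquo e s' z) \<le> 1 / real (Suc j)"
          if "0 < \<bar>s\<bar>" "\<bar>s\<bar> \<le> rad n" "0 < \<bar>s'\<bar>" "\<bar>s'\<bar> \<le> rad n" for s s'
        proof -
          have "dist (dquo e s z) (dquo e s' z) \<le> dist (dquo e s z) a + dist (dquo e s' z) a"
            by (rule dist_triangle2)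
          also have "\<dots> \<le> 1 / (2 * real (Suc j)) + 1 / (2 * real (Suc j))"
            using d(2)[of s] d(2)[of s'] that n by (intro add_mono) auto
          also have "\<dots> = 1 / real (Suc j)" by (simp add: field_simps)
          finally show ?thesis by (simp add: dist_norm)
        qed
        then show ?thesis by blast
      qed
      from this[of 1] this[of \<i>] elim Q0[OF zQ]
      obtain n1 n2 where
        n1: "\<And>s s'. 0 < \<bar>s\<bar> \<Longrightarrow> \<bar>s\<bar> \<le> rad n1 \<Longrightarrow> 0 < \<bar>s'\<bar> \<Longrightarrow> \<bar>s'\<bar> \<le> rad n1 \<Longrightarrow> cmod (dquo 1 s z - dquo 1 s' z) \<le> 1 / real (Suc j)"
        and n2: "\<And>s s'. 0 < \<bar>s\<bar> \<Longrightarrow> \<bar>s\<bar> \<le> rad n2 \<Longrightarrow> 0 < \<bar>s'\<bar> \<Longrightarrow> \<bar>s'\<bar> \<le> rad n2 \<Longrightarrow> cmod (dquo \<i> s z - dquo \<i> s' z) \<le> 1 / real (Suc j)"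
        by meson
      have "z \<in> G j (max n1 n2)"
        unfolding G_def I_def using zQ n1 n2 rad_mono[of n1 "max n1 n2"] rad_mono[of n2 "max n1 n2"]
        by (auto; meson order_trans)
      then show "\<exists>n. z \<in> G j n" by blast
    qed
  qed
  have small: "\<exists>n. emeasure lborel (Q - G j n) \<le> ennreal \<theta>" if "0 < \<theta>" for j \<theta>
  proof -
    have "(\<lambda>n. emeasure lborel (Q - G j n)) \<longlonglongrightarrow> emeasure lborel (\<Inter>n. Q - G j n)"
    proof (rule Lim_emeasure_decseq)
      show "range (\<lambda>n. Q - G j n) \<subseteq> sets lborel"
        using closedG Q by (auto simp: borel_closed compact_imp_closed)
      show "decseq (\<lambda>n. Q - G j n)" using G_mono by (force simp: decseq_def)
      show "emeasure lborel (Q - G j n) \<noteq> \<infinity>" for n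
        using emeasure_mono[of "Q - G j n" Q lborel] emeasure_compact_finite[OF Q] Q
        by (auto simp: borel_closed compact_imp_closed top_unique)
    qed
    moreover have "emeasure lborel (\<Inter>n. Q - G j n) = 0"
    proof (rule AE_iff_measurable[THEN iffD1])
      show "(\<Inter>n. Q - G j n) \<in> sets lborel"
        using closedG Q by (auto simp: borel_closed compact_imp_closed intro!: sets.countable_INT)
      show "{x \<in> space lborel. \<not> (x \<in> Q \<longrightarrow> (\<exists>n. x \<in> G j n))} = (\<Inter>n. Q - G j n)" by auto
    qed (rule AEG)
    ultimately have "(\<lambda>n. emeasure lborel (Q - G j n)) \<longlonglongrightarrow> 0" by simp
    then have "eventually (\<lambda>n. emeasure lborel (Q - G j n) < ennreal \<theta>) sequentially"
      using that by (intro order_tendstoD(2)) auto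
    then show ?thesis by (auto simp: eventually_sequentially intro: less_imp_le)
  qed
  \<comment> \<open>The least index is increasing in \<open>m\<close>, since an index good enough
    for m + 1 is good enough for m. This makes \<open>S\<close> increasing.\<close>
  define N where "N j m = (LEAST n. emeasure lborel (Q - G j n) \<le> ennreal ((1/2) ^ m * (1/2) ^ j))" for j m
  have N: "emeasure lborel (Q - G j (N j m)) \<le> ennreal ((1/2) ^ m * (1/2) ^ j)" for j m
    unfolding N_def by (rule LeastI_ex, rule small) simp
  have N_mono: "N j m \<le> N j (Suc m)" for j m
    unfolding N_def[of j m]
    by (rule Least_le, rule order_trans[OF N]) (auto intro!: ennreal_leI simp: field_simps)
  define S where "S m = (\<Inter>j. G j (N j m))" for m
  show thesis
  proof (rule that[of S])
    show "incseq S"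
      unfolding S_def by (rule incseq_SucI) (use G_mono[OF N_mono] in blast)
    show SQ: "S m \<subseteq> Q" for m unfolding S_def using GQ by blast
    have clS: "closed (S m)" for m unfolding S_def by (intro closed_INT ballI closedG)
    then show "compact (S m)" for m
      using SQ Q by (metis compact_Int_closed inf.absorb_iff2)
    show "\<exists>\<rho>>0. \<rho> \<le> r0 \<and> (\<forall>w\<in>S m. \<forall>e\<in>{1, \<i>}. \<forall>s s'. 0 < \<bar>s\<bar> \<and> \<bar>s\<bar> \<le> \<rho> \<and> 0 < \<bar>s'\<bar> \<and> \<bar>s'\<bar> \<le> \<rho>
        \<longrightarrow> cmod (dquo e s w - dquo e s' w) \<le> \<epsilon>)" if "0 < \<epsilon>" for m \<epsilon>
    proof -
      obtain j where "inverse (real (Suc j)) < \<epsilon>" using reals_Archimedean[OF \<open>0 < \<epsilon>\<close>] by blast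
      then have j: "1 / real (Suc j) < \<epsilon>" by (simp add: inverse_eq_divide)
      show ?thesis
      proof (intro exI conjI ballI allI impI)
        show "0 < rad (N j m)" "rad (N j m) \<le> r0" by (rule rad)+
        fix w e and s s' :: real assume "w \<in> S m" and *: "e \<in> {1, \<i>}"
          "0 < \<bar>s\<bar> \<and> \<bar>s\<bar> \<le> rad (N j m) \<and> 0 < \<bar>s'\<bar> \<and> \<bar>s'\<bar> \<le> rad (N j m)"
        then have "w \<in> G j (N j m)" by (auto simp: S_def)
        then have "cmod (dquo e s w - dquo e s' w) \<le> 1 / real (Suc j)"
          using * by (intro GI[where n = "N j m"]) auto
        then show "cmod (dquo e s w - dquo e s' w) \<le> \<epsilon>" using j by linarith
      qed
    qed
    have mS: "emeasure lborel (Q - S m) \<le> ennreal ((1/2) ^ m * 2)" for m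
    proof -
      have eq: "Q - S m = (\<Union>j. Q - G j (N j m))" by (auto simp: S_def)
      have "emeasure lborel (Q - S m) \<le> (\<Sum>j. emeasure lborel (Q - G j (N j m)))"
        unfolding eq
        by (rule emeasure_subadditive_countably)
          (use closedG Q in \<open>auto simp: borel_closed compact_imp_closed\<close>)
      also have "\<dots> \<le> (\<Sum>j. ennreal ((1/2) ^ m * (1/2) ^ j))"
        by (intro suminf_le N) auto
      also have "\<dots> = ennreal ((1/2) ^ m * 2)"
      proof (rule suminf_ennreal_eq)
        have "(\<lambda>j. (1/2::real) ^ j) sums (1 / (1 - 1/2))" by (rule geometric_sums) simp
        from sums_mult[OF this, of "(1/2) ^ m"] show "(\<lambda>j. (1/2) ^ m * (1/2) ^ j) sums ((1/2::real) ^ m * 2)" by simp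
      qed simp
      finally show ?thesis .
    qed
    have "emeasure lborel (Q - (\<Union>m. S m)) \<le> 0"
    proof (rule LIMSEQ_le_const)
      have "(\<lambda>m. (1/2::real) ^ m * 2) \<longlonglongrightarrow> 0 * 2"
        by (intro tendsto_intros LIMSEQ_power_zero) simp
      then show "(\<lambda>m. ennreal ((1/2) ^ m * 2)) \<longlonglongrightarrow> 0"
        by (metis ennreal_0 mult_zero_left tendsto_ennrealI)
      have "emeasure lborel (Q - (\<Union>m. S m)) \<le> ennreal ((1/2) ^ m * 2)" for m
        by (rule order_trans[OF emeasure_mono mS])
          (use clS Q in \<open>auto simp: borel_closed compact_imp_closed\<close>)
      then show "\<exists>N. \<forall>n\<ge>N. emeasure lborel (Q - (\<Union>m. S m)) \<le> ennreal ((1/2) ^ n * 2)" by blast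
    qed
    then have "Q - (\<Union>m. S m) \<in> null_sets lborel"
      using clS Q by (auto simp: null_sets_def borel_closed compact_imp_closed intro!: sets.Diff sets.countable_UN)
    from AE_not_in[OF this] show "AE z in lborel. z \<in> Q \<longrightarrow> (\<exists>m. z \<in> S m)"
      by eventually_elim auto
  qed
qed

text \<open>The area formula on the compact exhausting sets, followed by monotone convergence. Only
  a null set of the domain is lost, which leaves the integral on the left unchanged.\<close>

lemma area_inequality:
  assumes Q: "compact Q" "Q \<subseteq> \<Omega>" and B: "closed B"
  shows "(\<integral>\<^sup>+z. ennreal \<bar>jac z\<bar> * indicator {z \<in> Q. F z \<in> B} z \<partial>lborel) \<le> emeasure lborel B"
proof -
  obtain r0 where r0: "0 < r0" "(\<Union>x\<in>Q. cball x r0) \<subseteq> \<Omega>"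
    using compact_subset_open_imp_cball_epsilon_subset[OF Q(1) open_\<Omega> Q(2)] by blast
  have Q\<Omega>: "w + of_real s * e \<in> \<Omega>" if "w \<in> Q" "\<bar>s\<bar> \<le> r0" "e \<in> {1, \<i>}" for w s e
  proof -
    have "w + of_real s * e \<in> cball w r0" using that by (auto simp: dist_norm norm_mult)
    then show ?thesis using r0(2) that(1) by blast
  qed
  obtain S where S: "incseq S" "\<And>m. compact (S m)" "\<And>m. S m \<subseteq> Q"
    "AE z in lborel. z \<in> Q \<longrightarrow> (\<exists>m. z \<in> S m)"
    "\<And>m \<epsilon>. 0 < \<epsilon> \<Longrightarrow> \<exists>\<rho>>0. \<rho> \<le> r0 \<and> (\<forall>w\<in>S m. \<forall>e\<in>{1, \<i>}. \<forall>s s'. 0 < \<bar>s\<bar> \<and> \<bar>s\<bar> \<le> \<rho> \<and> 0 < \<bar>s'\<bar> \<and> \<bar>s'\<bar> \<le> \<rho>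
        \<longrightarrow> cmod (dquo e s w - dquo e s' w) \<le> \<epsilon>)"
  proof goal_cases
    case 1
    show ?case
    proof (rule exhausting_uniform_sets[OF Q(1) r0(1)])
      show "w + of_real s * e \<in> \<Omega>" if "w \<in> Q" "\<bar>s\<bar> \<le> r0" "e \<in> {1, \<i>}" for w s e
        using that by (rule Q\<Omega>)
    qed (rule 1)
  qed
  define T where "T m = {z \<in> S m. F z \<in> B}" for m
  have cT: "compact (T m)" for m
  proof -
    have "continuous_on (S m) F" using cont S(3) Q by (meson continuous_on_subset subset_trans)
    then have "closed (S m \<inter> F -` B)"
      using S(2) B by (intro continuous_closed_preimage) (auto simp: compact_imp_closed)
    moreover have "T m = S m \<inter> (S m \<inter> F -` B)" by (auto simp: T_def)
    ultimately show ?thesis using S(2) by (metis compact_Int_closed)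
  qed
  have bnd: "(\<integral>\<^sup>+z. ennreal \<bar>jac z\<bar> * indicator (T m) z \<partial>lborel) \<le> emeasure lborel B" for m
  proof -
    have "(\<integral>\<^sup>+z. ennreal \<bar>Im (cnj (partial 1 z) * partial \<i> z)\<bar> * indicator (T m) z \<partial>lborel) \<le> emeasure lborel (F ` T m)"
    proof (rule nn_integral_jacobian_le[OF cT])
      show "inj_on F (T m)" using inj S(3) Q by (auto simp: T_def intro: inj_on_subset)
      fix z assume z: "z \<in> T m"
      have "(F has_derivative (\<lambda>h. of_real (Re h) * partial 1 z + of_real (Im h) * partial \<i> z)) (at z within S m)"
        by (rule has_derivative_within_uniform_set[OF S(3) _ r0(1) Q\<Omega> S(5)]) (use z in \<open>auto simp: T_def\<close>)
      then show "(F has_derivative (\<lambda>h. of_real (Re h) * partial 1 z + of_real (Im h) * partial \<i> z)) (at z within T m)"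
        by (rule has_derivative_subset) (auto simp: T_def)
    qed measurable
    also have "\<dots> \<le> emeasure lborel B"
      using B by (intro emeasure_mono) (auto simp: T_def borel_closed)
    finally show ?thesis by (simp add: jac_def)
  qed
  have incT: "incseq T" using S(1) by (fastforce simp: incseq_def T_def)
  have "(\<integral>\<^sup>+z. ennreal \<bar>jac z\<bar> * indicator {z \<in> Q. F z \<in> B} z \<partial>lborel)
      = (\<integral>\<^sup>+z. (SUP m. ennreal \<bar>jac z\<bar> * indicator (T m) z) \<partial>lborel)"
  proof (rule nn_integral_cong_AE)
    show "AE z in lborel. ennreal \<bar>jac z\<bar> * indicator {z \<in> Q. F z \<in> B} z = (SUP m. ennreal \<bar>jac z\<bar> * indicator (T m) z)"
      using S(4)
    proof eventually_elim
      case (elim z)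
      show ?case
      proof (cases "z \<in> Q \<and> F z \<in> B")
        case True
        then obtain m where m: "z \<in> T m" using elim by (auto simp: T_def)
        show ?thesis
          by (rule antisym) (use True m in \<open>auto intro!: SUP_upper2[of m] SUP_least simp: indicator_def\<close>)
      next
        case False
        then have "z \<notin> T m" for m using S(3) by (auto simp: T_def)
        then show ?thesis using False by auto
      qed
    qed
  qed
  also have "\<dots> = (SUP m. \<integral>\<^sup>+z. ennreal \<bar>jac z\<bar> * indicator (T m) z \<partial>lborel)"
  proof (rule nn_integral_monotone_convergence_SUP)
    show "incseq (\<lambda>m z. ennreal \<bar>jac z\<bar> * indicator (T m) z)"
      using incT by (auto simp: incseq_def le_fun_def indicator_def)
    show "(\<lambda>z. ennreal \<bar>jac z\<bar> * indicator (T m) z) \<in> borel_measurable lborel" for m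
      using cT by (auto simp: borel_closed compact_imp_closed)
  qed
  also have "\<dots> \<le> emeasure lborel B" by (intro SUP_least bnd)
  finally show ?thesis .
qed

end

section \<open>A truncated logarithmic potential\<close>

text \<open>It vanishes at 0, and its derivative falls linearly from 1 to 0 on [0, L^2]. A
  truncation with a kink would not do: \<open>oscillation_along_line\<close> differentiates the
  potential at every point of the plane, and the image of a line may meet a given circle in a large
  set.\<close>

definition cutoff :: "real \<Rightarrow> real \<Rightarrow> real" where
  "cutoff L u = L\<^sup>2 / 2 - (max 0 (L\<^sup>2 - u))\<^sup>2 / (2 * L\<^sup>2)"

text \<open>A continuously differentiable substitute for \<open>2 * ln r\<close>, \<open>r = cmod (w - c)\<close>, which is constant for
  \<open>r \<ge> L\<close> and almost constant for \<open>r \<le> \<rho>\<close>.\<close>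

definition log_potential :: "complex \<Rightarrow> real \<Rightarrow> real \<Rightarrow> complex \<Rightarrow> real" where
  "log_potential c \<rho> L w = ln (\<rho>\<^sup>2 + cutoff L ((cmod (w - c))\<^sup>2))"

definition log_potential_slope :: "complex \<Rightarrow> real \<Rightarrow> real \<Rightarrow> complex \<Rightarrow> real" where
  "log_potential_slope c \<rho> L w =
     max 0 (L\<^sup>2 - (cmod (w - c))\<^sup>2) / L\<^sup>2 * (2 * cmod (w - c)) / (\<rho>\<^sup>2 + cutoff L ((cmod (w - c))\<^sup>2))"

lemma pos_part_square_deriv: "((\<lambda>x::real. (max 0 x)\<^sup>2) has_real_derivative 2 * max 0 x) (at x)"
proof -
  consider "0 < x" | "x < 0" | "x = 0" by linarith
  then show ?thesis
  proof cases
    case 1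
    have "((\<lambda>x. x\<^sup>2) has_real_derivative 2 * max 0 x) (at x)"
      using 1 by (auto intro!: derivative_eq_intros)
    then show ?thesis
      by (rule has_field_derivative_transform_within_open[where S = "{0<..}"]) (use 1 in auto)
  next
    case 2
    have "((\<lambda>x. 0) has_real_derivative 2 * max 0 x) (at x)"
      using 2 by (auto intro!: derivative_eq_intros)
    then show ?thesis
      by (rule has_field_derivative_transform_within_open[where S = "{..<0}"]) (use 2 in auto)
  next
    case 3
    have "((\<lambda>h. (max 0 h)\<^sup>2 / h) \<longlongrightarrow> 0) (at (0::real))"
    proof (rule Lim_null_comparison)
      show "eventually (\<lambda>h::real. norm ((max 0 h)\<^sup>2 / h) \<le> \<bar>h\<bar>) (at 0)"
        by (intro always_eventually) (auto simp: max_def power2_eq_square)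
      show "((\<lambda>h::real. \<bar>h\<bar>) \<longlongrightarrow> 0) (at 0)"
        by (auto intro!: tendsto_eq_intros)
    qed
    then show ?thesis using 3 by (simp add: DERIV_def)
  qed
qed

lemma cutoff_deriv: "L \<noteq> 0 \<Longrightarrow> (cutoff L has_real_derivative max 0 (L\<^sup>2 - u) / L\<^sup>2) (at u)"
proof -
  assume L: "L \<noteq> 0"
  have "((\<lambda>u. L\<^sup>2 - u) has_real_derivative -1) (at u)" by (auto intro!: derivative_eq_intros)
  from DERIV_chain2[OF pos_part_square_deriv this]
  have "((\<lambda>u. (max 0 (L\<^sup>2 - u))\<^sup>2) has_real_derivative 2 * max 0 (L\<^sup>2 - u) * -1) (at u)" .
  then have "((\<lambda>u. L\<^sup>2 / 2 - (max 0 (L\<^sup>2 - u))\<^sup>2 / (2 * L\<^sup>2)) has_real_derivative 0 - (2 * max 0 (L\<^sup>2 - u) * -1) / (2 * L\<^sup>2)) (at u)"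
    by (intro DERIV_diff DERIV_cdivide DERIV_const)
  then show ?thesis by (simp add: cutoff_def[abs_def])
qed

lemma cutoff_ge:
  assumes "0 < L" "0 \<le> u"
  shows "min u (L\<^sup>2) / 2 \<le> cutoff L u"
proof (cases "u \<le> L\<^sup>2")
  case True
  then have "(L\<^sup>2 - u)\<^sup>2 \<le> L\<^sup>2 * (L\<^sup>2 - u)"
    using assms unfolding power2_eq_square[of "L\<^sup>2 - u"] by (intro mult_right_mono) auto
  then have "(L\<^sup>2 - u)\<^sup>2 / (2 * L\<^sup>2) \<le> (L\<^sup>2 - u) / 2" using assms by (simp add: field_simps)
  then show ?thesis using True by (simp add: cutoff_def min_def field_simps)
next
  case False
  then show ?thesis by (simp add: cutoff_def min_def)
qed

lemma cutoff_le: "0 < L \<Longrightarrow> cutoff L u \<le> u"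
proof (cases "u \<le> L\<^sup>2")
  case True
  assume L: "0 < L"
  have "(L\<^sup>2 - u)\<^sup>2 = L\<^sup>2 * L\<^sup>2 - 2 * L\<^sup>2 * u + u\<^sup>2" by (simp add: power2_eq_square algebra_simps)
  then have "L\<^sup>2 * L\<^sup>2 - 2 * L\<^sup>2 * u \<le> (L\<^sup>2 - u)\<^sup>2" by simp
  then show ?thesis using True L by (simp add: cutoff_def field_simps)
next
  case False
  assume "0 < L"
  then show ?thesis using False by (simp add: cutoff_def) (smt (verit) zero_le_power2)
qed

lemma cutoff_eq: "L\<^sup>2 \<le> u \<Longrightarrow> cutoff L u = L\<^sup>2 / 2"
  by (simp add: cutoff_def)

context
  fixes c :: complex and \<rho> L :: real
  assumes \<rho>: "0 < \<rho>" and L: "0 < L"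
begin

lemma potential_pos: "0 < \<rho>\<^sup>2 + cutoff L ((cmod (w - c))\<^sup>2)"
proof -
  have "0 \<le> cutoff L ((cmod (w - c))\<^sup>2)"
    by (rule order_trans[OF _ cutoff_ge[OF L]]) auto
  moreover have "0 < \<rho>\<^sup>2" using \<rho> by simp
  ultimately show ?thesis by linarith
qed

lemma log_potential_deriv:
  "(log_potential c \<rho> L has_derivative
     (\<lambda>h. inverse (\<rho>\<^sup>2 + cutoff L ((cmod (w - c))\<^sup>2)) * (max 0 (L\<^sup>2 - (cmod (w - c))\<^sup>2) / L\<^sup>2 * (2 * ((w - c) \<bullet> h))))) (at w)"
proof -
  have "((\<lambda>w. (w - c) \<bullet> (w - c)) has_derivative (\<lambda>h. (w - c) \<bullet> h + h \<bullet> (w - c))) (at w)"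
    by (auto intro!: derivative_eq_intros)
  then have 1: "((\<lambda>w. (cmod (w - c))\<^sup>2) has_derivative (\<lambda>h. 2 * ((w - c) \<bullet> h))) (at w)"
    by (simp add: power2_norm_eq_inner inner_commute)
  have 2: "((\<lambda>u. \<rho>\<^sup>2 + cutoff L u) has_real_derivative max 0 (L\<^sup>2 - (cmod (w - c))\<^sup>2) / L\<^sup>2) (at ((cmod (w - c))\<^sup>2))"
    using DERIV_add[OF DERIV_const cutoff_deriv[of L]] L by simp
  have 3: "((\<lambda>u. ln (\<rho>\<^sup>2 + cutoff L u)) has_real_derivative inverse (\<rho>\<^sup>2 + cutoff L ((cmod (w - c))\<^sup>2)) * (max 0 (L\<^sup>2 - (cmod (w - c))\<^sup>2) / L\<^sup>2)) (at ((cmod (w - c))\<^sup>2))"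
    by (rule DERIV_chain2[OF DERIV_ln[OF potential_pos] 2])
  from has_derivative_compose[OF 1 3[unfolded has_field_derivative_def]]
  show ?thesis by (simp add: log_potential_def[abs_def] mult.assoc)
qed

lemma slope_nonneg: "0 \<le> log_potential_slope c \<rho> L w"
  unfolding log_potential_slope_def using potential_pos[of w] L by (intro divide_nonneg_pos mult_nonneg_nonneg) auto

lemma log_potential_deriv_le:
  "\<bar>inverse (\<rho>\<^sup>2 + cutoff L ((cmod (w - c))\<^sup>2)) * (max 0 (L\<^sup>2 - (cmod (w - c))\<^sup>2) / L\<^sup>2 * (2 * ((w - c) \<bullet> h)))\<bar>
     \<le> log_potential_slope c \<rho> L w * cmod h"
proof -
  let ?D = "\<rho>\<^sup>2 + cutoff L ((cmod (w - c))\<^sup>2)" and ?m = "max 0 (L\<^sup>2 - (cmod (w - c))\<^sup>2) / L\<^sup>2"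
  have "\<bar>inverse ?D * (?m * (2 * ((w - c) \<bullet> h)))\<bar> = inverse ?D * (?m * (2 * \<bar>(w - c) \<bullet> h\<bar>))"
    using potential_pos[of w] by (simp add: abs_mult)
  also have "\<dots> \<le> inverse ?D * (?m * (2 * (cmod (w - c) * cmod h)))"
    using potential_pos[of w] by (intro mult_left_mono Cauchy_Schwarz_ineq2) auto
  also have "\<dots> = log_potential_slope c \<rho> L w * cmod h"
    by (simp add: log_potential_slope_def divide_inverse mult_ac)
  finally show ?thesis .
qed

lemma slope_cases:
  shows "L < cmod (w - c) \<Longrightarrow> log_potential_slope c \<rho> L w = 0"
    and "cmod (w - c) \<le> \<rho> \<Longrightarrow> log_potential_slope c \<rho> L w \<le> 2 / \<rho>"
    and "0 < cmod (w - c) \<Longrightarrow> log_potential_slope c \<rho> L w \<le> 4 / cmod (w - c)"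
proof -
  define r where "r = cmod (w - c)"
  have r0: "0 \<le> r" by (simp add: r_def)
  define D where "D = \<rho>\<^sup>2 + cutoff L (r\<^sup>2)"
  have D: "0 < D" using potential_pos[of w] by (simp add: D_def r_def)
  have g: "log_potential_slope c \<rho> L w = max 0 (L\<^sup>2 - r\<^sup>2) / L\<^sup>2 * (2 * r) / D"
    by (simp add: log_potential_slope_def D_def r_def)
  have m1: "max 0 (L\<^sup>2 - r\<^sup>2) / L\<^sup>2 \<le> 1" using L by simp
  have le: "log_potential_slope c \<rho> L w \<le> 2 * r / D"
  proof -
    have "max 0 (L\<^sup>2 - r\<^sup>2) / L\<^sup>2 * (2 * r) \<le> 1 * (2 * r)"
      by (rule mult_right_mono[OF m1]) (use r0 in simp)
    from divide_right_mono[OF this less_imp_le[OF D]] show ?thesis unfolding g mult_1 .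
  qed
  have z: "log_potential_slope c \<rho> L w = 0" if "L \<le> r"
  proof -
    have "L\<^sup>2 \<le> r\<^sup>2" using that L by (intro power_mono) auto
    then show ?thesis unfolding g by simp
  qed
  then show "L < cmod (w - c) \<Longrightarrow> log_potential_slope c \<rho> L w = 0" by (simp add: r_def)
  have q0: "0 \<le> cutoff L (r\<^sup>2)" by (rule order_trans[OF _ cutoff_ge[OF L]]) auto
  show "log_potential_slope c \<rho> L w \<le> 2 / \<rho>" if "cmod (w - c) \<le> \<rho>"
  proof -
    have "2 * r / D \<le> 2 * \<rho> / \<rho>\<^sup>2"
      using that q0 \<rho> D by (intro frac_le) (auto simp: D_def r_def)
    then show ?thesis using le \<rho> by (simp add: power2_eq_square)
  qed
  show "log_potential_slope c \<rho> L w \<le> 4 / cmod (w - c)" if "0 < cmod (w - c)"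
  proof (cases "r \<le> L")
    case True
    have "r\<^sup>2 \<le> L\<^sup>2" using True r0 by (intro power_mono)
    then have "r\<^sup>2 / 2 \<le> D" using cutoff_ge[OF L, of "r\<^sup>2"] \<rho> by (simp add: D_def min_def) (smt (verit) zero_le_power2)
    then have "2 * r / D \<le> 2 * r / (r\<^sup>2 / 2)"
      using that r0 by (intro divide_left_mono) (auto simp: r_def[symmetric] D)
    then show ?thesis using le that by (simp add: r_def power2_eq_square)
  next
    case False
    then show ?thesis using z that by simp
  qed
qed

lemma slope_le: "log_potential_slope c \<rho> L w \<le> 4 / \<rho>"
proof (cases "cmod (w - c) \<le> \<rho>")
  case True
  have "2 / \<rho> \<le> 4 / \<rho>" using \<rho> by (simp add: divide_right_mono)
  then show ?thesis using slope_cases(2)[OF True] by linarith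
next
  case False
  then have pos: "0 < cmod (w - c)" using \<rho> by linarith
  have "4 / cmod (w - c) \<le> 4 / \<rho>" using \<rho> False pos by (intro divide_left_mono mult_pos_pos) auto
  with pos show ?thesis using slope_cases(3)[of w] by linarith
qed

text \<open>In the dyadic annulus with outer radius 2^j \<rho> the slope is at most 8 / (2^j
  \<rho>), so the single term with index \<open>j\<close> dominates. Each disc is later weighed
  against its own area, so that every scale costs the same.\<close>

lemma slope_square_le:
  assumes N: "L = 2 ^ N * \<rho>"
  shows "(log_potential_slope c \<rho> L w)\<^sup>2 \<le> (\<Sum>j\<le>N. 64 / (2 ^ j * \<rho>)\<^sup>2 * indicator (cball c (2 ^ j * \<rho>)) w)"
proof (cases "L < cmod (w - c)")
  case True
  then show ?thesis by (simp add: slope_cases(1)) (intro sum_nonneg, simp)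
next
  case False
  define R where "R j = 2 ^ j * \<rho>" for j :: nat
  have R0: "0 < R j" for j using \<rho> by (simp add: R_def)
  define j where "j = (LEAST j. cmod (w - c) \<le> R j)"
  have ex: "cmod (w - c) \<le> R N" using False N by (simp add: R_def)
  have j1: "cmod (w - c) \<le> R j" unfolding j_def by (rule LeastI) (rule ex)
  have jN: "j \<le> N" unfolding j_def by (rule Least_le) (rule ex)
  have "log_potential_slope c \<rho> L w \<le> 8 / R j"
  proof (cases j)
    case 0
    then have "cmod (w - c) \<le> \<rho>" using j1 by (simp add: R_def)
    from slope_cases(2)[OF this] show ?thesis using 0 \<rho> by (simp add: R_def) (smt (verit) divide_right_mono)
  next
    case (Suc i)
    then have "\<not> cmod (w - c) \<le> R i" unfolding j_def by (intro not_less_Least) simp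
    then have i: "R i < cmod (w - c)" by simp
    then have "log_potential_slope c \<rho> L w \<le> 4 / cmod (w - c)" using R0[of i] by (intro slope_cases(3)) linarith
    also have "\<dots> \<le> 4 / R i" using i R0[of i] by (intro divide_left_mono mult_pos_pos) auto
    also have "\<dots> = 8 / R j" using Suc by (simp add: R_def)
    finally show ?thesis .
  qed
  then have "(log_potential_slope c \<rho> L w)\<^sup>2 \<le> (8 / R j)\<^sup>2" by (intro power_mono slope_nonneg)
  also have "\<dots> = 64 / (R j)\<^sup>2 * indicator (cball c (R j)) w"
    using j1 by (simp add: power_divide indicator_def dist_norm norm_minus_commute)
  also have "\<dots> \<le> (\<Sum>j\<le>N. 64 / (R j)\<^sup>2 * indicator (cball c (R j)) w)"
    using jN by (intro member_le_sum) auto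
  finally show ?thesis by (simp add: R_def)
qed

text \<open>The potential is at most ln (2 \<rho>^2) inside and at least ln (L^2 / 2) outside. These
  numbers differ by (N - 1) ln 4.\<close>

lemma log_potential_gap:
  assumes N: "L = 2 ^ N * \<rho>" and w: "cmod (w - c) \<le> \<rho>" and w': "L \<le> cmod (w' - c)"
  shows "real N - 1 \<le> log_potential c \<rho> L w' - log_potential c \<rho> L w"
proof -
  have "cutoff L ((cmod (w - c))\<^sup>2) \<le> (cmod (w - c))\<^sup>2" by (rule cutoff_le[OF L])
  also have "\<dots> \<le> \<rho>\<^sup>2" using w by (intro power_mono) auto
  finally have 1: "log_potential c \<rho> L w \<le> ln (2 * \<rho>\<^sup>2)"
    unfolding log_potential_def using potential_pos[of w] by (subst ln_le_cancel_iff) auto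
  have "L\<^sup>2 \<le> (cmod (w' - c))\<^sup>2" using w' L by (intro power_mono) auto
  then have "cutoff L ((cmod (w' - c))\<^sup>2) = L\<^sup>2 / 2" by (rule cutoff_eq)
  then have 2: "ln (L\<^sup>2 / 2) \<le> log_potential c \<rho> L w'"
    unfolding log_potential_def using L \<rho> potential_pos[of w'] by (subst ln_le_cancel_iff) auto
  have e4: "1 \<le> ln (4::real)"
    using exp_le by (subst ln_ge_iff) auto
  have LN: "L\<^sup>2 / 2 = 4 ^ N * (\<rho>\<^sup>2 / 2)"
  proof -
    have "(2::real) ^ N * 2 ^ N = 4 ^ N" by (simp flip: power_mult_distrib)
    then show ?thesis unfolding N power_mult_distrib power2_eq_square[of "2 ^ N"] by simp
  qed
  have "ln (L\<^sup>2 / 2) = real N * ln 4 + ln (\<rho>\<^sup>2 / 2)"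
    unfolding LN using \<rho> by (subst ln_mult) (auto simp: ln_realpow)
  moreover have "ln (2 * \<rho>\<^sup>2) = ln 4 + ln (\<rho>\<^sup>2 / 2)"
  proof -
    have "2 * \<rho>\<^sup>2 = 4 * (\<rho>\<^sup>2 / 2)" by simp
    moreover have "ln (4 * (\<rho>\<^sup>2 / 2)) = ln 4 + ln (\<rho>\<^sup>2 / 2)" using \<rho> by (intro ln_mult_pos) auto
    ultimately show ?thesis by simp
  qed
  ultimately have 3: "ln (L\<^sup>2 / 2) - ln (2 * \<rho>\<^sup>2) = (real N - 1) * ln 4" by (simp add: algebra_simps)
  show ?thesis
  \<comment> \<open>For N = 0 the difference above is - ln 4, which is less than -1; there
    monotonicity of the potential is used.\<close>
  proof (cases "N = 0")
    case True
    then have "L \<le> cmod (w' - c)" "cmod (w - c) \<le> L" using w w' N by auto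
    have "cutoff L ((cmod (w - c))\<^sup>2) \<le> cutoff L ((cmod (w' - c))\<^sup>2)"
      unfolding \<open>cutoff L ((cmod (w' - c))\<^sup>2) = L\<^sup>2 / 2\<close> by (simp add: cutoff_def)
    then have "log_potential c \<rho> L w \<le> log_potential c \<rho> L w'"
      unfolding log_potential_def using potential_pos by (subst ln_le_cancel_iff) auto
    then show ?thesis using True by simp
  next
    case False
    then have "(real N - 1) * 1 \<le> (real N - 1) * ln 4" using e4 by (intro mult_left_mono) auto
    then have "real N - 1 \<le> (real N - 1) * ln 4" by simp
    also have "\<dots> = ln (L\<^sup>2 / 2) - ln (2 * \<rho>\<^sup>2)" by (rule 3[symmetric])
    also have "\<dots> \<le> log_potential c \<rho> L w' - log_potential c \<rho> L w" using 2 1 by (rule diff_mono)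
    finally show ?thesis .
  qed
qed

end

section \<open>The length-area estimate on concentric squares\<close>

lemma AE_lborel_affine:
  fixes P :: "real \<Rightarrow> bool"
  assumes "AE y in lborel. P y" "c \<noteq> 0"
  shows "AE s in lborel. P (t + c * s)"
proof -
  obtain N where N: "N \<in> null_sets lborel" "{z. \<not> P z} \<subseteq> N"
    using assms(1) by (auto elim: AE_E simp: null_sets_def)
  have "AE y in lborel. y \<notin> N" using N(1) by (rule AE_not_in)
  then have "AE s in lborel. t + c * s \<notin> N"
    using N(1) assms(2) by (intro AE_borel_affine) auto
  then show ?thesis by eventually_elim (use N(2) in auto)
qed

lemma emeasure_cball_le:
  assumes "0 < R"
  shows "emeasure lborel (cball (c :: complex) R) \<le> ennreal (4 * R\<^sup>2)"
proof -
  define l where "l = c - Complex R R"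
  define u where "u = c + Complex R R"
  have "cball c R \<subseteq> cbox l u"
  proof
    fix z assume "z \<in> cball c R"
    then have "cmod (z - c) \<le> R" by (simp add: dist_norm norm_minus_commute)
    then have "\<bar>Re z - Re c\<bar> \<le> R" "\<bar>Im z - Im c\<bar> \<le> R"
      using abs_Re_le_cmod[of "z - c"] abs_Im_le_cmod[of "z - c"] by auto
    then show "z \<in> cbox l u" by (auto simp: in_cbox_complex_iff l_def u_def)
  qed
  then have "emeasure lborel (cball c R) \<le> emeasure lborel (cbox l u)"
    by (intro emeasure_mono) auto
  also have "\<dots> = ennreal (4 * R\<^sup>2)"
    using assms by (simp add: emeasure_lborel_cbox_eq Basis_complex_def l_def u_def power2_eq_square)
  finally show ?thesis .
qed

text \<open>Its level sets are axis-parallel squares. Absolute continuity is available only on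
  horizontal and vertical lines, so squares replace circles.\<close>

definition square_norm :: "complex \<Rightarrow> real" where
  "square_norm z = max \<bar>Re z\<bar> \<bar>Im z\<bar>"

lemma square_norm_le: "square_norm z \<le> cmod z"
  by (simp add: square_norm_def abs_Re_le_cmod abs_Im_le_cmod)

lemma square_norm_ge: "cmod z \<le> 2 * square_norm z"
  using cmod_le[of z] by (auto simp: square_norm_def)

lemma continuous_square_norm: "continuous_on A (\<lambda>z. square_norm (z - a))"
  unfolding square_norm_def by (intro continuous_intros)

lemma connected_meets_square:
  assumes "connected E" "x \<in> E" "y \<in> E" "square_norm (x - a) \<le> s" "s \<le> square_norm (y - a)"
  shows "\<exists>z\<in>E. square_norm (z - a) = s"
proof -
  have "connected ((\<lambda>z. square_norm (z - a)) ` E)"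
    by (rule connected_continuous_image[OF continuous_square_norm assms(1)])
  then have "{square_norm (x - a)..square_norm (y - a)} \<subseteq> (\<lambda>z. square_norm (z - a)) ` E"
    by (rule connected_contains_Icc) (use assms in auto)
  moreover have "s \<in> {square_norm (x - a)..square_norm (y - a)}" using assms by simp
  ultimately have "s \<in> (\<lambda>z. square_norm (z - a)) ` E" by blast
  then show ?thesis by blast
qed

context qc_map
begin

lemma ACL_horizontal:
  assumes "cbox u v \<subseteq> \<Omega>"
  shows "AE y in lborel. y \<in> {Im u..Im v} \<longrightarrow> abs_continuous_on_interval (\<lambda>x. F (Complex x y)) (Re u) (Re v)"
    and "AE x in lborel. x \<in> {Re u..Re v} \<longrightarrow> abs_continuous_on_interval (\<lambda>y. F (Complex x y)) (Im u) (Im v)"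
  using acl assms unfolding ACL_on_def by (auto simp: AE_completion_iff)

text \<open>The exceptional lines are fixed before the endpoints: one good line serves all pairs of
  its points. This matters because the points where the two connected sets cross a square vary with
  the square.\<close>

lemma oscillation_on_lines:
  fixes \<Psi> :: "complex \<Rightarrow> real"
  assumes box: "cbox u v \<subseteq> \<Omega>"
    and \<Psi>: "\<And>w. (\<Psi> has_derivative D\<Psi> w) (at w)" "\<And>w h. \<bar>D\<Psi> w h\<bar> \<le> g w * cmod h" "\<And>w. g w \<le> L"
    and L: "0 < L" and g0: "\<And>w. 0 \<le> g w" and g: "g \<in> borel_measurable borel"
  shows "AE y in lborel. y \<in> {Im u..Im v} \<longrightarrow> (\<forall>x1\<in>{Re u..Re v}. \<forall>x2\<in>{Re u..Re v}.
      ennreal \<bar>\<Psi> (F (Complex x2 y)) - \<Psi> (F (Complex x1 y))\<bar>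
        \<le> (\<integral>\<^sup>+x. ennreal (g (F0 (Complex x y)) * cmod (partial 1 (Complex x y))) * indicator (cbox u v) (Complex x y) \<partial>lborel))"
    and "AE x in lborel. x \<in> {Re u..Re v} \<longrightarrow> (\<forall>y1\<in>{Im u..Im v}. \<forall>y2\<in>{Im u..Im v}.
      ennreal \<bar>\<Psi> (F (Complex x y2)) - \<Psi> (F (Complex x y1))\<bar>
        \<le> (\<integral>\<^sup>+y. ennreal (g (F0 (Complex x y)) * cmod (partial \<i> (Complex x y))) * indicator (cbox u v) (Complex x y) \<partial>lborel))"
proof -
  have mC1: "(\<lambda>x. Complex x y) \<in> borel_measurable borel" for y
    unfolding Complex_eq by (intro borel_measurable_continuous_onI continuous_intros)
  have mC2: "(\<lambda>y. Complex x y) \<in> borel_measurable borel" for x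
    unfolding Complex_eq by (intro borel_measurable_continuous_onI continuous_intros)
  have m\<Theta>: "(\<lambda>z. ennreal (g (F0 z) * cmod (partial e z)) * indicator (cbox u v) z) \<in> borel_measurable borel" for e
    using measurable_compose[OF measurable_F0 g] by measurable
  show "AE y in lborel. y \<in> {Im u..Im v} \<longrightarrow> (\<forall>x1\<in>{Re u..Re v}. \<forall>x2\<in>{Re u..Re v}.
      ennreal \<bar>\<Psi> (F (Complex x2 y)) - \<Psi> (F (Complex x1 y))\<bar>
        \<le> (\<integral>\<^sup>+x. ennreal (g (F0 (Complex x y)) * cmod (partial 1 (Complex x y))) * indicator (cbox u v) (Complex x y) \<partial>lborel))"
    using ACL_horizontal(1)[OF box] AE_complex(1)[OF AE_partials]
  proof eventually_elim
    case (elim y)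
    show ?case
    proof (intro impI ballI)
      fix x1 x2 assume y: "y \<in> {Im u..Im v}" and x: "x1 \<in> {Re u..Re v}" "x2 \<in> {Re u..Re v}"
      have inb: "Complex x y \<in> cbox u v \<longleftrightarrow> x \<in> {Re u..Re v}" for x using y by (simp add: in_cbox_complex_iff)
      have inO: "Complex x y \<in> \<Omega>" if "x \<in> {Re u..Re v}" for x using inb box that by blast
      have eq: "ennreal (g (F0 (Complex x y)) * cmod (partial 1 (Complex x y))) * indicator (cbox u v) (Complex x y)
          = ennreal (g (F (Complex x y)) * cmod (partial 1 (Complex x y))) * indicator {Re u..Re v} x" for x
        using inb[of x] inO[of x] by (auto simp: indicator_def F0_def)
      show "ennreal \<bar>\<Psi> (F (Complex x2 y)) - \<Psi> (F (Complex x1 y))\<bar>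
        \<le> (\<integral>\<^sup>+x. ennreal (g (F0 (Complex x y)) * cmod (partial 1 (Complex x y))) * indicator (cbox u v) (Complex x y) \<partial>lborel)"
        unfolding eq
      proof (rule oscillation_along_line[OF _ _ \<Psi> L g0 _ x])
        show "abs_continuous_on_interval (\<lambda>x. F (Complex x y)) (Re u) (Re v)" using elim(1) y by blast
        show "(\<lambda>x. ennreal (g (F (Complex x y)) * cmod (partial 1 (Complex x y))) * indicator {Re u..Re v} x) \<in> borel_measurable borel"
          using measurable_compose[OF mC1[of y] m\<Theta>[of 1]] unfolding eq .
        show "AE x in lborel. x \<in> {Re u..Re v} \<longrightarrow> ((\<lambda>x. F (Complex x y)) has_vector_derivative partial 1 (Complex x y)) (at x)"
          using elim(2)
        proof eventually_elim
          case (elim x)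
          show ?case
          proof
            assume "x \<in> {Re u..Re v}"
            then have d: "((\<lambda>s. F (Complex x y + of_real s * 1)) has_vector_derivative partial 1 (Complex x y)) (at (x - x))"
              using elim inO by auto
            have "((\<lambda>x'. x' - x) has_vector_derivative 1) (at x)" by (auto intro!: derivative_eq_intros)
            from vector_diff_chain_at[OF this d]
            show "((\<lambda>x. F (Complex x y)) has_vector_derivative partial 1 (Complex x y)) (at x)"
              by (simp add: o_def complex_eq_iff Complex_eq algebra_simps)
          qed
        qed
      qed
    qed
  qed
  show "AE x in lborel. x \<in> {Re u..Re v} \<longrightarrow> (\<forall>y1\<in>{Im u..Im v}. \<forall>y2\<in>{Im u..Im v}.
      ennreal \<bar>\<Psi> (F (Complex x y2)) - \<Psi> (F (Complex x y1))\<bar>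
        \<le> (\<integral>\<^sup>+y. ennreal (g (F0 (Complex x y)) * cmod (partial \<i> (Complex x y))) * indicator (cbox u v) (Complex x y) \<partial>lborel))"
    using ACL_horizontal(2)[OF box] AE_complex(2)[OF AE_partials]
  proof eventually_elim
    case (elim x)
    show ?case
    proof (intro impI ballI)
      fix y1 y2 assume x: "x \<in> {Re u..Re v}" and y: "y1 \<in> {Im u..Im v}" "y2 \<in> {Im u..Im v}"
      have inb: "Complex x y \<in> cbox u v \<longleftrightarrow> y \<in> {Im u..Im v}" for y using x by (simp add: in_cbox_complex_iff)
      have inO: "Complex x y \<in> \<Omega>" if "y \<in> {Im u..Im v}" for y using inb box that by blast
      have eq: "ennreal (g (F0 (Complex x y)) * cmod (partial \<i> (Complex x y))) * indicator (cbox u v) (Complex x y)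
          = ennreal (g (F (Complex x y)) * cmod (partial \<i> (Complex x y))) * indicator {Im u..Im v} y" for y
        using inb[of y] inO[of y] by (auto simp: indicator_def F0_def)
      show "ennreal \<bar>\<Psi> (F (Complex x y2)) - \<Psi> (F (Complex x y1))\<bar>
        \<le> (\<integral>\<^sup>+y. ennreal (g (F0 (Complex x y)) * cmod (partial \<i> (Complex x y))) * indicator (cbox u v) (Complex x y) \<partial>lborel)"
        unfolding eq
      proof (rule oscillation_along_line[OF _ _ \<Psi> L g0 _ y])
        show "abs_continuous_on_interval (\<lambda>y. F (Complex x y)) (Im u) (Im v)" using elim(1) x by blast
        show "(\<lambda>y. ennreal (g (F (Complex x y)) * cmod (partial \<i> (Complex x y))) * indicator {Im u..Im v} y) \<in> borel_measurable borel"
          using measurable_compose[OF mC2[of x] m\<Theta>[of \<i>]] unfolding eq .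
        show "AE y in lborel. y \<in> {Im u..Im v} \<longrightarrow> ((\<lambda>y. F (Complex x y)) has_vector_derivative partial \<i> (Complex x y)) (at y)"
          using elim(2)
        proof eventually_elim
          case (elim y)
          show ?case
          proof
            assume "y \<in> {Im u..Im v}"
            then have d: "((\<lambda>s. F (Complex x y + of_real s * \<i>)) has_vector_derivative partial \<i> (Complex x y)) (at (y - y))"
              using elim inO by auto
            have "((\<lambda>y'. y' - y) has_vector_derivative 1) (at y)" by (auto intro!: derivative_eq_intros)
            from vector_diff_chain_at[OF this d]
            show "((\<lambda>y. F (Complex x y)) has_vector_derivative partial \<i> (Complex x y)) (at y)"
              by (simp add: o_def complex_eq_iff Complex_eq algebra_simps)
          qed
        qed
      qed
    qed
  qed
qed

definition dilatation :: real where
  "dilatation = (1 + k) / (1 - k)"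

lemma dilatation_pos: "1 \<le> dilatation"
  using k by (simp add: dilatation_def)

text \<open>Each of the N + 1 dyadic discs contributes at most 64 / R^2 times its area, which is
  bounded by 4 R^2.\<close>

lemma energy_bound:
  assumes Q: "compact Q" "Q \<subseteq> \<Omega>" and \<rho>: "0 < \<rho>" and L: "L = 2 ^ N * \<rho>"
  shows "(\<integral>\<^sup>+z. ennreal ((log_potential_slope c \<rho> L (F0 z))\<^sup>2 * \<bar>jac z\<bar>) * indicator Q z \<partial>lborel) \<le> ennreal (256 * real (N + 1))"
proof -
  have L0: "0 < L" using \<rho> L by simp
  define R where "R j = 2 ^ j * \<rho>" for j :: nat
  have R0: "0 < R j" for j using \<rho> by (simp add: R_def)
  define A where "A j = {z \<in> Q. F z \<in> cball c (R j)}" for j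
  have mA: "A j \<in> sets borel" for j
  proof -
    have "closed (Q \<inter> F -` cball c (R j))"
      using Q cont by (intro continuous_closed_preimage) (auto simp: compact_imp_closed intro: continuous_on_subset)
    moreover have "A j = Q \<inter> F -` cball c (R j)" by (auto simp: A_def)
    ultimately show ?thesis by (simp add: borel_closed)
  qed
  have "ennreal ((log_potential_slope c \<rho> L (F0 z))\<^sup>2 * \<bar>jac z\<bar>) * indicator Q z
      \<le> (\<Sum>j\<le>N. ennreal (64 / (R j)\<^sup>2) * (ennreal \<bar>jac z\<bar> * indicator (A j) z))" for z
  proof (cases "z \<in> Q")
    case True
    then have z: "F0 z = F z" using Q by (auto simp: F0_def)
    have "(log_potential_slope c \<rho> L (F0 z))\<^sup>2 * \<bar>jac z\<bar>
        \<le> (\<Sum>j\<le>N. 64 / (R j)\<^sup>2 * indicator (cball c (R j)) (F z)) * \<bar>jac z\<bar>"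
      unfolding z R_def by (intro mult_right_mono slope_square_le[OF \<rho> L0 L]) auto
    also have "\<dots> = (\<Sum>j\<le>N. 64 / (R j)\<^sup>2 * (\<bar>jac z\<bar> * indicator (A j) z))"
      unfolding sum_distrib_right using True by (intro sum.cong) (auto simp: A_def indicator_def)
    finally have "ennreal ((log_potential_slope c \<rho> L (F0 z))\<^sup>2 * \<bar>jac z\<bar>)
       \<le> ennreal (\<Sum>j\<le>N. 64 / (R j)\<^sup>2 * (\<bar>jac z\<bar> * indicator (A j) z))" by (rule ennreal_leI)
    also have "\<dots> = (\<Sum>j\<le>N. ennreal (64 / (R j)\<^sup>2 * (\<bar>jac z\<bar> * indicator (A j) z)))"
      by (subst sum_ennreal) auto
    also have "\<dots> = (\<Sum>j\<le>N. ennreal (64 / (R j)\<^sup>2) * (ennreal \<bar>jac z\<bar> * indicator (A j) z))"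
      by (intro sum.cong refl) (simp add: ennreal_mult[symmetric] indicator_def)
    finally show ?thesis using True by simp
  qed simp
  then have "(\<integral>\<^sup>+z. ennreal ((log_potential_slope c \<rho> L (F0 z))\<^sup>2 * \<bar>jac z\<bar>) * indicator Q z \<partial>lborel)
      \<le> (\<integral>\<^sup>+z. (\<Sum>j\<le>N. ennreal (64 / (R j)\<^sup>2) * (ennreal \<bar>jac z\<bar> * indicator (A j) z)) \<partial>lborel)"
    by (intro nn_integral_mono)
  also have "\<dots> = (\<Sum>j\<le>N. ennreal (64 / (R j)\<^sup>2) * (\<integral>\<^sup>+z. ennreal \<bar>jac z\<bar> * indicator (A j) z \<partial>lborel))"
  proof -
    have m: "(\<lambda>z. ennreal \<bar>jac z\<bar> * indicator (A j) z) \<in> borel_measurable lborel" for j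
      using mA[of j] measurable_jac by measurable
    show ?thesis using m by (subst nn_integral_sum) (auto simp: nn_integral_cmult)
  qed
  also have "\<dots> \<le> (\<Sum>j\<le>N. ennreal 256)"
  proof (rule sum_mono)
    fix j
    have "(\<integral>\<^sup>+z. ennreal \<bar>jac z\<bar> * indicator (A j) z \<partial>lborel) \<le> emeasure lborel (cball c (R j))"
      unfolding A_def by (rule area_inequality[OF Q]) simp
    also have "\<dots> \<le> ennreal (4 * (R j)\<^sup>2)" by (rule emeasure_cball_le[OF R0])
    finally have "ennreal (64 / (R j)\<^sup>2) * (\<integral>\<^sup>+z. ennreal \<bar>jac z\<bar> * indicator (A j) z \<partial>lborel)
        \<le> ennreal (64 / (R j)\<^sup>2) * ennreal (4 * (R j)\<^sup>2)" by (intro mult_left_mono) auto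
    also have "\<dots> = ennreal 256"
      using R0[of j] by (subst ennreal_mult[symmetric]) (auto simp: field_simps)
    finally show "ennreal (64 / (R j)\<^sup>2) * (\<integral>\<^sup>+z. ennreal \<bar>jac z\<bar> * indicator (A j) z \<partial>lborel) \<le> ennreal 256" .
  qed
  also have "\<dots> = ennreal (256 * real (N + 1))"
    by (subst sum_ennreal) (auto simp: mult.commute)
  finally show ?thesis .
qed

lemma measurable_slope: "log_potential_slope c \<rho> L \<in> borel_measurable borel"
proof -
  have 1: "(\<lambda>w. (cmod (w - c))\<^sup>2) \<in> borel_measurable borel"
    by (intro borel_measurable_continuous_onI continuous_intros)
  have 2: "cutoff L \<in> borel_measurable borel"
    unfolding cutoff_def[abs_def] divide_inverse by (intro borel_measurable_continuous_onI continuous_intros)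
  show ?thesis
    unfolding log_potential_slope_def[abs_def]
    using measurable_compose[OF 1 2] 1 by measurable
qed

text \<open>For almost every \<open>s\<close> between \<open>\<delta>/4\<close> and \<open>\<delta>/2\<close>, the boundary of the square of half-side \<open>s\<close> about \<^term>\<open>a\<close>
  meets \<^term>\<open>E\<close> and \<^term>\<open>E'\<close>, so that \<^term>\<open>log_potential\<close> oscillates along it by at least a multiple of \<^term>\<open>N\<close>.
  The energy of the potential grows only linearly in \<^term>\<open>N\<close>; the weight \<open>\<mu>\<close> in the inequality
  \<open>2 \<mu> x \<le> \<mu>\<^sup>2 + x\<^sup>2\<close> is chosen so that this growth is less than that of the oscillation.\<close>

lemma box_modulus_bound:
  assumes box: "cbox (a - Complex \<delta> \<delta>) (a + Complex \<delta> \<delta>) \<subseteq> \<Omega>" and \<delta>: "0 < \<delta>" and \<rho>: "0 < \<rho>"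
    and E: "connected E" "a \<in> E" "e \<in> E" "\<delta> \<le> cmod (e - a)" "\<And>z. z \<in> E \<Longrightarrow> cmod (F z - c) \<le> \<rho>"
    and E': "connected E'" "b \<in> E'" "e' \<in> E'" "cmod (b - a) \<le> \<delta> / 4" "\<delta> \<le> cmod (e' - a)"
      "\<And>z. z \<in> E' \<Longrightarrow> 2 ^ N * \<rho> \<le> cmod (F z - c)"
  shows "real N \<le> 1048576 * dilatation + 3"
proof (cases "N = 0")
  case True
  then show ?thesis using dilatation_pos by simp
next
  case False
  define L where "L = 2 ^ N * \<rho>"
  have L0: "0 < L" using \<rho> by (simp add: L_def)
  define u where "u = a - Complex \<delta> \<delta>"
  define v where "v = a + Complex \<delta> \<delta>"
  have uv: "Re u = Re a - \<delta>" "Re v = Re a + \<delta>" "Im u = Im a - \<delta>" "Im v = Im a + \<delta>"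
    by (simp_all add: u_def v_def)
  have Q: "compact (cbox u v)" "cbox u v \<subseteq> \<Omega>" using box by (auto simp: u_def v_def)
  define g where "g = log_potential_slope c \<rho> L"
  define \<Psi> where "\<Psi> = log_potential c \<rho> L"
  define f where "f z = \<Psi> (F z)" for z
  have mg: "g \<in> borel_measurable borel" unfolding g_def by (rule measurable_slope)
  define \<Theta> where "\<Theta> = (\<lambda>d z. ennreal (g (F0 z) * cmod (partial d z)) * indicator (cbox u v) z)"
  have m\<Theta>: "\<Theta> d \<in> borel_measurable borel" for d
    unfolding \<Theta>_def using measurable_compose[OF measurable_F0 mg] by measurable
  define W where "W y = (\<integral>\<^sup>+x. \<Theta> 1 (Complex x y) \<partial>lborel)" for y
  define V where "V x = (\<integral>\<^sup>+y. \<Theta> \<i> (Complex x y) \<partial>lborel)" for x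
  have mC: "(\<lambda>(x, y). Complex x y) \<in> borel_measurable (lborel \<Otimes>\<^sub>M lborel)"
    unfolding lborel_prod by (simp add: borel_measurable_continuous_onI Complex_eq case_prod_unfold continuous_intros)
  have mC': "(\<lambda>(y, x). Complex x y) \<in> borel_measurable (lborel \<Otimes>\<^sub>M lborel)"
    unfolding lborel_prod by (simp add: borel_measurable_continuous_onI Complex_eq case_prod_unfold continuous_intros)
  have mV: "V \<in> borel_measurable borel"
  proof -
    have "(\<lambda>x. \<integral>\<^sup>+y. \<Theta> \<i> (Complex x y) \<partial>lborel) \<in> borel_measurable lborel"
      using measurable_compose[OF mC m\<Theta>[of \<i>]]
      by (intro lborel.borel_measurable_nn_integral) (simp add: case_prod_unfold)
    then show ?thesis by (simp add: V_def[abs_def])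
  qed
  have mW: "W \<in> borel_measurable borel"
  proof -
    have "(\<lambda>y. \<integral>\<^sup>+x. \<Theta> 1 (Complex x y) \<partial>lborel) \<in> borel_measurable lborel"
      using measurable_compose[OF mC' m\<Theta>[of 1]]
      by (intro lborel.borel_measurable_nn_integral) (simp add: case_prod_unfold)
    then show ?thesis by (simp add: W_def[abs_def])
  qed
  have Lpos: "0 < 4 / \<rho>" using \<rho> by simp
  note osc = oscillation_on_lines[OF Q(2) log_potential_deriv[OF \<rho> L0] log_potential_deriv_le[OF \<rho> L0]
      slope_le[OF \<rho> L0] Lpos slope_nonneg[OF \<rho> L0] measurable_slope, of c,
      folded g_def \<Psi>_def f_def, unfolded uv]
  have oscW: "AE y in lborel. y \<in> {Im a - \<delta>..Im a + \<delta>} \<longrightarrow> (\<forall>x1\<in>{Re a - \<delta>..Re a + \<delta>}. \<forall>x2\<in>{Re a - \<delta>..Re a + \<delta>}.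
      ennreal \<bar>f (Complex x2 y) - f (Complex x1 y)\<bar> \<le> W y)"
    using osc(1) unfolding W_def \<Theta>_def .
  have oscV: "AE x in lborel. x \<in> {Re a - \<delta>..Re a + \<delta>} \<longrightarrow> (\<forall>y1\<in>{Im a - \<delta>..Im a + \<delta>}. \<forall>y2\<in>{Im a - \<delta>..Im a + \<delta>}.
      ennreal \<bar>f (Complex x y2) - f (Complex x y1)\<bar> \<le> V x)"
    using osc(2) unfolding V_def \<Theta>_def .
  \<comment> \<open>\<open>V\<close> and \<open>W\<close> integrate over the full width of the box
    and therefore bound the oscillation on the sides of all smaller squares. The factors 1 and -1
    are written out to match \<open>AE_lborel_affine\<close>.\<close>
  define tot where "tot s = V (Re a + 1 * s) + V (Re a + (-1) * s) + W (Im a + 1 * s) + W (Im a + (-1) * s)" for s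
  have nz: "(1::real) \<noteq> 0" "(-1::real) \<noteq> 0" by simp_all
  have AEs: "AE s in lborel. s \<in> {\<delta>/4<..<\<delta>/2} \<longrightarrow> ennreal (real N - 1) \<le> 2 * tot s"
    using AE_lborel_affine[OF oscV nz(1), of "Re a"] AE_lborel_affine[OF oscV nz(2), of "Re a"]
      AE_lborel_affine[OF oscW nz(1), of "Im a"] AE_lborel_affine[OF oscW nz(2), of "Im a"]
  proof eventually_elim
    case (elim s)
    show ?case
    proof
      assume s: "s \<in> {\<delta>/4<..<\<delta>/2}"
      have rng: "Re a + t \<in> {Re a - \<delta>..Re a + \<delta>}" "Im a + t \<in> {Im a - \<delta>..Im a + \<delta>}" if "\<bar>t\<bar> \<le> s" for t
        using s that by auto
      have tri: "ennreal \<bar>x - z\<bar> \<le> A + B" if "ennreal \<bar>x - y\<bar> \<le> A" "ennreal \<bar>y - z\<bar> \<le> B" for x y z :: real and A B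
      proof -
        have "ennreal \<bar>x - z\<bar> \<le> ennreal (\<bar>x - y\<bar> + \<bar>y - z\<bar>)" by (intro ennreal_leI) linarith
        also have "\<dots> = ennreal \<bar>x - y\<bar> + ennreal \<bar>y - z\<bar>" by simp
        also have "\<dots> \<le> A + B" by (intro add_mono that)
        finally show ?thesis .
      qed
      define P where "P s1 s2 = Complex (Re a + s1) (Im a + s2)" for s1 s2
      have R: "ennreal \<bar>f (P s t) - f (P s t')\<bar> \<le> V (Re a + 1 * s)" if "\<bar>t\<bar> \<le> s" "\<bar>t'\<bar> \<le> s" for t t'
        using elim(1) rng[of s] rng(2)[OF that(1)] rng(2)[OF that(2)] s \<delta> by (simp add: P_def)
      have Lf: "ennreal \<bar>f (P (-s) t) - f (P (-s) t')\<bar> \<le> V (Re a + (-1) * s)" if "\<bar>t\<bar> \<le> s" "\<bar>t'\<bar> \<le> s" for t t'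
        using elim(2) rng[of "-s"] rng(2)[OF that(1)] rng(2)[OF that(2)] s \<delta> by (simp add: P_def)
      have T: "ennreal \<bar>f (P t s) - f (P t' s)\<bar> \<le> W (Im a + 1 * s)" if "\<bar>t\<bar> \<le> s" "\<bar>t'\<bar> \<le> s" for t t'
        using elim(3) rng[of s] rng(1)[OF that(1)] rng(1)[OF that(2)] s \<delta> by (simp add: P_def)
      have Bt: "ennreal \<bar>f (P t (-s)) - f (P t' (-s))\<bar> \<le> W (Im a + (-1) * s)" if "\<bar>t\<bar> \<le> s" "\<bar>t'\<bar> \<le> s" for t t'
        using elim(4) rng[of "-s"] rng(1)[OF that(1)] rng(1)[OF that(2)] s \<delta> by (simp add: P_def)
      have s0: "\<bar>s\<bar> \<le> s" "\<bar>-s\<bar> \<le> s" using s \<delta> by auto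
      \<comment> \<open>Each point of the square is joined to one corner along at most two sides.
        Two points are then joined through the corner, whence the factor 2 in
        \<open>AEs\<close>.\<close>
      have corner: "ennreal \<bar>f z - f (P s s)\<bar> \<le> tot s" if z: "square_norm (z - a) = s" for z
      proof -
        define t1 where "t1 = Re z - Re a"
        define t2 where "t2 = Im z - Im a"
        have zP: "z = P t1 t2" by (simp add: P_def t1_def t2_def complex_eq_iff)
        have m: "max \<bar>t1\<bar> \<bar>t2\<bar> = s" using z by (simp add: square_norm_def t1_def t2_def)
        then have le: "\<bar>t1\<bar> \<le> s" "\<bar>t2\<bar> \<le> s" by auto
        consider "t1 = s" | "t1 = -s" | "t2 = s" | "t2 = -s" using m by (auto simp: max_def abs_if split: if_splits)
        then show ?thesis
        proof cases
          case 1
          have "ennreal \<bar>f z - f (P s s)\<bar> \<le> V (Re a + 1 * s)" unfolding zP 1 by (rule R[OF le(2) s0(1)])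
          also have "\<dots> \<le> tot s" unfolding tot_def by (simp add: add.assoc)
          finally show ?thesis .
        next
          case 2
          have "ennreal \<bar>f z - f (P s s)\<bar> \<le> V (Re a + (-1) * s) + W (Im a + 1 * s)"
            unfolding zP 2 by (rule tri[OF Lf[OF le(2) s0(1)] T[OF s0(2,1)]])
          also have "\<dots> \<le> tot s" unfolding tot_def by (intro add_mono add_increasing2 add_increasing) auto
          finally show ?thesis .
        next
          case 3
          have "ennreal \<bar>f z - f (P s s)\<bar> \<le> W (Im a + 1 * s)" unfolding zP 3 by (rule T[OF le(1) s0(1)])
          also have "\<dots> \<le> tot s" unfolding tot_def by (intro add_increasing2 add_increasing) auto
          finally show ?thesis .
        next
          case 4
          have "ennreal \<bar>f z - f (P s s)\<bar> \<le> W (Im a + (-1) * s) + V (Re a + 1 * s)"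
            unfolding zP 4 by (rule tri[OF Bt[OF le(1) s0(1)] R[OF s0(2,1)]])
          also have "\<dots> \<le> tot s" unfolding tot_def
            by (subst add.commute) (intro add_mono add_increasing2 add_increasing order_refl; simp)
          finally show ?thesis .
        qed
      qed
      \<comment> \<open>Both sets cross the square: \<open>E\<close> leads from the centre, and
        \<open>E'\<close> from sup-distance at most \<delta>/4, to sup-distance at least
        \<delta>/2.\<close>
      have "square_norm (a - a) \<le> s" using s \<delta> by (simp add: square_norm_def)
      moreover have "s \<le> square_norm (e - a)" using square_norm_ge[of "e - a"] E(4) s by simp
      ultimately obtain z1 where z1: "z1 \<in> E" "square_norm (z1 - a) = s"
        using connected_meets_square[OF E(1-3)] by blast
      have "square_norm (b - a) \<le> s" using square_norm_le[of "b - a"] E'(4) s by simp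
      moreover have "s \<le> square_norm (e' - a)" using square_norm_ge[of "e' - a"] E'(5) s by simp
      ultimately obtain z2 where z2: "z2 \<in> E'" "square_norm (z2 - a) = s"
        using connected_meets_square[OF E'(1-3)] by blast
      have "real N - 1 \<le> f z2 - f z1"
        unfolding f_def \<Psi>_def
        by (rule log_potential_gap[OF \<rho> L0 L_def E(5)[OF z1(1)]]) (use E'(6)[OF z2(1)] in \<open>simp add: L_def\<close>)
      then have "ennreal (real N - 1) \<le> ennreal \<bar>f z2 - f z1\<bar>" by (intro ennreal_leI) linarith
      also have "\<dots> \<le> tot s + tot s"
      proof (rule tri[OF corner[OF z2(2)]])
        show "ennreal \<bar>f (P s s) - f z1\<bar> \<le> tot s" using corner[OF z1(2)] by (simp add: abs_minus_commute)
      qed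
      finally show "ennreal (real N - 1) \<le> 2 * tot s" by (simp add: mult_2)
    qed
  qed
  have mtot: "tot \<in> borel_measurable borel"
  proof -
    have "(\<lambda>s. h (t + k * s)) \<in> borel_measurable borel" if "h \<in> borel_measurable borel" for h :: "real \<Rightarrow> ennreal" and t k
      by (rule measurable_compose[OF _ that]) simp
    then show ?thesis unfolding tot_def[abs_def] using mV mW by (intro borel_measurable_add) auto
  qed
  \<comment> \<open>Fubini and invariance of the measure under reflections and translations;
    opposite sides count each area integral twice.\<close>
  have inttot: "(\<integral>\<^sup>+s. tot s \<partial>lborel) = 2 * (\<integral>\<^sup>+z. \<Theta> \<i> z \<partial>lborel) + 2 * (\<integral>\<^sup>+z. \<Theta> 1 z \<partial>lborel)"
  proof -
    have aff: "(\<integral>\<^sup>+s. h (t + k * s) \<partial>lborel) = (\<integral>\<^sup>+s. h s \<partial>lborel)"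
      if "h \<in> borel_measurable borel" "\<bar>k\<bar> = 1" for h :: "real \<Rightarrow> ennreal" and t k
      using nn_integral_real_affine[OF that(1), of k t] that(2) by (cases "k = 0") auto
    have m: "(\<lambda>s. h (t + k * s)) \<in> borel_measurable lborel" if "h \<in> borel_measurable borel" for h :: "real \<Rightarrow> ennreal" and t k
      using measurable_compose[OF _ that, of "\<lambda>s. t + k * s"] by simp
    have "(\<integral>\<^sup>+s. tot s \<partial>lborel) = (\<integral>\<^sup>+s. V (Re a + 1 * s) \<partial>lborel) + (\<integral>\<^sup>+s. V (Re a + (-1) * s) \<partial>lborel)
       + (\<integral>\<^sup>+s. W (Im a + 1 * s) \<partial>lborel) + (\<integral>\<^sup>+s. W (Im a + (-1) * s) \<partial>lborel)"
      unfolding tot_def using m[OF mV, of "Re a" 1] m[OF mV, of "Re a" "-1"] m[OF mW, of "Im a" 1] m[OF mW, of "Im a" "-1"]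
      by (simp add: nn_integral_add borel_measurable_add)
    also have "\<dots> = (\<integral>\<^sup>+s. V s \<partial>lborel) + (\<integral>\<^sup>+s. V s \<partial>lborel) + (\<integral>\<^sup>+s. W s \<partial>lborel) + (\<integral>\<^sup>+s. W s \<partial>lborel)"
      using aff[OF mV, of 1 "Re a"] aff[OF mV, of "-1" "Re a"] aff[OF mW, of 1 "Im a"] aff[OF mW, of "-1" "Im a"]
      by simp
    also have "(\<integral>\<^sup>+s. V s \<partial>lborel) = (\<integral>\<^sup>+z. \<Theta> \<i> z \<partial>lborel)"
      unfolding V_def by (rule nn_integral_complex(2)[OF m\<Theta>, symmetric])
    also have "(\<integral>\<^sup>+s. W s \<partial>lborel) = (\<integral>\<^sup>+z. \<Theta> 1 z \<partial>lborel)"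
      unfolding W_def by (rule nn_integral_complex(1)[OF m\<Theta>, symmetric])
    finally show ?thesis by (simp add: mult_2 add.assoc)
  qed
  define K where "K = dilatation"
  have K: "1 \<le> K" using dilatation_pos by (simp add: K_def)
  \<comment> \<open>With this weight the energy term in 8 Y becomes \<delta> (N + 1) / 8, which
    grows with \<open>N\<close> at half the rate of the lower bound \<delta> (N - 1) / 4.\<close>
  define \<mu> where "\<mu> = 8192 * K / \<delta>"
  have \<mu>: "0 < \<mu>" using K \<delta> by (simp add: \<mu>_def)
  have \<Theta>le: "(\<integral>\<^sup>+z. \<Theta> d z \<partial>lborel) \<le> ennreal (2 * \<mu> * \<delta>\<^sup>2 + 128 * K * real (N + 1) / \<mu>)" if d: "d \<in> {1, \<i>}" for d
  proof -
    have "AE z in lborel. \<Theta> d z \<le> ennreal (\<mu> / 2) * indicator (cbox u v) z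
        + ennreal (K / (2 * \<mu>)) * (ennreal ((g (F0 z))\<^sup>2 * \<bar>jac z\<bar>) * indicator (cbox u v) z)"
      using AE_partials
    proof eventually_elim
      case (elim z)
      show ?case
      proof (cases "z \<in> cbox u v")
        case True
        then have "z \<in> \<Omega>" using Q by blast
        then have pd: "(cmod (partial d z))\<^sup>2 \<le> K * jac z"
          using elim d by (auto simp: K_def dilatation_def)
        define x where "x = g (F0 z) * cmod (partial d z)"
        have "x\<^sup>2 = (g (F0 z))\<^sup>2 * (cmod (partial d z))\<^sup>2" by (simp add: x_def power_mult_distrib)
        also have "\<dots> \<le> (g (F0 z))\<^sup>2 * (K * \<bar>jac z\<bar>)"
          using pd K by (intro mult_left_mono order_trans[OF pd]) auto
        finally have x2: "x\<^sup>2 \<le> K * ((g (F0 z))\<^sup>2 * \<bar>jac z\<bar>)" by (simp add: mult_ac)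
        have "0 \<le> (x - \<mu>)\<^sup>2" by simp
        then have "2 * \<mu> * x \<le> \<mu>\<^sup>2 + x\<^sup>2" by (simp add: power2_eq_square algebra_simps)
        then have "x \<le> \<mu> / 2 + x\<^sup>2 / (2 * \<mu>)" using \<mu> by (simp add: field_simps power2_eq_square)
        also have "\<dots> \<le> \<mu> / 2 + K * ((g (F0 z))\<^sup>2 * \<bar>jac z\<bar>) / (2 * \<mu>)"
          using x2 \<mu> by (intro add_left_mono divide_right_mono) auto
        also have "\<dots> = \<mu> / 2 + K / (2 * \<mu>) * ((g (F0 z))\<^sup>2 * \<bar>jac z\<bar>)" by simp
        finally have "ennreal x \<le> ennreal (\<mu> / 2 + K / (2 * \<mu>) * ((g (F0 z))\<^sup>2 * \<bar>jac z\<bar>))" by (rule ennreal_leI)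
        also have "\<dots> = ennreal (\<mu> / 2) + ennreal (K / (2 * \<mu>)) * ennreal ((g (F0 z))\<^sup>2 * \<bar>jac z\<bar>)"
          using \<mu> K by (simp add: ennreal_mult[symmetric])
        finally show ?thesis using True by (simp add: \<Theta>_def x_def)
      qed (simp add: \<Theta>_def)
    qed
    then have "(\<integral>\<^sup>+z. \<Theta> d z \<partial>lborel) \<le> (\<integral>\<^sup>+z. ennreal (\<mu> / 2) * indicator (cbox u v) z
        + ennreal (K / (2 * \<mu>)) * (ennreal ((g (F0 z))\<^sup>2 * \<bar>jac z\<bar>) * indicator (cbox u v) z) \<partial>lborel)"
      by (rule nn_integral_mono_AE)
    also have "\<dots> = ennreal (\<mu> / 2) * emeasure lborel (cbox u v)
        + ennreal (K / (2 * \<mu>)) * (\<integral>\<^sup>+z. ennreal ((g (F0 z))\<^sup>2 * \<bar>jac z\<bar>) * indicator (cbox u v) z \<partial>lborel)"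
    proof -
      have m: "(\<lambda>z. ennreal ((g (F0 z))\<^sup>2 * \<bar>jac z\<bar>) * indicator (cbox u v) z) \<in> borel_measurable lborel"
        using measurable_compose[OF measurable_F0 mg] measurable_jac by measurable
      show ?thesis
        using m by (subst nn_integral_add) (auto simp: nn_integral_cmult nn_integral_cmult_indicator)
    qed
    also have "\<dots> \<le> ennreal (\<mu> / 2) * ennreal (4 * \<delta>\<^sup>2) + ennreal (K / (2 * \<mu>)) * ennreal (256 * real (N + 1))"
    proof (intro add_mono mult_left_mono)
      show "emeasure lborel (cbox u v) \<le> ennreal (4 * \<delta>\<^sup>2)"
        using \<delta> by (simp add: emeasure_lborel_cbox_eq Basis_complex_def u_def v_def power2_eq_square)
      show "(\<integral>\<^sup>+z. ennreal ((g (F0 z))\<^sup>2 * \<bar>jac z\<bar>) * indicator (cbox u v) z \<partial>lborel) \<le> ennreal (256 * real (N + 1))"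
        unfolding g_def by (rule energy_bound[OF Q \<rho> L_def])
    qed auto
    also have "\<dots> = ennreal (\<mu> / 2 * (4 * \<delta>\<^sup>2) + K / (2 * \<mu>) * (256 * real (N + 1)))"
    proof -
      have "ennreal (\<mu> / 2) * ennreal (4 * \<delta>\<^sup>2) = ennreal (\<mu> / 2 * (4 * \<delta>\<^sup>2))"
        using \<mu> by (intro ennreal_mult[symmetric]) auto
      moreover have "ennreal (K / (2 * \<mu>)) * ennreal (256 * real (N + 1)) = ennreal (K / (2 * \<mu>) * (256 * real (N + 1)))"
        using \<mu> K by (intro ennreal_mult[symmetric]) auto
      moreover have "0 \<le> \<mu> / 2 * (4 * \<delta>\<^sup>2)" "0 \<le> K / (2 * \<mu>) * (256 * real (N + 1))"
        using \<mu> K by (auto intro!: mult_nonneg_nonneg divide_nonneg_nonneg)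
      ultimately show ?thesis by (simp only: ennreal_plus)
    qed
    also have "\<mu> / 2 * (4 * \<delta>\<^sup>2) + K / (2 * \<mu>) * (256 * real (N + 1)) = 2 * \<mu> * \<delta>\<^sup>2 + 128 * K * real (N + 1) / \<mu>"
      using \<mu> by (simp add: field_simps)
    finally show ?thesis .
  qed
  define Y where "Y = 2 * \<mu> * \<delta>\<^sup>2 + 128 * K * real (N + 1) / \<mu>"
  have Y0: "0 \<le> Y" using \<mu> K by (simp add: Y_def)
  have "ennreal ((real N - 1) * (\<delta> / 4)) = ennreal (real N - 1) * emeasure lborel {\<delta>/4<..<\<delta>/2}"
    using \<delta> False by (simp add: ennreal_mult[symmetric])
  also have "\<dots> = (\<integral>\<^sup>+s. ennreal (real N - 1) * indicator {\<delta>/4<..<\<delta>/2} s \<partial>lborel)"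
    by (simp add: nn_integral_cmult_indicator)
  also have "\<dots> \<le> (\<integral>\<^sup>+s. 2 * tot s \<partial>lborel)"
  proof (rule nn_integral_mono_AE)
    show "AE s in lborel. ennreal (real N - 1) * indicator {\<delta>/4<..<\<delta>/2} s \<le> 2 * tot s"
      using AEs
    proof eventually_elim
      case (elim s)
      then show ?case by (cases "s \<in> {\<delta>/4<..<\<delta>/2}") auto
    qed
  qed
  also have "\<dots> = 2 * (\<integral>\<^sup>+s. tot s \<partial>lborel)"
    using mtot by (simp add: nn_integral_cmult)
  also have "\<dots> \<le> 2 * (2 * ennreal Y + 2 * ennreal Y)"
    unfolding inttot Y_def by (intro mult_left_mono add_mono \<Theta>le) auto
  also have "\<dots> = ennreal (8 * Y)"
  proof -
    have dbl: "2 * ennreal x = ennreal (2 * x)" if "0 \<le> x" for x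
      using that by (simp add: ennreal_mult')
    have "ennreal (2 * Y) + ennreal (2 * Y) = ennreal (2 * Y + 2 * Y)"
      using Y0 by (intro ennreal_plus[symmetric]) auto
    moreover have "2 * ennreal (2 * Y + 2 * Y) = ennreal (2 * (2 * Y + 2 * Y))"
      using Y0 by (intro dbl) auto
    ultimately show ?thesis unfolding dbl[OF Y0] by simp
  qed
  finally have "(real N - 1) * (\<delta> / 4) \<le> 8 * Y"
    using Y0 by (simp add: ennreal_le_iff)
  also have "8 * Y = \<delta> * (131072 * K + (real N + 1) / 8)"
    using K \<delta> by (simp add: Y_def \<mu>_def field_simps power2_eq_square)
  finally have "\<delta> * ((real N - 1) / 4) \<le> \<delta> * (131072 * K + (real N + 1) / 8)" by (simp add: mult.commute)
  then have "(real N - 1) / 4 \<le> 131072 * K + (real N + 1) / 8" using \<delta> by simp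
  then have "2 * (real N - 1) \<le> 1048576 * K + (real N + 1)" by (simp add: field_simps)
  then show ?thesis unfolding K_def by (simp add: algebra_simps)
qed

section \<open>Weak quasisymmetry of quasiconformal maps near infinity\<close>

definition F_inv :: "complex \<Rightarrow> complex" where
  "F_inv = the_inv_into \<Omega> F"

lemma F_inv: "w \<in> F ` \<Omega> \<Longrightarrow> F_inv w \<in> \<Omega>" "w \<in> F ` \<Omega> \<Longrightarrow> F (F_inv w) = w"
  "z \<in> \<Omega> \<Longrightarrow> F_inv (F z) = z"
  using the_inv_into_into[OF inj _ order_refl] f_the_inv_into_f[OF inj] the_inv_into_f_f[OF inj]
  by (auto simp: F_inv_def)

lemma continuous_F_inv: "continuous_on (F ` \<Omega>) F_inv"
proof -
  obtain g where g: "homeomorphism \<Omega> (F ` \<Omega>) F g"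
    using invariance_of_domain_homeomorphism[OF open_\<Omega> cont _ inj] by auto
  then have "continuous_on (F ` \<Omega>) g" by (simp add: homeomorphism_def)
  moreover have "g w = F_inv w" if "w \<in> F ` \<Omega>" for w
    using g that F_inv(3) by (auto simp: homeomorphism_def)
  ultimately show ?thesis using continuous_on_cong by (metis (no_types, lifting))
qed

text \<open>The exponent exceeds the bound that \<open>box_modulus_bound\<close> puts on the number
  of dyadic scales.\<close>

definition qs_const :: real where
  "qs_const = 2 ^ (nat \<lceil>1048576 * dilatation + 3\<rceil> + 1)"

lemma qs_const_pos: "1 \<le> qs_const"
  unfolding qs_const_def by (rule one_le_power) simp

text \<open>If \<open>l\<close> were larger, too many dyadic scales would lie between the images of
  \<open>E\<close> and \<open>E'\<close>. The square of half-side \<delta> fits into the ball of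
  radius 2 \<delta>, as sqrt 2 < 2.\<close>

lemma separation_bound:
  assumes box: "ball a (2 * \<delta>) \<subseteq> \<Omega>" and \<delta>: "0 < \<delta>" and \<rho>: "0 < \<rho>"
    and E: "connected E" "a \<in> E" "e \<in> E" "\<delta> \<le> cmod (e - a)" "\<And>z. z \<in> E \<Longrightarrow> cmod (F z - c) \<le> \<rho>"
    and E': "connected E'" "b \<in> E'" "e' \<in> E'" "cmod (b - a) \<le> \<delta> / 4" "\<delta> \<le> cmod (e' - a)"
      "\<And>z. z \<in> E' \<Longrightarrow> l \<le> cmod (F z - c)"
  shows "l \<le> qs_const * \<rho>"
proof (rule ccontr)
  define N where "N = nat \<lceil>1048576 * dilatation + 3\<rceil> + 1"
  assume "\<not> ?thesis"
  then have l: "2 ^ N * \<rho> \<le> l" by (simp add: qs_const_def N_def)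
  have "cbox (a - Complex \<delta> \<delta>) (a + Complex \<delta> \<delta>) \<subseteq> ball a (2 * \<delta>)"
  proof
    fix z assume "z \<in> cbox (a - Complex \<delta> \<delta>) (a + Complex \<delta> \<delta>)"
    then have "\<bar>Re (z - a)\<bar> \<le> \<delta>" "\<bar>Im (z - a)\<bar> \<le> \<delta>" by (auto simp: in_cbox_complex_iff)
    then have "(cmod (z - a))\<^sup>2 \<le> \<delta>\<^sup>2 + \<delta>\<^sup>2"
      unfolding cmod_power2 using \<delta> by (intro add_mono) (auto simp: abs_le_square_iff[symmetric])
    also have "\<dots> < (2 * \<delta>)\<^sup>2" using \<delta> by (simp add: power2_eq_square)
    finally have "cmod (z - a) < 2 * \<delta>" by (rule power2_less_imp_less) (use \<delta> in simp)
    then show "z \<in> ball a (2 * \<delta>)" by (simp add: dist_norm norm_minus_commute)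
  qed
  then have "cbox (a - Complex \<delta> \<delta>) (a + Complex \<delta> \<delta>) \<subseteq> \<Omega>" using box by blast
  from box_modulus_bound[OF this \<delta> \<rho> E E'(1-5), of N]
  have "real N \<le> 1048576 * dilatation + 3" using l E'(6) by (meson order_trans)
  then show False unfolding N_def by linarith
qed

end

locale qc_map_at_infinity = qc_map F "{z. M < cmod z}" k for F M k +
  assumes M: "0 < M" and F_inf: "filterlim F at_infinity at_infinity"
begin

text \<open>The image is both open and closed relative to the connected set \<open>V\<close> outside
  a large disc: open by invariance of domain, closed because \<open>F\<close> tends to infinity and
  \<open>V\<close> avoids the image of the bounding circle.\<close>

lemma image_contains_nhd_of_infinity:
  obtains R where "0 < R" "{w. R < cmod w} \<subseteq> F ` {z. M < cmod z}"
proof -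
  \<comment> \<open>The radius M + 1 keeps the circle inside the domain of \<open>F\<close>.\<close>
  define K where "K = F ` sphere 0 (M + 1)"
  have contS: "continuous_on {z. M + 1 \<le> cmod z} F"
    using M by (intro continuous_on_subset[OF cont]) auto
  have cK: "compact K"
    unfolding K_def by (rule compact_continuous_image[OF continuous_on_subset[OF contS]]) auto
  then obtain R0 where R0: "\<forall>w\<in>K. cmod w \<le> R0"
    using compact_imp_bounded[OF cK] unfolding bounded_iff by blast
  define R where "R = max R0 1"
  define U where "U = F ` {z. M + 1 < cmod z}"
  define V where "V = {w::complex. R < cmod w}"
  have oset: "open {z::complex. M + 1 < cmod z}" by (intro open_Collect_less continuous_intros)
  have "open U"
    unfolding U_def
    by (rule invariance_of_domain[OF continuous_on_subset[OF cont] oset inj_on_subset[OF inj]]) auto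
  have inf: "\<exists>b. \<forall>z. b \<le> cmod z \<longrightarrow> B < cmod (F z)" for B
    using filterlim_at_infinity_imp_norm_at_top[OF F_inf]
    unfolding filterlim_at_top_dense eventually_at_infinity by blast
  have "closed (F ` {z. M + 1 \<le> cmod z})"
    unfolding closed_sequential_limits
  proof (intro allI impI)
    fix x l assume x: "(\<forall>n. x n \<in> F ` {z. M + 1 \<le> cmod z}) \<and> x \<longlonglongrightarrow> l"
    then obtain z where z: "\<And>n. M + 1 \<le> cmod (z n)" "\<And>n. x n = F (z n)" by (auto simp: image_iff) metis
    have "bounded (range x)" using x by (intro convergent_imp_bounded) (auto simp: convergent_def)
    then obtain B where B: "\<And>n. cmod (x n) \<le> B" by (auto simp: bounded_iff)
    obtain b where b: "\<And>z. b \<le> cmod z \<Longrightarrow> B < cmod (F z)" using inf by blast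
    have zb: "z n \<in> cball 0 b - ball 0 (M + 1)" for n
      using b[of "z n"] B[of n] z by (force simp: not_less)
    have "compact (cball 0 b - ball 0 (M + 1) :: complex set)" by (intro compact_diff) auto
    then obtain p r where p: "p \<in> cball 0 b - ball 0 (M + 1)" and r: "strict_mono r" "(z \<circ> r) \<longlonglongrightarrow> p"
      using zb unfolding compact_def by blast
    have pM: "M + 1 \<le> cmod p" using p by auto
    have "(\<lambda>n. F ((z \<circ> r) n)) \<longlonglongrightarrow> F p"
      by (rule continuous_on_tendsto_compose[OF contS r(2)]) (use pM z in auto)
    moreover have "(x \<circ> r) \<longlonglongrightarrow> l" using x r LIMSEQ_subseq_LIMSEQ by blast
    ultimately have "l = F p" using z by (auto simp: o_def intro: LIMSEQ_unique)
    then show "l \<in> F ` {z. M + 1 \<le> cmod z}" using pM by blast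
  qed
  moreover have "V \<inter> F ` {z. M + 1 \<le> cmod z} = V \<inter> U"
  proof -
    have "F z \<notin> V" if "cmod z = M + 1" for z
    proof -
      have "F z \<in> K" unfolding K_def using that by (intro imageI) (simp add: dist_norm)
      then show ?thesis using R0 by (auto simp: V_def R_def not_less)
    qed
    then show ?thesis unfolding U_def by (auto simp: order_le_less)
  qed
  ultimately have cl: "closedin (top_of_set V) (V \<inter> U)" by (metis closedin_closed_Int)
  have op: "openin (top_of_set V) (V \<inter> U)" using \<open>open U\<close> by (rule openin_open_Int)
  have "connected V"
  proof -
    have "V = - cball 0 R" by (auto simp: V_def)
    then show ?thesis using connected_complement_bounded_convex[of "cball (0::complex) R"] by simp
  qed
  moreover have "V \<inter> U \<noteq> {}"
  proof -
    obtain b where b: "\<And>z. b \<le> cmod z \<Longrightarrow> R < cmod (F z)" using inf by blast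
    define z where "z = complex_of_real (max b (M + 2))"
    have "cmod z = max b (M + 2)" using M by (simp add: z_def)
    then have "F z \<in> V \<inter> U" using b[of z] by (auto simp: U_def V_def)
    then show ?thesis by blast
  qed
  ultimately have "V \<inter> U = V" using cl op unfolding connected_clopen by blast
  moreover have "U \<subseteq> F ` {z. M < cmod z}" unfolding U_def by (rule image_mono) auto
  ultimately have "V \<subseteq> F ` {z. M < cmod z}" by blast
  then show thesis using that[of R] by (simp add: V_def R_def)
qed

text \<open>\<open>separation_bound\<close> is applied to preimages of sets drawn in the image
  plane: a segment from \<open>F a\<close>, and a ray from \<open>F b\<close> that recedes from
  \<open>F a\<close>. The second estimate takes over when \<open>F c\<close> is far from
  \<open>F a\<close>.\<close>

lemma quasisymmetry_at_infinity:
  assumes \<delta>: "0 < \<delta>"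
  obtains C R where "0 < C" "M < R"
    "\<And>a b c. R < cmod a \<Longrightarrow> cmod (b - a) \<le> \<delta> / 4 \<Longrightarrow> M < cmod c \<Longrightarrow> \<delta> \<le> cmod (c - a) \<Longrightarrow>
       cmod (F b - F a) \<le> C * cmod (F c - F a)"
    "\<And>a b. R < cmod a \<Longrightarrow> cmod (b - a) \<le> \<delta> / 4 \<Longrightarrow> cmod (F b - F a) \<le> C * cmod (F a)"
proof -
  let ?\<Omega> = "{z. M < cmod z}"
  obtain R1 where R1: "0 < R1" "{w. R1 < cmod w} \<subseteq> F ` ?\<Omega>" by (rule image_contains_nhd_of_infinity)
  have cpt: "compact (F_inv ` sphere 0 (R1 + 1))"
    using R1 by (intro compact_continuous_image continuous_on_subset[OF continuous_F_inv]) auto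
  then obtain R2 where "\<forall>x\<in>F_inv ` sphere 0 (R1 + 1). cmod x \<le> R2"
    using compact_imp_bounded[OF cpt] unfolding bounded_iff by blast
  then have R2: "cmod (F_inv w) \<le> R2" if "cmod w = R1 + 1" for w
    using that by simp
  obtain R3 where R3: "\<And>z. R3 \<le> cmod z \<Longrightarrow> 2 * R1 + 2 < cmod (F z)"
    using filterlim_at_infinity_imp_norm_at_top[OF F_inf]
    unfolding filterlim_at_top_dense eventually_at_infinity by blast
  \<comment> \<open>If |a| exceeds \<open>R\<close>, the ball of radius 2\<delta> about
    \<open>a\<close> lies in the domain, \<open>a\<close> is further than \<delta> from the
    preimages of the circle of radius R1 + 1, and |F| exceeds 2 R1 + 2 even within \<delta> of
    \<open>a\<close>.\<close>
  define R where "R = max (max (M + 2 * \<delta>) (R2 + \<delta>)) (R3 + \<delta>)"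
  have core: "cmod (F b - F a) \<le> qs_const * \<rho>"
    if a: "R < cmod a" and b: "cmod (b - a) \<le> \<delta> / 4" and \<rho>: "0 < \<rho>"
      and S: "connected S" "F a \<in> S" "S \<subseteq> cball (F a) \<rho>" "S \<subseteq> {w. R1 < cmod w}"
      and e: "\<exists>e\<in>S. \<delta> \<le> cmod (F_inv e - a)" for a b \<rho> S
  proof (cases "b = a")
    case False
    have am: "cmod a - cmod (x - a) \<le> cmod x" for x
      using norm_triangle_ineq2[of a "a - x"] by (simp add: norm_minus_commute)
    have box: "ball a (2 * \<delta>) \<subseteq> ?\<Omega>"
    proof
      fix z assume "z \<in> ball a (2 * \<delta>)"
      then have "cmod (z - a) < 2 * \<delta>" by (simp add: dist_norm norm_minus_commute)
      then show "z \<in> ?\<Omega>" using am[of z] a by (auto simp: R_def)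
    qed
    have ab: "a \<in> ?\<Omega>" "b \<in> ?\<Omega>" using box b \<delta> by (auto simp: subset_iff dist_norm norm_minus_commute)
    have Fb: "2 * R1 + 2 < cmod (F b)" using R3[of b] am[of b] a b \<delta> by (auto simp: R_def)
    define l where "l = cmod (F b - F a)"
    have l0: "0 < l" using inj_onD[OF inj _ ab(2,1)] False by (auto simp: l_def)
    define u1 where "u1 = F b /\<^sub>R cmod (F b)"
    define u2 where "u2 = (F b - F a) /\<^sub>R l"
    have Fb0: "F b \<noteq> 0" using Fb R1(1) by auto
    have u12: "norm u1 = 1" "norm u2 = 1" using Fb0 l0 by (simp_all add: u1_def u2_def l_def)
    have Fb_eq: "F b = cmod (F b) *\<^sub>R u1" "F b - F a = l *\<^sub>R u2"
      using Fb0 l0 by (auto simp: u1_def u2_def)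
    \<comment> \<open>The ray must stay where \<open>F_inv\<close> is defined and at distance at
      least \<open>l\<close> from \<open>F a\<close>. Both moduli increase along it if
      \<open>d\<close> makes no obtuse angle with \<open>u1\<close> and \<open>u2\<close>. Their sum
      has this property, and a normal does when they are opposite.\<close>
    obtain d where d: "d \<noteq> 0" "0 \<le> d \<bullet> u1" "0 \<le> d \<bullet> u2"
    proof (cases "u1 + u2 = 0")
      case True
      then have "u2 = - u1" by (simp add: eq_neg_iff_add_eq_0 add.commute)
      moreover have "(\<i> * u1) \<bullet> u1 = 0" by (simp add: inner_complex_def)
      moreover have "\<i> * u1 \<noteq> 0" using u12 by auto
      ultimately show thesis using that[of "\<i> * u1"] by (simp add: inner_minus_right)
    next
      case False
      have "\<bar>u1 \<bullet> u2\<bar> \<le> 1" using Cauchy_Schwarz_ineq2[of u1 u2] u12 by simp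
      moreover have "u1 \<bullet> u1 = 1" "u2 \<bullet> u2 = 1" using u12 by (simp_all add: norm_eq_1)
      ultimately show thesis using that[of "u1 + u2"] False
        by (simp add: inner_add_left inner_add_right inner_commute[of u2 u1])
    qed
    have dd: "0 \<le> d \<bullet> F b" "0 \<le> d \<bullet> (F b - F a)"
      using d l0 by (auto simp: Fb_eq(2)) (subst Fb_eq(1), simp)
    define p where "p s = F b + s *\<^sub>R d" for s :: real
    have mono: "norm v \<le> norm (v + s *\<^sub>R d)" if "0 \<le> d \<bullet> v" "0 \<le> s" for v s
    proof (rule power2_le_imp_le)
      have "(norm (v + s *\<^sub>R d))\<^sup>2 = (norm v)\<^sup>2 + 2 * s * (d \<bullet> v) + s\<^sup>2 * (norm d)\<^sup>2"
        unfolding power2_norm_eq_inner by (simp add: inner_add_left inner_add_right inner_commute power2_eq_square algebra_simps)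
      then show "(norm v)\<^sup>2 \<le> (norm (v + s *\<^sub>R d))\<^sup>2" using that by simp
    qed simp
    have pR: "R1 < cmod (p s)" if "0 \<le> s" for s
      using mono[OF dd(1) that] Fb R1 by (simp add: p_def)
    have pl: "l \<le> cmod (p s - F a)" if "0 \<le> s" for s
      using mono[OF dd(2) that] by (simp add: p_def l_def algebra_simps)
    have p\<Omega>: "p s \<in> F ` ?\<Omega>" if "0 \<le> s" for s using pR[OF that] R1(2) by auto
    define E where "E = F_inv ` S"
    define E' where "E' = (\<lambda>s. F_inv (p s)) ` {0..}"
    have S\<Omega>: "S \<subseteq> F ` ?\<Omega>" using S(4) R1(2) by blast
    obtain e where e': "e \<in> S" "\<delta> \<le> cmod (F_inv e - a)" using e by blast
    \<comment> \<open>Otherwise the preimage of the ray would remain in a compact ball on which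
      \<open>F\<close> is bounded, while the ray is unbounded.\<close>
    have "\<exists>s\<ge>0. \<delta> \<le> cmod (F_inv (p s) - a)"
    proof (rule ccontr)
      assume "\<not> ?thesis"
      then have *: "F_inv (p s) \<in> cball a \<delta>" if "0 \<le> s" for s
        using that by (force simp: dist_norm norm_minus_commute)
      have "cball a \<delta> \<subseteq> ball a (2 * \<delta>)" using \<delta> by auto
      then have "cball a \<delta> \<subseteq> ?\<Omega>" using box by (rule subset_trans)
      then have cptB: "compact (F ` cball a \<delta>)"
        by (intro compact_continuous_image continuous_on_subset[OF cont]) auto
      then obtain B where B: "\<forall>w\<in>F ` cball a \<delta>. cmod w \<le> B"
        using compact_imp_bounded[OF cptB] unfolding bounded_iff by blast
      have pB: "cmod (p s) \<le> B" if "0 \<le> s" for s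
      proof -
        have "F (F_inv (p s)) \<in> F ` cball a \<delta>" using *[OF that] by (rule imageI)
        then show ?thesis using B unfolding F_inv(2)[OF p\<Omega>[OF that]] by (rule bspec[rotated])
      qed
      define s where "s = (B + cmod (F b) + 1) / norm d"
      have "0 \<le> B" using pB[of 0] norm_ge_zero order_trans by blast
      then have s: "0 \<le> s" "s * norm d = B + cmod (F b) + 1" using d(1) by (auto simp: s_def)
      have "s * norm d \<le> cmod (p s) + cmod (F b)"
        using norm_triangle_ineq4[of "p s" "F b"] s(1) by (simp add: p_def)
      then show False using pB[OF s(1)] s(2) by simp
    qed
    then obtain s where s: "0 \<le> s" "\<delta> \<le> cmod (F_inv (p s) - a)" by blast
    have "l \<le> qs_const * \<rho>"
    proof (rule separation_bound[OF box \<delta> \<rho>, where E = E and E' = E' and c = "F a" and b = b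
          and e = "F_inv e" and e' = "F_inv (p s)"])
      show "connected E" unfolding E_def
        by (intro connected_continuous_image S continuous_on_subset[OF continuous_F_inv] S\<Omega>)
      show "a \<in> E" unfolding E_def using F_inv(3)[OF ab(1)] S(2) by (metis imageI)
      show "F_inv e \<in> E" using e' by (simp add: E_def)
      show "cmod (F z - F a) \<le> \<rho>" if zE: "z \<in> E" for z
      proof -
        obtain w where w: "w \<in> S" "z = F_inv w" using zE by (auto simp: E_def)
        then have "F z = w" using F_inv(2) S\<Omega> by blast
        then show ?thesis using w S(3) by (auto simp: dist_norm norm_minus_commute)
      qed
      show "connected E'"
      proof -
        have "continuous_on {0..} (\<lambda>s. F_inv (p s))"
          by (rule continuous_on_compose2[OF continuous_F_inv])
            (use p\<Omega> in \<open>auto simp: p_def intro!: continuous_intros\<close>)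
        then show ?thesis unfolding E'_def
          by (rule connected_continuous_image) (simp add: convex_connected)
      qed
      show "b \<in> E'" unfolding E'_def using F_inv(3)[OF ab(2)]
        by (intro image_eqI[of _ _ 0]) (auto simp: p_def)
      show "F_inv (p s) \<in> E'" using s by (simp add: E'_def)
      show "l \<le> cmod (F z - F a)" if "z \<in> E'" for z
        using that pl F_inv(2)[OF p\<Omega>] by (auto simp: E'_def)
    qed (use b e' s in auto)
    then show ?thesis by (simp add: l_def)
  qed (use qs_const_pos \<rho> in simp)
  \<comment> \<open>The segment runs radially from \<open>F a\<close> down to the circle of radius
    R1 + 1, whose preimage stays in a bounded set and so lies far from \<open>a\<close>.\<close>
  have second: "cmod (F b - F a) \<le> qs_const * cmod (F a)" if a: "R < cmod a" and b: "cmod (b - a) \<le> \<delta> / 4" for a b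
  proof -
    have Fa: "2 * R1 + 2 < cmod (F a)" using R3[of a] a \<delta> by (auto simp: R_def)
    define v where "v = ((R1 + 1) / cmod (F a)) *\<^sub>R F a"
    have "F a \<noteq> 0" using Fa R1(1) by auto
    then have nv: "cmod v = R1 + 1" using R1(1) by (simp add: v_def)
    have seg: "w = x *\<^sub>R F a \<Longrightarrow> (R1 + 1) / cmod (F a) \<le> x \<Longrightarrow> x \<le> 1 \<Longrightarrow> R1 < cmod w \<and> cmod (F a - w) \<le> cmod (F a)" for w x
    proof -
      assume w: "w = x *\<^sub>R F a" and x: "(R1 + 1) / cmod (F a) \<le> x" "x \<le> 1"
      have "0 < cmod (F a)" using Fa R1 by linarith
      then have "R1 + 1 \<le> x * cmod (F a)" using x(1) by (simp add: pos_divide_le_eq)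
      moreover have x0: "0 \<le> x" using x(1) R1 Fa by (smt (verit) divide_nonneg_nonneg norm_ge_zero)
      moreover have "F a - w = (1 - x) *\<^sub>R F a" using w by (simp add: scaleR_left_diff_distrib)
      then have "cmod (F a - w) = (1 - x) * cmod (F a)" using x by simp
      moreover have "(1 - x) * cmod (F a) \<le> 1 * cmod (F a)" using x0 by (intro mult_right_mono) auto
      ultimately show ?thesis using w by simp
    qed
    have P: "R1 < cmod w \<and> cmod (F a - w) \<le> cmod (F a)" if w: "w \<in> closed_segment (F a) v" for w
    proof -
      have "\<exists>t. 0 \<le> t \<and> t \<le> 1 \<and> w = (1 - t) *\<^sub>R F a + t *\<^sub>R v" using w by (simp only: in_segment(1))
      then obtain t where t: "0 \<le> t" "t \<le> 1" "w = (1 - t) *\<^sub>R F a + t *\<^sub>R v" by metis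
      define q where "q = (R1 + 1) / cmod (F a)"
      have q: "0 \<le> q" "q \<le> 1" using Fa R1 by (auto simp: q_def divide_le_eq)
      have "w = ((1 - t) + t * q) *\<^sub>R F a" unfolding t(3) v_def q_def by (simp add: scaleR_left_distrib)
      moreover have "q \<le> (1 - t) + t * q"
        using mult_nonneg_nonneg[of "1 - t" "1 - q"] t q by (simp add: algebra_simps)
      moreover have "(1 - t) + t * q \<le> 1" using t q mult_left_le[of q t] by simp
      ultimately show ?thesis using seg q_def by blast
    qed
    show ?thesis
    proof (rule core[OF a b, where S = "closed_segment (F a) v"])
      show "closed_segment (F a) v \<subseteq> cball (F a) (cmod (F a))" using P by (auto simp: dist_norm)
      show "closed_segment (F a) v \<subseteq> {w. R1 < cmod w}" using P by auto
      have "\<delta> \<le> cmod (F_inv v - a)"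
        using R2[OF nv] a norm_triangle_ineq2[of a "F_inv v"] by (auto simp: R_def norm_minus_commute)
      then show "\<exists>e\<in>closed_segment (F a) v. \<delta> \<le> cmod (F_inv e - a)" by auto
    qed (use Fa R1 in auto)
  qed
  \<comment> \<open>If \<open>F c\<close> is within |F a| / 2 of \<open>F a\<close>, the straight
    segment between them keeps away from the disc of radius \<open>R1\<close>. Otherwise |F a| is at
    most twice |F c - F a| and \<open>second\<close> is enough.\<close>
  have first: "cmod (F b - F a) \<le> 2 * qs_const * cmod (F c - F a)"
    if a: "R < cmod a" and b: "cmod (b - a) \<le> \<delta> / 4" and c: "M < cmod c" "\<delta> \<le> cmod (c - a)" for a b c
  proof (cases "cmod (F c - F a) \<le> cmod (F a) / 2")
    case True
    have Fa: "2 * R1 + 2 < cmod (F a)" using R3[of a] a \<delta> by (auto simp: R_def)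
    have ac: "a \<in> ?\<Omega>" "c \<in> ?\<Omega>" using a c \<delta> by (auto simp: R_def)
    have "c \<noteq> a" using c \<delta> by auto
    then have \<rho>: "0 < cmod (F c - F a)" using inj_onD[OF inj _ ac(2,1)] by auto
    have P: "w \<in> cball (F a) (cmod (F c - F a))" if w: "w \<in> closed_segment (F a) (F c)" for w
      using w convex_cball[of "F a" "cmod (F c - F a)"] closed_segment_subset[of "F a" "cball (F a) (cmod (F c - F a))" "F c"]
      by (auto simp: dist_norm norm_minus_commute)
    have "cmod (F b - F a) \<le> qs_const * cmod (F c - F a)"
    proof (rule core[OF a b \<rho>, where S = "closed_segment (F a) (F c)"])
      show "closed_segment (F a) (F c) \<subseteq> cball (F a) (cmod (F c - F a))" using P by blast
      show "closed_segment (F a) (F c) \<subseteq> {w. R1 < cmod w}"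
      proof
        fix w assume "w \<in> closed_segment (F a) (F c)"
        from P[OF this] have "cmod (F a - w) \<le> cmod (F a) / 2" using True by (simp add: dist_norm)
        then show "w \<in> {w. R1 < cmod w}" using norm_triangle_ineq2[of "F a" w] Fa by simp
      qed
      show "\<exists>e\<in>closed_segment (F a) (F c). \<delta> \<le> cmod (F_inv e - a)"
        using F_inv(3)[OF ac(2)] c by (intro bexI[of _ "F c"]) auto
    qed auto
    also have "\<dots> \<le> 2 * qs_const * cmod (F c - F a)" using qs_const_pos by (intro mult_right_mono) auto
    finally show ?thesis .
  next
    case False
    have "cmod (F b - F a) \<le> qs_const * cmod (F a)" by (rule second[OF a b])
    also have "\<dots> \<le> qs_const * (2 * cmod (F c - F a))" using False qs_const_pos by (intro mult_left_mono) auto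
    finally show ?thesis by simp
  qed
  show thesis
  proof (rule that[of "2 * qs_const" R])
    show "M < R" using \<delta> by (auto simp: R_def)
    show "cmod (F b - F a) \<le> 2 * qs_const * cmod (F a)" if "R < cmod a" "cmod (b - a) \<le> \<delta> / 4" for a b
      by (rule order_trans[OF second[OF that] mult_right_mono]) (use qs_const_pos in auto)
  qed (use first qs_const_pos in auto)
qed

end

lemma qc_map_at_infinityI:
  assumes "quasiconformal_on F {z. M < cmod z}" "0 < M" "filterlim F at_infinity at_infinity"
  obtains k where "qc_map_at_infinity F M k"
proof -
  obtain g k where gk: "homeomorphism {z. M < cmod z} (F ` {z. M < cmod z}) F g"
    "0 \<le> k" "k < 1"
    "AE z in lebesgue. z \<in> {z. M < cmod z} \<longrightarrow>
          (\<exists>a b. ((\<lambda>s. F (z + of_real s)) has_vector_derivative a) (at 0) \<and>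
                 ((\<lambda>s. F (z + \<i> * of_real s)) has_vector_derivative b) (at 0) \<and>
                 cmod ((a + \<i> * b) / 2) \<le> k * cmod ((a - \<i> * b) / 2))"
    and op: "open {z::complex. M < cmod z}" and acl: "ACL_on F {z. M < cmod z}"
    using assms(1) unfolding quasiconformal_on_def by blast
  have "inj_on F {z. M < cmod z}"
    using gk(1) by (metis homeomorphism_apply1 inj_on_inverseI)
  then have "qc_map_at_infinity F M k"
    using gk op acl assms(2,3) homeomorphism_cont1[OF gk(1)]
    by (simp add: qc_map_at_infinity_def qc_map_def qc_map_at_infinity_axioms_def)
  then show thesis by (rule that)
qed

section \<open>Weak quasisymmetry and univalence\<close>

lemma weakly_quasisymmetric:
  assumes ext: "continuous_on {z. 0 \<le> Re z} g" "inj_on g {z. 0 \<le> Re z}" "\<And>z. z \<in> right_half_plane \<Longrightarrow> g z = h z"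
    and inf: "filterlim h at_infinity (inf at_infinity (principal right_half_plane))"
    and B: "locally_qc_extendible_at_infinity h" and \<delta>: "0 < \<delta>"
  shows "\<exists>C>0. weakly_quasisymmetric_at h \<delta> C"
proof -
  let ?H = right_half_plane and ?P = "{z::complex. 0 \<le> Re z}"
  obtain M F where MF: "0 < M" "quasiconformal_on F {z. M < cmod z}"
    "\<And>z. z \<in> ?H \<Longrightarrow> M < cmod z \<Longrightarrow> F z = h z" "filterlim F at_infinity at_infinity"
    using B unfolding locally_qc_extendible_at_infinity_def by blast
  obtain k where k: "qc_map_at_infinity F M k"
    using qc_map_at_infinityI[OF MF(2,1,4)] by blast
  obtain C1 R where C1: "0 < C1" "M < R"
    "\<And>a b c. R < cmod a \<Longrightarrow> cmod (b - a) \<le> \<delta> / 4 \<Longrightarrow> M < cmod c \<Longrightarrow> \<delta> \<le> cmod (c - a) \<Longrightarrow>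
       cmod (F b - F a) \<le> C1 * cmod (F c - F a)"
    "\<And>a b. R < cmod a \<Longrightarrow> cmod (b - a) \<le> \<delta> / 4 \<Longrightarrow> cmod (F b - F a) \<le> C1 * cmod (F a)"
    using qc_map_at_infinity.quasisymmetry_at_infinity[OF k \<delta>] by blast
  have HP: "?H \<subseteq> ?P" by (auto simp: right_half_plane_def)
  have closedP: "closed ?P" by (rule closed_halfspace_Re_ge)
  have bdd: "\<exists>B>0. \<forall>z\<in>?H. cmod z \<le> r \<longrightarrow> cmod (h z) \<le> B" for r
  proof -
    have cptB: "compact (g ` (?P \<inter> cball 0 r))"
      using closedP by (intro compact_continuous_image continuous_on_subset[OF ext(1)]) (auto intro: closed_Int_compact)
    then obtain B where B: "0 < B" "\<forall>w\<in>g ` (?P \<inter> cball 0 r). cmod w \<le> B"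
      using compact_imp_bounded[OF cptB] unfolding bounded_pos by blast
    have "cmod (h z) \<le> B" if "z \<in> ?H" "cmod z \<le> r" for z
    proof -
      have "z \<in> ?P \<inter> cball 0 r" using that HP by auto
      then have "cmod (g z) \<le> B" using B(2) by blast
      then show ?thesis using ext(3)[OF that(1)] by simp
    qed
    then show ?thesis using B(1) by blast
  qed
  have far: "\<exists>r. \<forall>z\<in>?H. r \<le> cmod z \<longrightarrow> K < cmod (h z)" for K
    using filterlim_at_infinity_imp_norm_at_top[OF inf]
    unfolding filterlim_at_top_dense eventually_inf_principal eventually_at_infinity by blast
  obtain B1 where B1: "0 < B1" "\<And>z. z \<in> ?H \<Longrightarrow> cmod z \<le> M \<Longrightarrow> cmod (h z) \<le> B1" using bdd by blast
  \<comment> \<open>For |w| at most \<open>M\<close> the extension gives no information on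
    \<open>h w\<close>. There |h z| exceeds 2 |h w|, so |h w - h z| is at least |h z| / 2.\<close>
  obtain r1 where r1: "\<And>z. z \<in> ?H \<Longrightarrow> r1 \<le> cmod z \<Longrightarrow> 2 * B1 < cmod (h z)" using far by blast
  define R' where "R' = max (R + \<delta>) r1"
  have large: "cmod (h z' - h z) \<le> 2 * C1 * cmod (h w - h z)"
    if z: "z \<in> ?H" "R' < cmod z" and z': "z' \<in> ?H" "cmod (z' - z) \<le> \<delta> / 4" and w: "w \<in> ?H" "\<delta> \<le> cmod (w - z)" for z z' w
  proof -
    have zR: "R < cmod z" using z \<delta> by (auto simp: R'_def)
    have "cmod z - cmod (z' - z) \<le> cmod z'"
      using norm_triangle_ineq2[of z "z - z'"] by (simp add: norm_minus_commute)
    then have "M < cmod z'" using z z' \<delta> C1(2) by (auto simp: R'_def)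
    then have Fz: "F z = h z" "F z' = h z'" using MF(3) z z' zR C1(2) by auto
    show ?thesis
    proof (cases "M < cmod w")
      case True
      then have "cmod (h z' - h z) \<le> C1 * cmod (h w - h z)"
        using C1(3)[OF zR z'(2) True w(2)] MF(3)[OF w(1) True] Fz by simp
      also have "\<dots> \<le> 2 * C1 * cmod (h w - h z)" using C1(1) by (intro mult_right_mono) auto
      finally show ?thesis .
    next
      case False
      have "cmod (h w) \<le> B1" using B1(2)[OF w(1)] False by simp
      moreover have "2 * B1 < cmod (h z)" using r1[OF z(1)] z(2) by (simp add: R'_def)
      moreover have "cmod (h z) \<le> cmod (h w) + cmod (h w - h z)"
        by (metis norm_minus_commute norm_triangle_sub)
      ultimately have "cmod (h z) \<le> 2 * cmod (h w - h z)" by linarith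
      then have "C1 * cmod (h z) \<le> C1 * (2 * cmod (h w - h z))" using C1(1) by (intro mult_left_mono) auto
      then show ?thesis using C1(4)[OF zR z'(2)] Fz by simp
    qed
  qed
  obtain B2 where B2: "0 < B2" "\<And>z. z \<in> ?H \<Longrightarrow> cmod z \<le> R' + \<delta> \<Longrightarrow> cmod (h z) \<le> B2" using bdd by blast
  obtain r2 where r2: "\<And>z. z \<in> ?H \<Longrightarrow> r2 \<le> cmod z \<Longrightarrow> B2 + 1 < cmod (h z)" using far by blast
  \<comment> \<open>The pairs range over the closed half-plane, so that \<open>T\<close> is compact;
    the minimum is positive because \<open>g\<close> is injective up to the axis. When |w| is at
    least \<open>r2\<close> the size of \<open>h w\<close> gives the lower bound 1 directly.\<close>
  define T where "T = ((?P \<inter> cball 0 R') \<times> (?P \<inter> cball 0 r2)) \<inter> {p. \<delta> \<le> cmod (snd p - fst p)}"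
  have cT: "compact T"
    unfolding T_def
    by (intro compact_Int_closed compact_Times closed_Int_compact closedP compact_cball closed_Collect_le continuous_intros)
  have "\<exists>m>0. \<forall>p\<in>T. m \<le> cmod (g (snd p) - g (fst p))"
  proof (cases "T = {}")
    case False
    have "continuous_on T (\<lambda>p. cmod (g (snd p) - g (fst p)))"
      by (intro continuous_intros continuous_on_compose2[OF ext(1)]) (auto simp: T_def)
    then obtain p where p: "p \<in> T" "\<And>q. q \<in> T \<Longrightarrow> cmod (g (snd p) - g (fst p)) \<le> cmod (g (snd q) - g (fst q))"
      using continuous_attains_inf[OF cT False] by blast
    have "snd p \<noteq> fst p" using p(1) \<delta> by (auto simp: T_def)
    then have "g (snd p) \<noteq> g (fst p)" using p(1) inj_onD[OF ext(2)] by (auto simp: T_def)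
    then show ?thesis using p(2) by (intro exI[of _ "cmod (g (snd p) - g (fst p))"]) auto
  qed (intro exI[of _ 1], simp)
  then obtain m where m: "0 < m" "\<And>p. p \<in> T \<Longrightarrow> m \<le> cmod (g (snd p) - g (fst p))" by blast
  define C2 where "C2 = 2 * B2 / min m 1"
  have C2: "0 < C2" using m B2 by (simp add: C2_def)
  have small: "cmod (h z' - h z) \<le> C2 * cmod (h w - h z)"
    if z: "z \<in> ?H" "cmod z \<le> R'" and z': "z' \<in> ?H" "cmod (z' - z) \<le> \<delta> / 4" and w: "w \<in> ?H" "\<delta> \<le> cmod (w - z)" for z z' w
  proof -
    have hz: "cmod (h z) \<le> B2" using B2(2)[OF z(1)] z(2) \<delta> by simp
    have "cmod z' \<le> cmod z + cmod (z' - z)" by (rule norm_triangle_sub)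
    then have "cmod (h z') \<le> B2" using B2(2)[OF z'(1)] z(2) z'(2) \<delta> by simp
    then have num: "cmod (h z' - h z) \<le> 2 * B2" using hz norm_triangle_ineq4[of "h z'" "h z"] by simp
    have den: "min m 1 \<le> cmod (h w - h z)"
    proof (cases "r2 \<le> cmod w")
      case True
      then have "B2 + 1 < cmod (h w)" using r2 w by blast
      then show ?thesis using hz norm_triangle_ineq2[of "h w" "h z"] by simp
    next
      case False
      then have "(z, w) \<in> T" using z w HP by (auto simp: T_def)
      then show ?thesis using m(2)[of "(z, w)"] ext(3) z w by simp
    qed
    have "2 * B2 = C2 * min m 1" using m by (simp add: C2_def)
    also have "\<dots> \<le> C2 * cmod (h w - h z)" using den C2 by (intro mult_left_mono) auto
    finally show ?thesis using num by simp
  qed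
  define C where "C = max (2 * C1) C2"
  have "weakly_quasisymmetric_at h \<delta> C"
    unfolding weakly_quasisymmetric_at_def
  proof (intro ballI impI)
    fix z z' w assume *: "z \<in> ?H" "z' \<in> ?H" "w \<in> ?H" "cmod (z' - z) \<le> \<delta> / 4" "\<delta> \<le> cmod (w - z)"
    show "cmod (h z' - h z) \<le> C * cmod (h w - h z)"
    proof (cases "cmod z \<le> R'")
      case True
      have "cmod (h z' - h z) \<le> C2 * cmod (h w - h z)" by (rule small) (use * True in auto)
      also have "\<dots> \<le> C * cmod (h w - h z)" by (intro mult_right_mono) (auto simp: C_def)
      finally show ?thesis .
    next
      case False
      have "cmod (h z' - h z) \<le> 2 * C1 * cmod (h w - h z)" by (rule large) (use * False in auto)
      also have "\<dots> \<le> C * cmod (h w - h z)" by (intro mult_right_mono) (auto simp: C_def)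
      finally show ?thesis .
    qed
  qed
  moreover have "0 < C" using C2 by (simp add: C_def)
  ultimately show ?thesis by blast
qed

theorem theorem4p5:
  fixes h :: "complex \<Rightarrow> complex" and k \<tau>\<^sub>0 :: real
  assumes "univalent_on h right_half_plane"
    and "filterlim h at_infinity (inf at_infinity (principal right_half_plane))"
    and "jordan_domain (Some ` h ` right_half_plane)"
    and "schwarzian_vanishes_at_boundary h"
    and "locally_qc_extendible_at_infinity h"
    and "0 < k" and "k < 1"
    and "loewner_constant h k \<tau>\<^sub>0"
  shows "\<exists>\<tau>. 0 < \<tau> \<and> \<tau> \<le> \<tau>\<^sub>0 \<and>
           (\<forall>t\<in>{0..\<tau>}. univalent_on (h_family h t) right_half_plane)"
proof -
  obtain X where X: "0 < X" "\<And>z. z \<in> strip X \<Longrightarrow> (Re z)\<^sup>2 * cmod (schwarzian h z) \<le> 1/1000"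
    using small_schwarzian_near_boundary[OF assms(4)] by blast
  have h: "h holomorphic_on right_half_plane" "inj_on h right_half_plane"
    using assms(1) by (auto simp: univalent_on_def)
  interpret jordan_half_plane_map h X
    using h assms(2,3) X by unfold_locales (simp_all add: right_half_plane_def)
  obtain g where g: "continuous_on {z. 0 \<le> Re z} g" "inj_on g {z. 0 \<le> Re z}" "\<And>z. z \<in> H \<Longrightarrow> g z = h z"
    using boundary_extension by blast
  have qs: "\<exists>C>0. weakly_quasisymmetric_at h \<delta> C" if "0 < \<delta>" for \<delta>
    by (rule weakly_quasisymmetric[OF g(1,2) _ assms(2,5) that]) (simp add: g(3) right_half_plane_def)
  show ?thesis
    by (rule univalent_near_0[OF h assms(4) qs])
      (use assms(8) in \<open>auto simp: loewner_constant_def\<close>)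
qed

end
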